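(* Let $(\mathcal A,\mathscr D(\mathcal A))$ be a Lévy-type operator in $\mathbb R$ with characteristic triplet $(a,b,\Pi)$ and assume $\mathcal C_c^\infty(\mathbb R)\subset\mathscr D(\mathcal A)$. Let $\pi=(\nu,\mu,\rho)$ be a convenient decomposition of $\Pi$ and let $\eta$ be a positive Radon measure on $\mathbb R$ such that $a+a_\pi\in L^1_{\mathrm{loc}}(\eta)$, $b\in W^{1,1}_{\mathrm{loc}}(\eta)$, and $U^\pi(\eta),V^\pi(\eta),W^\pi(\eta)\in\mathcal D'^0$. Then $\eta$ is infinitesimally invariant for $(\mathcal A,\mathscr D(\mathcal A))$ if and only if there exist constants $c_1,c_2\in\mathbb R$ such that $\eta$ solves the Volterra–Fredholm integral equation $$F_1(x)\,\eta(dx)=\Big(F_2(x)+\int_{\mathbb R}\kappa_1(x,z)\,\eta(dz)+\int_{(0,x]}\kappa_2(x,z)\,\eta(dz)\Big)dx$$ with $F_1(x)=\frac12b(x)$, $F_2(x)=c_1x+c_2$, $$\kappa_1(x,z)=\begin{cases}-\int_{(0,x]}\int_{(0,u]}\nu(z,dy-z)\,du-\int_{(0,x]}\mathrm{sgn}(y-z)\,\widetilde\mu(z,y-z)\,dy-\widetilde{\overline\rho}(z,x-z),&x>0,\\-\int_{(x,0]}\int_{(u,0]}\nu(z,dy-z)\,du+\int_{(x,0]}\mathrm{sgn}(y-z)\,\widetilde\mu(z,y-z)\,dy-\widetilde{\overline\rho}(z,x-z),&x\le0,\end{cases}$$ $$\kappa_2(x,z)=a(z)+a_\pi(z)+\tfrac12b'(z)+(x-z)\,\nu(z,\mathbb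 R),$$ for all $x,z\in\mathbb R$.
   Context: **Lévy-type operators.** Let $\mathcal E$ be a Banach space of functions $f:\mathbb R\to\mathbb R$. A Lévy-type operator in $\mathbb R$ is a pair $(\mathcal A,\mathscr D(\mathcal A))$ with $\mathscr D(\mathcal A)\subset\mathcal E$ and $\mathcal A:\mathscr D(\mathcal A)\to\mathcal E$ of the form $$\mathcal Af(x)=a(x)f'(x)+\tfrac12(bf')'(x)+\int_{\mathbb R}\big(f(x+y)-f(x)-f'(x)y\mathbf 1_{\{|y|<1\}}\big)\Pi(x,dy),$$ where $a:\mathbb R\to\mathbb R$ and $b:\mathbb R\to[0,\infty)$ are Borel and $\Pi$ is a Lévy kernel: $\Pi(x,\cdot)$ is a Lévy measure on $\mathbb R$ for each $x$, $\Pi(\cdot,B)$ is Borel for each Borel $B$, $\Pi(x,\{0\})=0$. $(a,b,\Pi)$ is the characteristic triplet. A measure $\eta$ is infinitesimally invariant for $(\mathcal A,\mathscr D(\mathcal A))$ if $\mathcal Af\in L^1(\eta)$ and $\int\mathcal Af\,d\eta=0$ for all $f\in\mathcal C_c^\infty(\mathbb R)$. **Convenient decomposition.** $\pi=(\nu,\mu,\rho)$ is a convenient decomposition of $\Pi$ if there are non-negative continuous functions $h_\nu,h_\mu,h_\rho$ with $\nu=h_\nu\Pi$, $\mu=h_\mu\Pi$, $\rho=h_\rho\Pi$ (i.e. $\nu(x,dy)=h_\nu(y)\Pi(x,dy)$ etc.), $\Pi=\nu+\mu+\rho$, and for all $x$: $\nu(x,\mathbb R)<\infty$, $\int(1\wedge|y|)\mu(x,dy)<\infty$,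 $\int(|y|\wedge|y|^2)\rho(x,dy)<\infty$. Put $a_\pi(x)=-\int_{|y|<1}y\,\nu(x,dy)-\int_{|y|<1}y\,\mu(x,dy)+\int_{|y|\ge1}y\,\rho(x,dy)$. **Tails.** For a kernel $Q$ write $\widetilde Q(x,z)=Q(x,(z,\infty))$ for $z>0$, $\widetilde Q(x,z)=Q(x,(-\infty,z))$ for $z<0$, $\widetilde Q(x,0)=0$. In dimension one the integrated radial tail of $Q$ is $\overline Q(x,B)=\int_B\widetilde Q(x,z)\,dz$ and the double-integrated radial tail is $\overline{\overline Q}(x,B)=\int_B\widetilde{\overline Q}(x,z)\,dz$, where $\widetilde{\overline Q}$ is the tail function of the kernel $\overline Q$. **Jump functionals.** $\langle U^\pi(\eta),f\rangle=\int\big(\int f(x+y)\nu(x,dy)-f(x)\nu(x,\mathbb R)\big)\eta(dx)$, $\langle V^\pi(\eta),f\rangle=\int\int f(x+y)\,\mathrm{sgn}(y)\,\overline\mu(x,dy)\,\eta(dx)$, $\langle W^\pi(\eta),f\rangle=\int\int f(x+y)\,\overline{\overline\rho}(x,dy)\,\eta(dx)$. **Conventions.** $\mathcal D'^0$ is the space of distributions of order $0$ on $\mathbb R$ (equivalently, real-valued Radon measures, i.e. differences of two Radon measures). $b\in W^{1,1}_{\mathrm{loc}}(\eta)$ means that $b$ has a weak derivative $b'$ and $b,b'\in L^1_{\mathrm{loc}}(\eta)$. $\nu(z,dy-z)$ denotes the measure $B\mapsto\nu(z,B-z)$. For $x\le0$ the integral $\int_{(0,x]}\kappa_2(x,z)\eta(dz)$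 is interpreted as $-\int_{(x,0]}\kappa_2(x,z)\eta(dz)$. The integral equation is an equality of measures.
   Formalization: In κ₁ the μ-term has the opposite sign (+ for x>0, − for x≤0), since the printed sign makes the claim false; U, V, W ∈ D'^0 is read as: the defining integrals converge for every f ∈ C_c, not only smooth f, and give Radon measures. *)

theory Defs
  imports "HOL-Analysis.Analysis"
begin

section \<open>Radon measures, test functions, weak derivatives\<close>

definition radon_measure :: "real measure \<Rightarrow> bool" where
  "radon_measure \<eta> \<longleftrightarrow>
     sets \<eta> = sets borel \<and> (\<forall>K. compact K \<longrightarrow> emeasure \<eta> K < \<infinity>)"

definition L1_loc :: "real measure \<Rightarrow> (real \<Rightarrow> real) \<Rightarrow> bool" where
  "L1_loc \<eta> g \<longleftrightarrow>
     g \<in> borel_measurable borel \<and> (\<forall>K. compact K \<longrightarrow> set_integrable \<eta> K g)"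

definition Cc :: "(real \<Rightarrow> real) set" where
  "Cc = {f. continuous_on UNIV f \<and> compact (closure {x. f x \<noteq> 0})}"

definition Cc_smooth :: "(real \<Rightarrow> real) set" where
  "Cc_smooth = {f. (\<forall>n x. (deriv ^^ n) f field_differentiable at x) \<and>
                   compact (closure {x. f x \<noteq> 0})}"

definition has_weak_derivative :: "(real \<Rightarrow> real) \<Rightarrow> (real \<Rightarrow> real) \<Rightarrow> bool" where
  "has_weak_derivative u u' \<longleftrightarrow>
     L1_loc lborel u \<and> L1_loc lborel u' \<and>
     (\<forall>\<phi>\<in>Cc_smooth. (LBINT x. u x * deriv \<phi> x) = - (LBINT x. u' x * \<phi> x))"

text \<open>Membership of \<open>b\<close> in the local Sobolev space with respect to \<open>\<eta>\<close>. A weak derivative is only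
  determined up to Lebesgue null sets, which \<open>\<eta>\<close> may charge, so a Borel version \<open>b'\<close> is fixed
  once and for all; the same version enters the operator below.\<close>

definition W11_loc :: "real measure \<Rightarrow> (real \<Rightarrow> real) \<Rightarrow> (real \<Rightarrow> real) \<Rightarrow> bool" where
  "W11_loc \<eta> b b' \<longleftrightarrow> has_weak_derivative b b' \<and> L1_loc \<eta> b \<and> L1_loc \<eta> b'"


section \<open>Levy-type operators\<close>

definition banach_function_space ::
    "(real \<Rightarrow> real) set \<Rightarrow> ((real \<Rightarrow> real) \<Rightarrow> real) \<Rightarrow> bool" where
  "banach_function_space E N \<longleftrightarrow>
     (\<lambda>x. 0) \<in> E \<and>
     (\<forall>f\<in>E. \<forall>g\<in>E. (\<lambda>x. f x + g x) \<in> E \<and> N (\<lambda>x. f x + g x) \<le> N f + N g) \<and>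
     (\<forall>c. \<forall>f\<in>E. (\<lambda>x. c * f x) \<in> E \<and> N (\<lambda>x. c * f x) = \<bar>c\<bar> * N f) \<and>
     (\<forall>f\<in>E. 0 \<le> N f \<and> (N f = 0 \<longleftrightarrow> f = (\<lambda>x. 0))) \<and>
     Metric_space.mcomplete E (\<lambda>f g. N (\<lambda>x. f x - g x))"

definition levy_measure :: "real measure \<Rightarrow> bool" where
  "levy_measure m \<longleftrightarrow>
     sets m = sets borel \<and> emeasure m {0} = 0 \<and>
     (\<integral>\<^sup>+ y. ennreal (min 1 (y\<^sup>2)) \<partial>m) < \<infinity>"

definition levy_kernel :: "(real \<Rightarrow> real measure) \<Rightarrow> bool" where
  "levy_kernel \<Lambda> \<longleftrightarrow>
     (\<forall>x. levy_measure (\<Lambda> x)) \<and>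
     (\<forall>B\<in>sets borel. (\<lambda>x. emeasure (\<Lambda> x) B) \<in> borel_measurable borel)"

text \<open>\<open>g\<close> is the function \<open>(b f')'\<close>. For twice continuously differentiable \<open>f\<close>, in particular for
  test functions, it is the version \<open>b' f' + b f''\<close> given by the product rule.\<close>

definition divergence_term ::
    "(real \<Rightarrow> real) \<Rightarrow> (real \<Rightarrow> real) \<Rightarrow> (real \<Rightarrow> real) \<Rightarrow> (real \<Rightarrow> real) \<Rightarrow> bool" where
  "divergence_term b b' f g \<longleftrightarrow>
     has_weak_derivative (\<lambda>x. b x * deriv f x) g \<and>
     ((\<forall>x. deriv f field_differentiable at x) \<and> continuous_on UNIV (deriv (deriv f)) \<longrightarrow>
        (\<forall>x. g x = b' x * deriv f x + b x * deriv (deriv f) x))"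

definition jump_integrand :: "(real \<Rightarrow> real) \<Rightarrow> real \<Rightarrow> real \<Rightarrow> real" where
  "jump_integrand f x y = f (x + y) - f x - deriv f x * y * indicator {y. \<bar>y\<bar> < 1} y"

definition levy_type_operator ::
    "(real \<Rightarrow> real) set \<Rightarrow> ((real \<Rightarrow> real) \<Rightarrow> real) \<Rightarrow>
     (real \<Rightarrow> real) set \<Rightarrow> ((real \<Rightarrow> real) \<Rightarrow> real \<Rightarrow> real) \<Rightarrow>
     (real \<Rightarrow> real) \<Rightarrow> (real \<Rightarrow> real) \<Rightarrow> (real \<Rightarrow> real) \<Rightarrow> (real \<Rightarrow> real measure) \<Rightarrow> bool" where
  "levy_type_operator E N D A a b b' \<Lambda> \<longleftrightarrow>
     banach_function_space E N \<and> D \<subseteq> E \<and> A ` D \<subseteq> E \<and>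
     a \<in> borel_measurable borel \<and> b \<in> borel_measurable borel \<and> (\<forall>x. 0 \<le> b x) \<and>
     levy_kernel \<Lambda> \<and>
     (\<forall>f\<in>D. (\<forall>x. f field_differentiable at x) \<and>
        (\<forall>x. integrable (\<Lambda> x) (jump_integrand f x)) \<and>
        (\<exists>g. divergence_term b b' f g \<and>
           (\<forall>x. A f x = a x * deriv f x + 1/2 * g x + (\<integral>y. jump_integrand f x y \<partial>\<Lambda> x))))"

definition infinitesimally_invariant ::
    "((real \<Rightarrow> real) \<Rightarrow> real \<Rightarrow> real) \<Rightarrow> real measure \<Rightarrow> bool" where
  "infinitesimally_invariant A \<eta> \<longleftrightarrow>
     (\<forall>f\<in>Cc_smooth. integrable \<eta> (A f) \<and> (\<integral>x. A f x \<partial>\<eta>) = 0)"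


section \<open>Convenient decompositions, tails and jump functionals\<close>

definition convenient_decomposition ::
    "(real \<Rightarrow> real measure) \<Rightarrow> (real \<Rightarrow> real measure) \<Rightarrow> (real \<Rightarrow> real measure) \<Rightarrow>
     (real \<Rightarrow> real measure) \<Rightarrow> bool" where
  "convenient_decomposition \<Lambda> \<nu> \<mu> \<rho> \<longleftrightarrow>
     (\<exists>h\<^sub>\<nu> h\<^sub>\<mu> h\<^sub>\<rho> :: real \<Rightarrow> real.
        continuous_on UNIV h\<^sub>\<nu> \<and> continuous_on UNIV h\<^sub>\<mu> \<and> continuous_on UNIV h\<^sub>\<rho> \<and>
        (\<forall>y. 0 \<le> h\<^sub>\<nu> y \<and> 0 \<le> h\<^sub>\<mu> y \<and> 0 \<le> h\<^sub>\<rho> y) \<and>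
        (\<forall>x. \<nu> x = density (\<Lambda> x) (\<lambda>y. ennreal (h\<^sub>\<nu> y)) \<and>
             \<mu> x = density (\<Lambda> x) (\<lambda>y. ennreal (h\<^sub>\<mu> y)) \<and>
             \<rho> x = density (\<Lambda> x) (\<lambda>y. ennreal (h\<^sub>\<rho> y)))) \<and>
     (\<forall>x. \<forall>B\<in>sets borel.
        emeasure (\<Lambda> x) B = emeasure (\<nu> x) B + emeasure (\<mu> x) B + emeasure (\<rho> x) B) \<and>
     (\<forall>x. emeasure (\<nu> x) UNIV < \<infinity> \<and>
          (\<integral>\<^sup>+ y. ennreal (min 1 \<bar>y\<bar>) \<partial>\<mu> x) < \<infinity> \<and>
          (\<integral>\<^sup>+ y. ennreal (min \<bar>y\<bar> (\<bar>y\<bar>\<^sup>2)) \<partial>\<rho> x) < \<infinity>)"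

definition drift_correction ::
    "(real \<Rightarrow> real measure) \<Rightarrow> (real \<Rightarrow> real measure) \<Rightarrow> (real \<Rightarrow> real measure) \<Rightarrow> real \<Rightarrow> real" where
  "drift_correction \<nu> \<mu> \<rho> x =
     - (LINT y:{y. \<bar>y\<bar> < 1}|\<nu> x. y) - (LINT y:{y. \<bar>y\<bar> < 1}|\<mu> x. y)
     + (LINT y:{y. 1 \<le> \<bar>y\<bar>}|\<rho> x. y)"

definition tail :: "(real \<Rightarrow> real measure) \<Rightarrow> real \<Rightarrow> real \<Rightarrow> ennreal" where
  "tail Q x z =
     (if z > 0 then emeasure (Q x) {z<..} else if z < 0 then emeasure (Q x) {..<z} else 0)"

definition integrated_tail :: "(real \<Rightarrow> real measure) \<Rightarrow> real \<Rightarrow> real measure" where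
  "integrated_tail Q x = density lborel (tail Q x)"

definition double_integrated_tail :: "(real \<Rightarrow> real measure) \<Rightarrow> real \<Rightarrow> real measure" where
  "double_integrated_tail Q = integrated_tail (integrated_tail Q)"

text \<open>The integrands, as functions of \<open>x\<close>, of the outer \<open>\<eta>\<close>-integrals that define the jump
  functionals.\<close>

definition U_integrand :: "(real \<Rightarrow> real measure) \<Rightarrow> (real \<Rightarrow> real) \<Rightarrow> real \<Rightarrow> real" where
  "U_integrand \<nu> f x = (\<integral>y. f (x + y) \<partial>\<nu> x) - f x * measure (\<nu> x) UNIV"

definition V_integrand :: "(real \<Rightarrow> real measure) \<Rightarrow> (real \<Rightarrow> real) \<Rightarrow> real \<Rightarrow> real" where
  "V_integrand \<mu> f x = (\<integral>y. f (x + y) * sgn y \<partial>integrated_tail \<mu> x)"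

definition W_integrand :: "(real \<Rightarrow> real measure) \<Rightarrow> (real \<Rightarrow> real) \<Rightarrow> real \<Rightarrow> real" where
  "W_integrand \<rho> f x = (\<integral>y. f (x + y) \<partial>double_integrated_tail \<rho> x)"

text \<open>The functional \<open>f \<mapsto> \<integral> T f d\<eta>\<close> is a distribution of order \<open>0\<close>, that is, a difference of two
  Radon measures. Such a distribution is a functional on the continuous functions with compact
  support, so the defining integral has to converge, and to agree with the real-valued Radon
  measure, for all of these, not only for the smooth ones. The distinction matters: for
  \<open>\<nu> x = |x|\<^sup>-\<^sup>1 \<delta>\<^sub>(\<^sub>-\<^sub>2\<^sub>x\<^sub>)\<close> (\<open>x \<noteq> 0\<close>) and \<open>\<eta>\<close> Lebesgue measure,
  the integral defining \<open>U\<close> converges to \<open>0\<close> for all test functions, but the kernels of the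
  integral equation are not \<open>\<eta>\<close>-integrable.\<close>

definition order_zero :: "((real \<Rightarrow> real) \<Rightarrow> real \<Rightarrow> real) \<Rightarrow> real measure \<Rightarrow> bool" where
  "order_zero T \<eta> \<longleftrightarrow>
     (\<exists>m\<^sub>1 m\<^sub>2. radon_measure m\<^sub>1 \<and> radon_measure m\<^sub>2 \<and>
        (\<forall>f\<in>Cc. integrable \<eta> (T f) \<and>
           (\<integral>x. T f x \<partial>\<eta>) = (\<integral>x. f x \<partial>m\<^sub>1) - (\<integral>x. f x \<partial>m\<^sub>2)))"


section \<open>The Volterra-Fredholm equation\<close>

text \<open>The measure \<open>\<nu>(z, dy - z)\<close>, which maps \<open>B\<close> to \<open>\<nu>(z, B - z)\<close>.\<close>

definition shifted :: "(real \<Rightarrow> real measure) \<Rightarrow> real \<Rightarrow> real measure" where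
  "shifted \<nu> z = distr (\<nu> z) borel (\<lambda>y. y + z)"

text \<open>The sign of the \<open>\<mu>\<close>-term is dictated by \<open>\<langle>V, f'\<rangle> = \<integral>\<integral> (f(x+y) - f(x)) \<mu>(x,dy) \<eta>(dx)\<close>: small
  positive jumps act like a positive drift, which enters the second kernel with a plus sign. With
  the opposite sign, found in print, the characterization fails, for instance for \<open>b = 0\<close>,
  \<open>a = -2\<close>, \<open>\<mu> x = \<Lambda> x = \<delta>\<^sub>1\<close> and \<open>\<eta>(dx) = exp(l x) dx\<close>, where \<open>l < 0\<close> solves
  \<open>2 l + exp(-l) - 1 = 0\<close>.\<close>

definition kernel1 ::
    "(real \<Rightarrow> real measure) \<Rightarrow> (real \<Rightarrow> real measure) \<Rightarrow> (real \<Rightarrow> real measure) \<Rightarrow>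
     real \<Rightarrow> real \<Rightarrow> real" where
  "kernel1 \<nu> \<mu> \<rho> x z =
     (if x > 0 then
        - (LBINT u:{0<..x}. measure (shifted \<nu> z) {0<..u})
        + (LBINT y:{0<..x}. sgn (y - z) * enn2real (tail \<mu> z (y - z)))
        - enn2real (tail (integrated_tail \<rho>) z (x - z))
      else
        - (LBINT u:{x<..0}. measure (shifted \<nu> z) {u<..0})
        - (LBINT y:{x<..0}. sgn (y - z) * enn2real (tail \<mu> z (y - z)))
        - enn2real (tail (integrated_tail \<rho>) z (x - z)))"

definition kernel2 ::
    "(real \<Rightarrow> real) \<Rightarrow> (real \<Rightarrow> real) \<Rightarrow>
     (real \<Rightarrow> real measure) \<Rightarrow> (real \<Rightarrow> real measure) \<Rightarrow> (real \<Rightarrow> real measure) \<Rightarrow>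
     real \<Rightarrow> real \<Rightarrow> real" where
  "kernel2 a b' \<nu> \<mu> \<rho> x z =
     a z + drift_correction \<nu> \<mu> \<rho> z + 1/2 * b' z + (x - z) * measure (\<nu> z) UNIV"

definition volterra_integral :: "real measure \<Rightarrow> real \<Rightarrow> (real \<Rightarrow> real) \<Rightarrow> real" where
  "volterra_integral \<eta> x k =
     (if x > 0 then (LINT z:{0<..x}|\<eta>. k z) else - (LINT z:{x<..0}|\<eta>. k z))"

text \<open>Both sides of the equation are real-valued Radon measures, so they are equal iff they agree
  on bounded Borel sets. All integrals are required to exist; those in \<open>z\<close> for almost every \<open>x\<close>,
  since their values matter only as a density in \<open>x\<close>.\<close>

definition solves_volterra_fredholm ::
    "real measure \<Rightarrow> (real \<Rightarrow> real) \<Rightarrow> (real \<Rightarrow> real) \<Rightarrow>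
     (real \<Rightarrow> real \<Rightarrow> real) \<Rightarrow> (real \<Rightarrow> real \<Rightarrow> real) \<Rightarrow> bool" where
  "solves_volterra_fredholm \<eta> F\<^sub>1 F\<^sub>2 \<kappa>\<^sub>1 \<kappa>\<^sub>2 \<longleftrightarrow>
     (AE x in lborel. integrable \<eta> (\<kappa>\<^sub>1 x) \<and> set_integrable \<eta> ({0<..x} \<union> {x<..0}) (\<kappa>\<^sub>2 x)) \<and>
     (let G = (\<lambda>x. F\<^sub>2 x + (\<integral>z. \<kappa>\<^sub>1 x z \<partial>\<eta>) + volterra_integral \<eta> x (\<kappa>\<^sub>2 x)) in
      \<forall>B\<in>sets borel. bounded B \<longrightarrow>
        set_integrable \<eta> B F\<^sub>1 \<and> set_integrable lborel B G \<and>
        (LINT x:B|\<eta>. F\<^sub>1 x) = (LBINT x:B. G x))"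

end

theory Submission
  imports Defs "HOL-Probability.Giry_Monad"
begin

text \<open>
  Write \<open>\<alpha> = a + a\<^sub>\<pi> + b'/2\<close>. For a test function \<open>f\<close>, the fundamental theorem of calculus and
  Tonelli's theorem turn the compensated jump integral into
  \<open>A f = \<alpha> f' + b f''/2 + U f + V f' + W f''\<close>, where \<open>U\<close>, \<open>V\<close>, \<open>W\<close> are the integrands of the jump
  functionals. Representing \<open>f(z)\<close> and \<open>f'(z)\<close> by integrals of \<open>f''\<close> over the points that lie
  beyond \<open>z\<close>, as seen from the origin, and exchanging the integrals, invariance says that
  \<open>b \<eta>/2\<close> minus the density given by the two kernels annihilates all second derivatives of test
  functions, that is, it is an affine density.

  The exchange needs integrability of the kernels, where the assumptions only give integrability of
  \<open>U f\<close>, \<open>V f\<close>, \<open>W f\<close> for each continuous \<open>f\<close> with compact support. By Baire's theorem the \<open>L\<^sup>1(\<eta>)\<close>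
  norms are then bounded uniformly in \<open>\<bar>f\<bar> \<le> 1\<close> with support in a fixed compact set. Fatou's lemma
  extends the bound for \<open>V\<close> to indicators of intervals, and testing \<open>U\<close> with oscillating functions
  shows that the total mass of \<open>\<nu>\<close> is locally \<open>\<eta>\<close>-integrable.
\<close>

section \<open>Kernels and tails\<close>

text \<open>Two exchanges of integrals are kept apart. For fixed \<open>z\<close>, the integrals
  over \<open>x\<close> and over the jump \<open>y\<close> may be exchanged because of the moment
  conditions in the convenient decomposition. The exchange of \<open>x\<close> with \<open>z\<close>
  rests on local integrability of the kernels after the integration in \<open>y\<close>. This order
  matters: the integrand of \<open>V\<close> carries \<open>sgn y\<close>, so a bound on
  \<open>V f\<close> controls no absolute integral in \<open>y\<close>, and absolute convergence in
  all three variables does not follow. For \<open>U\<close> the obstacle is the difference in its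
  definition. The equation puts the incoming jumps into the first kernel and the total mass into the
  second, and each has to be integrable by itself; this is what the local integrability of the mass
  is for. \<open>W\<close> has a positive kernel, so Tonelli's theorem is enough there. The two free
  constants come from the fact that second derivatives of test functions are exactly the test
  functions whose zeroth and first moments vanish.\<close>

lemma finite_kernel_nn_integral_measurable:
  fixes Q :: "'a \<Rightarrow> real measure"
  assumes sets: "\<And>z. sets (Q z) = sets borel"
    and meas: "\<And>B. B \<in> sets borel \<Longrightarrow> (\<lambda>z. emeasure (Q z) B) \<in> borel_measurable M"
    and fin: "\<And>z. emeasure (Q z) UNIV < \<infinity>"
    and g: "(\<lambda>(z, y). g z y) \<in> borel_measurable (M \<Otimes>\<^sub>M borel)"
  shows "(\<lambda>z. \<integral>\<^sup>+ y. g z y \<partial>Q z) \<in> borel_measurable M"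
proof -
  \<comment> \<open>Dividing by \<open>c\<close> gives a subprobability kernel, to which the
    measurability results of the Giry monad apply. The summand 1 keeps the divisor nonzero where
    \<open>Q z\<close> vanishes.\<close>
  define c where "c z = 1 + emeasure (Q z) UNIV" for z
  define P where "P z = scale_measure (inverse (c z)) (Q z)" for z
  have c: "c z \<noteq> 0" "c z < \<infinity>" for z using fin[of z] by (auto simp: c_def)
  have [measurable]: "c \<in> borel_measurable M" unfolding c_def[abs_def] using meas by measurable
  have "P \<in> measurable M (subprob_algebra borel)"
  proof (rule measurable_subprob_algebra)
    show "subprob_space (P z)" for z
    proof
      have sp: "space (P z) = UNIV"
        using sets_eq_imp_space_eq[of "P z" borel] sets[of z] by (simp add: P_def)
      have "inverse (c z) * emeasure (Q z) UNIV \<le> inverse (c z) * c z"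
        by (intro mult_left_mono) (auto simp: c_def)
      also have "\<dots> = 1" using c[of z] by (metis ennreal_inverse_mult infinity_ennreal_def mult.commute ennreal_divide_self divide_ennreal_def)
      finally show "emeasure (P z) (space (P z)) \<le> 1"
        unfolding sp by (simp add: P_def)
      show "space (P z) \<noteq> {}" by (simp add: sp)
    qed
    show "sets (P z) = sets borel" for z by (simp add: P_def sets)
    show "(\<lambda>z. emeasure (P z) B) \<in> borel_measurable M" if "B \<in> sets borel" for B
      using meas[OF that] by (simp add: P_def)
  qed
  then have "(\<lambda>z. \<integral>\<^sup>+ y. g z y \<partial>P z) \<in> borel_measurable M"
    by (rule nn_integral_measurable_subprob_algebra2[OF g])
  then have "(\<lambda>z. c z * (\<integral>\<^sup>+ y. g z y \<partial>P z)) \<in> borel_measurable M" by measurable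
  moreover have "c z * (\<integral>\<^sup>+ y. g z y \<partial>P z) = (\<integral>\<^sup>+ y. g z y \<partial>Q z)" if z: "z \<in> space M" for z
  proof -
    have "g z \<in> borel_measurable (Q z)"
      using measurable_Pair2[OF g z] by (simp add: measurable_cong_sets[OF sets refl])
    then have "c z * (\<integral>\<^sup>+ y. g z y \<partial>P z) = (c z * inverse (c z)) * (\<integral>\<^sup>+ y. g z y \<partial>Q z)"
      by (simp add: P_def nn_integral_scale_measure mult.assoc)
    also have "c z * inverse (c z) = 1"
      using c[of z] by (metis infinity_ennreal_def ennreal_divide_self divide_ennreal_def order_less_irrefl top.not_eq_extremum)
    finally show ?thesis by simp
  qed
  ultimately show ?thesis by (simp cong: measurable_cong_simp)
qed

text \<open>A Levy measure is finite away from the origin. The origin itself is put back in so that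
  these sets exhaust the line.\<close>

definition off_zero :: "nat \<Rightarrow> real set" where
  "off_zero n = {y. y = 0 \<or> 1 / real (Suc n) \<le> \<bar>y\<bar>}"

lemma off_zero: "off_zero n \<in> sets borel" "incseq off_zero" "(\<Union>n. off_zero n) = UNIV"
proof -
  show "off_zero n \<in> sets borel" unfolding off_zero_def by measurable
  show "incseq off_zero"
    by (rule incseq_SucI) (auto simp: off_zero_def field_simps intro: order_trans[rotated])
  show "(\<Union>n. off_zero n) = UNIV"
  proof (intro equalityI subsetI UNIV_I)
    fix y :: real
    show "y \<in> (\<Union>n. off_zero n)"
    proof (cases "y = 0")
      case False
      then obtain n where "inverse (real (Suc n)) < \<bar>y\<bar>" using reals_Archimedean[of "\<bar>y\<bar>"] by auto
      then show ?thesis by (auto simp: off_zero_def inverse_eq_divide intro!: exI[of _ n])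
    qed (auto simp: off_zero_def)
  qed
qed

text \<open>Chebyshev's inequality for the weight \<open>min 1 (y\<^sup>2)\<close>, which is at
  least \<open>1 / k\<^sup>2\<close> where \<open>\<bar>y\<bar> \<ge> 1 / k\<close>. The origin is
  covered by a separate indicator of integral 0.\<close>

lemma levy_measure_off_zero:
  assumes "levy_measure m" shows "emeasure m (off_zero n) < \<infinity>"
proof -
  have [measurable_cong]: "sets m = sets borel" using assms by (simp add: levy_measure_def)
  define k where "k = real (Suc n)"
  have k: "k > 0" by (simp add: k_def)
  have "emeasure m (off_zero n) = (\<integral>\<^sup>+ y. indicator (off_zero n) y \<partial>m)"
    using off_zero(1) \<open>sets m = _\<close> by simp
  also have "\<dots> \<le> (\<integral>\<^sup>+ y. ennreal (k\<^sup>2) * ennreal (min 1 (y\<^sup>2)) + indicator {0} y \<partial>m)"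
  proof (rule nn_integral_mono)
    fix y :: real
    show "indicator (off_zero n) y \<le> ennreal (k\<^sup>2) * ennreal (min 1 (y\<^sup>2)) + indicator {0} y"
    proof (cases "y = 0 \<or> y \<notin> off_zero n")
      case False
      then have "1 / k \<le> \<bar>y\<bar>" by (auto simp: off_zero_def k_def)
      then have y: "1 \<le> k * \<bar>y\<bar>" using k by (simp add: field_simps)
      have "1 \<le> k\<^sup>2" using k by (auto simp: k_def power2_eq_square intro!: mult_ge1_I)
      moreover have "1 \<le> k\<^sup>2 * y\<^sup>2" using power_mono[OF y, of 2] by (simp add: power_mult_distrib)
      ultimately have "1 \<le> k\<^sup>2 * min 1 (y\<^sup>2)" by (auto simp: min_def)
      then have "1 \<le> ennreal (k\<^sup>2 * min 1 (y\<^sup>2))" by (simp only: ennreal_1[symmetric] ennreal_leI)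
      then show ?thesis using False by (simp add: ennreal_mult'[symmetric])
    qed (auto simp: indicator_def)
  qed
  also have "\<dots> = ennreal (k\<^sup>2) * (\<integral>\<^sup>+ y. ennreal (min 1 (y\<^sup>2)) \<partial>m) + emeasure m {0}"
    by (subst nn_integral_add) (auto simp: nn_integral_cmult)
  also have "\<dots> < \<infinity>" using assms by (auto simp: levy_measure_def ennreal_mult_less_top)
  finally show ?thesis .
qed

lemma levy_measure_sigma_finite:
  assumes "levy_measure m" shows "sigma_finite_measure m"
proof
  have s: "sets m = sets borel" using assms by (simp add: levy_measure_def)
  show "\<exists>A. countable A \<and> A \<subseteq> sets m \<and> \<Union>A = space m \<and> (\<forall>a\<in>A. emeasure m a \<noteq> \<infinity>)"
    using off_zero levy_measure_off_zero[OF assms] s sets_eq_imp_space_eq[OF s]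
    by (intro exI[of _ "range off_zero"]) (auto simp: less_top)
qed

text \<open>Restriction to \<open>off_zero n\<close> makes the kernel finite, and monotone
  convergence removes the restriction. The map \<open>k\<close> allows the integrand to depend on
  further variables besides the base point, such as the pair (x, z) with the kernel taken at
  z.\<close>

lemma levy_kernel_nn_integral_measurable:
  fixes k :: "'a \<Rightarrow> real"
  assumes \<Lambda>: "levy_kernel \<Lambda>" and k: "k \<in> borel_measurable M"
    and g: "(\<lambda>(w, y). g w y) \<in> borel_measurable (M \<Otimes>\<^sub>M borel)"
  shows "(\<lambda>w. \<integral>\<^sup>+ y. g w y \<partial>\<Lambda> (k w)) \<in> borel_measurable M"
proof -
  have L: "levy_measure (\<Lambda> x)" for x using \<Lambda> by (simp add: levy_kernel_def)
  have s: "sets (\<Lambda> x) = sets borel" for x using L by (simp add: levy_measure_def)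
  note [measurable_cong] = s
  have gw: "g w \<in> borel_measurable borel" if "w \<in> space M" for w
    using measurable_Pair2[OF g that] by simp
  have "(\<lambda>w. \<integral>\<^sup>+ y. g w y \<partial>density (\<Lambda> (k w)) (indicator (off_zero n))) \<in> borel_measurable M" for n
  proof (rule finite_kernel_nn_integral_measurable[OF _ _ _ g])
    show "sets (density (\<Lambda> (k z)) (indicator (off_zero n))) = sets borel" for z by (simp add: s)
    have e: "emeasure (density (\<Lambda> x) (indicator (off_zero n))) B = emeasure (\<Lambda> x) (off_zero n \<inter> B)"
      if "B \<in> sets borel" for x B
      using that off_zero(1)[of n]
      by (subst emeasure_density) (auto simp: s indicator_inter_arith[symmetric])
    show "(\<lambda>z. emeasure (density (\<Lambda> (k z)) (indicator (off_zero n))) B) \<in> borel_measurable M"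
      if "B \<in> sets borel" for B
      unfolding e[OF that] using \<Lambda> that off_zero(1)[of n]
      by (intro measurable_compose[OF k]) (auto simp: levy_kernel_def)
    show "emeasure (density (\<Lambda> (k z)) (indicator (off_zero n))) UNIV < \<infinity>" for z
      using levy_measure_off_zero[OF L] by (simp add: e)
  qed
  then have "(\<lambda>w. SUP n. \<integral>\<^sup>+ y. g w y \<partial>density (\<Lambda> (k w)) (indicator (off_zero n))) \<in> borel_measurable M"
    by measurable
  moreover have "(SUP n. \<integral>\<^sup>+ y. g w y \<partial>density (\<Lambda> (k w)) (indicator (off_zero n))) = (\<integral>\<^sup>+ y. g w y \<partial>\<Lambda> (k w))"
    if w: "w \<in> space M" for w
  proof -
    note [measurable] = gw[OF w] off_zero(1)
    have "(SUP n. \<integral>\<^sup>+ y. g w y \<partial>density (\<Lambda> (k w)) (indicator (off_zero n))) =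
        (SUP n. \<integral>\<^sup>+ y. indicator (off_zero n) y * g w y \<partial>\<Lambda> (k w))"
      by (subst nn_integral_density) auto
    also have "\<dots> = (\<integral>\<^sup>+ y. (SUP n. indicator (off_zero n) y * g w y) \<partial>\<Lambda> (k w))"
    proof (intro nn_integral_monotone_convergence_SUP[symmetric])
      show "incseq (\<lambda>n y. indicator (off_zero n) y * g w y)"
        using off_zero(2) by (intro incseq_SucI le_funI mult_right_mono) (auto simp: incseq_Suc_iff indicator_def)
    qed auto
    also have "\<dots> = (\<integral>\<^sup>+ y. g w y \<partial>\<Lambda> (k w))"
    proof (rule nn_integral_cong)
      fix y
      obtain n where "y \<in> off_zero n" using off_zero(3) by blast
      then show "(SUP n. indicator (off_zero n) y * g w y) = g w y"
        by (intro antisym SUP_least SUP_upper2[of n]) (auto simp: indicator_def)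
    qed
    finally show ?thesis .
  qed
  ultimately show ?thesis by (simp cong: measurable_cong_simp)
qed

section \<open>Tails, integrated tails and increments\<close>

definition zbetween :: "real \<Rightarrow> real \<Rightarrow> bool" where
  "zbetween y t \<longleftrightarrow> 0 < t \<and> t < y \<or> y < t \<and> t < 0"

abbreviation "ind_between y t \<equiv> indicator {p. zbetween (fst p) (snd p)} (y, t)"

lemma zbetween_measurable[measurable]: "Measurable.pred (borel \<Otimes>\<^sub>M borel) (\<lambda>(y, t). zbetween y t)"
  unfolding zbetween_def by measurable

text \<open>A jump \<open>y\<close> counts for the tail at \<open>t\<close> iff \<open>t\<close>
  lies strictly between 0 and \<open>y\<close>. This single relation covers both half lines and
  \<open>t = 0\<close>, and it makes the tail an integral to which Tonelli's theorem
  applies.\<close>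

lemma tail_eq_nn_integral:
  assumes s: "sets (Q x) = sets borel"
  shows "tail Q x t = (\<integral>\<^sup>+ y. indicator {y. zbetween y t} y \<partial>Q x)"
proof -
  consider "t > 0" | "t < 0" | "t = 0" by linarith
  then show ?thesis
  proof cases
    case 1
    then have "{y. zbetween y t} = {t<..}" by (auto simp: zbetween_def)
    then show ?thesis using 1 s by (simp add: tail_def)
  next
    case 2
    then have "{y. zbetween y t} = {..<t}" by (auto simp: zbetween_def)
    then show ?thesis using 2 s by (simp add: tail_def)
  qed (simp add: tail_def zbetween_def)
qed

text \<open>Chebyshev's inequality again, for a weight \<open>w\<close> that is bounded below on the
  jumps beyond \<open>t\<close>. It serves \<open>\<mu>\<close>, \<open>\<rho>\<close> and the
  integrated tail of \<open>\<rho>\<close> with their respective weights.\<close>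

lemma tail_finite:
  assumes s: "sets (Q x) = sets borel" and w: "(\<integral>\<^sup>+ y. ennreal (w y) \<partial>Q x) < \<infinity>"
    and [measurable]: "w \<in> borel_measurable borel"
    and c: "c > 0" "\<And>y. zbetween y t \<Longrightarrow> c \<le> w y"
  shows "tail Q x t < top"
proof -
  note [measurable_cong] = s
  have "tail Q x t \<le> (\<integral>\<^sup>+ y. ennreal (1 / c) * ennreal (w y) \<partial>Q x)"
    unfolding tail_eq_nn_integral[of Q x t, OF s]
  proof (rule nn_integral_mono)
    fix y
    show "indicator {y. zbetween y t} y \<le> ennreal (1 / c) * ennreal (w y)"
    proof (cases "zbetween y t")
      case True
      then have "1 \<le> ennreal (1 / c * w y)"
        using c by (simp only: ennreal_1[symmetric]) (intro ennreal_leI, simp add: field_simps)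
      then show ?thesis using c by (simp add: indicator_def ennreal_mult'[symmetric])
    qed (simp add: indicator_def)
  qed
  also have "\<dots> = ennreal (1 / c) * (\<integral>\<^sup>+ y. ennreal (w y) \<partial>Q x)" by (simp add: nn_integral_cmult)
  also have "\<dots> < \<infinity>" using w by (simp add: ennreal_mult_less_top)
  finally show ?thesis by simp
qed

lemma tail_measurable:
  assumes s: "sets (Q x) = sets borel" and "sigma_finite_measure (Q x)"
  shows "tail Q x \<in> borel_measurable borel"
proof -
  interpret sigma_finite_measure "Q x" by fact
  note [measurable_cong] = s
  have "(\<lambda>t. \<integral>\<^sup>+ y. ind_between y t \<partial>Q x) \<in> borel_measurable borel"
    by measurable
  moreover have "tail Q x = (\<lambda>t. \<integral>\<^sup>+ y. ind_between y t \<partial>Q x)"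
    unfolding tail_eq_nn_integral[of Q x, OF s] fun_eq_iff
    by (intro allI nn_integral_cong) (simp add: indicator_def)
  ultimately show ?thesis by simp
qed

lemma sets_integrated_tail [simp, measurable_cong]: "sets (integrated_tail Q x) = sets borel"
  by (simp add: integrated_tail_def)

text \<open>By Tonelli's theorem, integrating over \<open>t\<close> with the tail as density amounts
  to integrating over the segment from 0 to \<open>y\<close>, for each jump
  \<open>y\<close>.\<close>

lemma nn_integral_integrated_tail:
  assumes s: "sets (Q x) = sets borel" and sf: "sigma_finite_measure (Q x)"
    and [measurable]: "\<phi> \<in> borel_measurable borel"
  shows "(\<integral>\<^sup>+ t. \<phi> t \<partial>integrated_tail Q x) =
    (\<integral>\<^sup>+ y. (\<integral>\<^sup>+ t. \<phi> t * indicator {t. zbetween y t} t \<partial>lborel) \<partial>Q x)"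
proof -
  interpret Q: sigma_finite_measure "Q x" by fact
  interpret pair_sigma_finite lborel "Q x" ..
  note [measurable_cong] = s
  note [measurable] = tail_measurable[of Q x, OF s sf]
  have "(\<integral>\<^sup>+ t. \<phi> t \<partial>integrated_tail Q x) = (\<integral>\<^sup>+ t. \<phi> t * tail Q x t \<partial>lborel)"
    unfolding integrated_tail_def by (subst nn_integral_density) (auto simp: mult.commute)
  also have "\<dots> = (\<integral>\<^sup>+ t. (\<integral>\<^sup>+ y. \<phi> t * ind_between y t \<partial>Q x) \<partial>lborel)"
  proof (intro nn_integral_cong)
    fix t
    have "\<phi> t * tail Q x t = (\<integral>\<^sup>+ y. \<phi> t * indicator {y. zbetween y t} y \<partial>Q x)"
      unfolding tail_eq_nn_integral[of Q x, OF s] by (rule nn_integral_cmult[symmetric]) measurable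
    also have "\<dots> = (\<integral>\<^sup>+ y. \<phi> t * ind_between y t \<partial>Q x)"
      by (intro nn_integral_cong) (simp add: indicator_def)
    finally show "\<phi> t * tail Q x t = (\<integral>\<^sup>+ y. \<phi> t * ind_between y t \<partial>Q x)" .
  qed
  also have "\<dots> = (\<integral>\<^sup>+ y. (\<integral>\<^sup>+ t. \<phi> t * ind_between y t \<partial>lborel) \<partial>Q x)"
    by (rule Fubini'[symmetric]) measurable
  finally show ?thesis by (simp add: indicator_def)
qed

lemma emeasure_zbetween: "emeasure lborel {t. zbetween y t} = ennreal \<bar>y\<bar>"
proof -
  have "{t. zbetween y t} = (if y > 0 then {0<..<y} else {y<..<0})" by (auto simp: zbetween_def)
  then show ?thesis by auto
qed

text \<open>The segment from 0 to \<open>y\<close> has length \<open>\<bar>y\<bar>\<close>, and only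
  its part in the support of \<open>g\<close> counts, so the inner integral is at most C min(|y|,
  2|R|). The constant \<open>D\<close> comes from min(|y|, 2|R|) \<le> max(1, 2|R|) min(1,
  |y|).\<close>

lemma integrated_tail_bound:
  assumes s: "sets (Q x) = sets borel" and sf: "sigma_finite_measure (Q x)"
    and w: "(\<integral>\<^sup>+ y. ennreal (min 1 \<bar>y\<bar>) \<partial>Q x) < \<infinity>"
    and [measurable]: "g \<in> borel_measurable borel"
    and g: "\<And>t. \<bar>g t\<bar> \<le> C" "\<And>t. \<bar>t\<bar> > R \<Longrightarrow> g t = 0"
  shows "(\<integral>\<^sup>+ t. ennreal \<bar>g t\<bar> \<partial>integrated_tail Q x) < \<infinity>"
proof -
  let ?J = "\<lambda>y. \<integral>\<^sup>+ t. ennreal \<bar>g t\<bar> * indicator {t. zbetween y t} t \<partial>lborel"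
  note [measurable_cong] = s
  define D where "D = \<bar>C\<bar> * max 1 (2 * abs R)"
  have C: "C \<ge> 0" using g(1)[of 0] by simp
  have D0: "D \<ge> 0" by (simp add: D_def le_max_iff_disj)
  have "(\<integral>\<^sup>+ t. ennreal \<bar>g t\<bar> \<partial>integrated_tail Q x) =
      (\<integral>\<^sup>+ y. ?J y \<partial>Q x)"
    by (rule nn_integral_integrated_tail[of Q x, OF s sf]) measurable
  also have "\<dots> \<le> (\<integral>\<^sup>+ y. ennreal D * ennreal (min 1 \<bar>y\<bar>) \<partial>Q x)"
  proof (rule nn_integral_mono)
    fix y
    have m: "{t. zbetween y t} \<in> sets lborel" by measurable
    have 1: "?J y \<le> ennreal C * ennreal \<bar>y\<bar>"
    proof -
      have "?J y \<le>
        (\<integral>\<^sup>+ t. ennreal C * indicator {t. zbetween y t} t \<partial>lborel)"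
        by (intro nn_integral_mono mult_right_mono ennreal_leI g) auto
      also have "\<dots> = ennreal C * ennreal \<bar>y\<bar>" using m by (simp add: nn_integral_cmult emeasure_zbetween)
      finally show ?thesis .
    qed
    have 2: "?J y \<le> ennreal C * ennreal (2 * \<bar>R\<bar>)"
    proof -
      have "?J y \<le>
        (\<integral>\<^sup>+ t. ennreal C * indicator {-\<bar>R\<bar>..\<bar>R\<bar>} t \<partial>lborel)"
      proof (rule nn_integral_mono)
        fix t
        show "ennreal \<bar>g t\<bar> * indicator {t. zbetween y t} t \<le> ennreal C * indicator {-\<bar>R\<bar>..\<bar>R\<bar>} t"
          using g(1)[of t] g(2)[of t] by (cases "\<bar>t\<bar> > R") (auto simp: indicator_def ennreal_leI)
      qed
      also have "\<dots> = ennreal C * ennreal (2 * \<bar>R\<bar>)" by (simp add: nn_integral_cmult)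
      finally show ?thesis .
    qed
    have "?J y \<le> ennreal (C * min \<bar>y\<bar> (2 * abs R))"
      using 1 2 C by (auto simp: ennreal_mult'[symmetric] min_def)
    also have "C * min \<bar>y\<bar> (2 * abs R) \<le> D * min 1 \<bar>y\<bar>"
    proof -
      have "min \<bar>y\<bar> (2 * abs R) \<le> max 1 (2 * abs R) * min 1 \<bar>y\<bar>"
      proof (cases "\<bar>y\<bar> \<le> 1")
        case True
        then have "1 * \<bar>y\<bar> \<le> max 1 (2 * abs R) * \<bar>y\<bar>" by (intro mult_right_mono) auto
        then show ?thesis using True by (simp add: min_def)
      qed auto
      then have "C * min \<bar>y\<bar> (2 * abs R) \<le> C * (max 1 (2 * abs R) * min 1 \<bar>y\<bar>)" using C by (rule mult_left_mono)
      then show ?thesis using C by (simp add: D_def mult.assoc)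
    qed
    then have "ennreal (C * min \<bar>y\<bar> (2 * abs R)) \<le> ennreal D * ennreal (min 1 \<bar>y\<bar>)"
      by (subst ennreal_mult'[symmetric]) (auto intro!: ennreal_leI D0)
    finally show "?J y \<le> ennreal D * ennreal (min 1 \<bar>y\<bar>)" .
  qed
  also have "\<dots> = ennreal D * (\<integral>\<^sup>+ y. ennreal (min 1 \<bar>y\<bar>) \<partial>Q x)" by (simp add: nn_integral_cmult)
  also have "\<dots> < \<infinity>" using w by (simp add: ennreal_mult_less_top)
  finally show ?thesis .
qed

text \<open>Passing to the integrated tail lowers the required moment by one: on the segment the
  weight is at most min(1, |y|), the segment has length |y|, and the product is min(|y|, |y|^2).
  Thus the integrated tail of \<open>\<rho>\<close> meets the condition imposed on
  \<open>\<mu>\<close> and can be treated like it.\<close>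

lemma integrated_tail_min_finite:
  assumes s: "sets (Q x) = sets borel" and sf: "sigma_finite_measure (Q x)"
    and w: "(\<integral>\<^sup>+ y. ennreal (min \<bar>y\<bar> (\<bar>y\<bar>\<^sup>2)) \<partial>Q x) < \<infinity>"
  shows "(\<integral>\<^sup>+ t. ennreal (min 1 \<bar>t\<bar>) \<partial>integrated_tail Q x) < \<infinity>"
proof -
  let ?J = "\<lambda>y. \<integral>\<^sup>+ t. ennreal (min 1 \<bar>t\<bar>) * indicator {t. zbetween y t} t \<partial>lborel"
  have "(\<integral>\<^sup>+ t. ennreal (min 1 \<bar>t\<bar>) \<partial>integrated_tail Q x) =
      (\<integral>\<^sup>+ y. ?J y \<partial>Q x)"
    by (rule nn_integral_integrated_tail[of Q x, OF s sf]) measurable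
  also have "\<dots> \<le> (\<integral>\<^sup>+ y. ennreal (min \<bar>y\<bar> (\<bar>y\<bar>\<^sup>2)) \<partial>Q x)"
  proof (rule nn_integral_mono)
    fix y
    have m: "{t. zbetween y t} \<in> sets lborel" by measurable
    have "?J y \<le>
        (\<integral>\<^sup>+ t. ennreal (min 1 \<bar>y\<bar>) * indicator {t. zbetween y t} t \<partial>lborel)"
      by (intro nn_integral_mono) (auto simp: indicator_def zbetween_def intro!: ennreal_leI)
    also have "\<dots> = ennreal (min 1 \<bar>y\<bar>) * ennreal \<bar>y\<bar>" using m by (simp add: nn_integral_cmult emeasure_zbetween)
    also have "\<dots> = ennreal (min \<bar>y\<bar> (\<bar>y\<bar>\<^sup>2))"
    proof -
      have "min 1 \<bar>y\<bar> * \<bar>y\<bar> = min \<bar>y\<bar> (\<bar>y\<bar>\<^sup>2)"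
        by (simp add: min_mult_distrib_right power2_eq_square)
      then show ?thesis by (subst ennreal_mult'[symmetric]) auto
    qed
    finally show "?J y \<le> ennreal (min \<bar>y\<bar> (\<bar>y\<bar>\<^sup>2))" .
  qed
  also have "\<dots> < \<infinity>" by (rule w)
  finally show ?thesis .
qed

lemma integral_integrated_tail:
  fixes f :: "real \<Rightarrow> real"
  assumes s: "sets (Q x) = sets borel" and sf: "sigma_finite_measure (Q x)"
    and fin: "\<And>t. tail Q x t < top" and [measurable]: "f \<in> borel_measurable borel"
  shows "(LINT t|integrated_tail Q x. f t) = (LBINT t. enn2real (tail Q x t) * f t)"
    "integrable (integrated_tail Q x) f \<longleftrightarrow> integrable lborel (\<lambda>t. enn2real (tail Q x t) * f t)"
proof -
  note [measurable] = tail_measurable[of Q x, OF s sf]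
  have "tail Q x = (\<lambda>t. ennreal (enn2real (tail Q x t)))"
    using fin by (simp add: fun_eq_iff)
  then have e: "integrated_tail Q x = density lborel (\<lambda>t. ennreal (enn2real (tail Q x t)))"
    unfolding integrated_tail_def by simp
  show "(LINT t|integrated_tail Q x. f t) = (LBINT t. enn2real (tail Q x t) * f t)"
    unfolding e by (subst integral_density) auto
  show "integrable (integrated_tail Q x) f \<longleftrightarrow> integrable lborel (\<lambda>t. enn2real (tail Q x t) * f t)"
    unfolding e by (subst integrable_density) auto
qed

lemma sigma_finite_integrated_tail:
  assumes s: "sets (Q x) = sets borel" and sf: "sigma_finite_measure (Q x)"
    and fin: "\<And>t. tail Q x t < top"
  shows "sigma_finite_measure (integrated_tail Q x)"
proof -
  have "tail Q x \<in> borel_measurable lborel" using tail_measurable[of Q x, OF s sf] by simp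
  then show ?thesis
    unfolding integrated_tail_def
    using sigma_finite_measure.sigma_finite_iff_density_finite[OF lborel.sigma_finite_measure_axioms] fin
    by (auto simp: less_top)
qed

text \<open>The fundamental theorem of calculus; \<open>sgn t\<close> supplies the orientation for
  negative \<open>y\<close>. The open segment and the closed interval differ by a null set.\<close>

lemma integral_zbetween:
  fixes F F' :: "real \<Rightarrow> real"
  assumes F: "\<And>t. (F has_real_derivative F' t) (at t)" and c: "continuous_on UNIV F'"
  shows "(LBINT t. sgn t * F' t * indicator {t. zbetween y t} t) = F y - F 0"
proof -
  have c': "isCont F' t" for t using c by (simp add: continuous_on_eq_continuous_at)
  have null: "AE t in lborel. t \<noteq> 0 \<and> t \<noteq> y"
    using AE_lborel_singleton[of 0] AE_lborel_singleton[of y] by eventually_elim auto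
  have [measurable]: "F' \<in> borel_measurable borel" by (rule borel_measurable_continuous_onI[OF c])
  show ?thesis
  proof (cases "y \<ge> 0")
    case True
    have "(LBINT t. sgn t * F' t * indicator {t. zbetween y t} t) = (LBINT t. F' t * indicator {0..y} t)"
    proof (rule integral_cong_AE)
      show "AE t in lborel. sgn t * F' t * indicator {t. zbetween y t} t = F' t * indicator {0..y} t"
        using null by eventually_elim (use True in \<open>auto simp: indicator_def zbetween_def sgn_if\<close>)
    qed measurable
    also have "\<dots> = F y - F 0" by (rule integral_FTC_Icc_real) (use True F c' in auto)
    finally show ?thesis .
  next
    case False
    have "(LBINT t. sgn t * F' t * indicator {t. zbetween y t} t) = (LBINT t. - (F' t * indicator {y..0} t))"
    proof (rule integral_cong_AE)
      show "AE t in lborel. sgn t * F' t * indicator {t. zbetween y t} t = - (F' t * indicator {y..0} t)"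
        using null by eventually_elim (use False in \<open>auto simp: indicator_def zbetween_def sgn_if\<close>)
    qed measurable
    also have "\<dots> = - (F 0 - F y)"
      unfolding Bochner_Integration.integral_minus
      by (subst integral_FTC_Icc_real) (use False F c' in auto)
    finally show ?thesis by simp
  qed
qed

text \<open>The weight \<open>\<sigma>\<close> is constant on either half line, so it can be moved past the integration in \<open>t\<close>.
  With \<open>p = 1\<close>, \<open>q = - 1\<close> the formula can be iterated.\<close>

lemma integral_increments_eq_tail:
  fixes F F' :: "real \<Rightarrow> real" and p q :: real
  defines "\<sigma> \<equiv> \<lambda>t::real. if t > 0 then p else q"
  assumes s: "sets (Q x) = sets borel" and sf: "sigma_finite_measure (Q x)"
    and fin: "\<And>t. tail Q x t < top"
    and F: "\<And>t. (F has_real_derivative F' t) (at t)" and c: "continuous_on UNIV F'"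
    and int: "(\<integral>\<^sup>+ t. ennreal \<bar>F' t\<bar> \<partial>integrated_tail Q x) < \<infinity>"
  shows "integrable (Q x) (\<lambda>y. \<sigma> y * (F y - F 0))"
    and "(LINT y|Q x. \<sigma> y * (F y - F 0)) = (LINT t|integrated_tail Q x. \<sigma> t * sgn t * F' t)"
proof -
  interpret Q: sigma_finite_measure "Q x" by fact
  interpret pair_sigma_finite "Q x" lborel ..
  note [measurable_cong] = s
  note [measurable] = tail_measurable[of Q x, OF s sf]
  have [measurable]: "F' \<in> borel_measurable borel" by (rule borel_measurable_continuous_onI[OF c])
  have [measurable]: "\<sigma> \<in> borel_measurable borel" unfolding \<sigma>_def by measurable
  define K where "K = max \<bar>p\<bar> \<bar>q\<bar>"
  have K: "\<bar>\<sigma> t\<bar> \<le> K" for t by (auto simp: \<sigma>_def K_def)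
  then have K0: "K \<ge> 0" by (meson abs_ge_zero order_trans)
  \<comment> \<open>Integrating \<open>H\<close> over \<open>t\<close> yields the weighted
    increment, integrating it over \<open>y\<close> yields the tail. The two claims are
    integrability of \<open>H\<close> and Fubini's theorem.\<close>
  define H where "H y t = \<sigma> t * sgn t * F' t * ind_between y t" for y t
  have [measurable]: "(\<lambda>(y, t). H y t) \<in> borel_measurable (Q x \<Otimes>\<^sub>M lborel)"
    unfolding H_def by measurable
  have inner: "(LBINT t. H y t) = \<sigma> y * (F y - F 0)" for y
  proof -
    have "(LBINT t. H y t) = (LBINT t. \<sigma> y * (sgn t * F' t * indicator {t. zbetween y t} t))"
      by (intro Bochner_Integration.integral_cong) (auto simp: H_def indicator_def zbetween_def \<sigma>_def)
    then show ?thesis using integral_zbetween[OF F c, of y] by simp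
  qed
  have Hint: "integrable (Q x \<Otimes>\<^sub>M lborel) (\<lambda>(y, t). H y t)"
  proof (rule integrableI_bounded)
    have "(\<integral>\<^sup>+ z. ennreal (norm (case z of (y, t) \<Rightarrow> H y t)) \<partial>(Q x \<Otimes>\<^sub>M lborel)) =
       (\<integral>\<^sup>+ y. (\<integral>\<^sup>+ t. ennreal \<bar>H y t\<bar> \<partial>lborel) \<partial>Q x)"
      by (subst lborel.nn_integral_fst[symmetric]) (auto simp: split_beta')
    also have "\<dots> \<le> (\<integral>\<^sup>+ y. (\<integral>\<^sup>+ t. ennreal (K * \<bar>F' t\<bar>) * indicator {t. zbetween y t} t \<partial>lborel) \<partial>Q x)"
    proof (intro nn_integral_mono)
      fix y t
      have "\<bar>\<sigma> t * sgn t * F' t\<bar> \<le> K * 1 * \<bar>F' t\<bar>"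
        unfolding abs_mult by (intro mult_mono K) (auto simp: abs_sgn_eq K0)
      then show "ennreal \<bar>H y t\<bar> \<le> ennreal (K * \<bar>F' t\<bar>) * indicator {t. zbetween y t} t"
        by (auto simp: H_def indicator_def intro: ennreal_leI)
    qed
    also have "\<dots> = (\<integral>\<^sup>+ t. ennreal (K * \<bar>F' t\<bar>) \<partial>integrated_tail Q x)"
      by (rule nn_integral_integrated_tail[of Q x, OF s sf, symmetric]) measurable
    also have "\<dots> = ennreal K * (\<integral>\<^sup>+ t. ennreal \<bar>F' t\<bar> \<partial>integrated_tail Q x)"
      using K0 by (simp add: ennreal_mult' nn_integral_cmult)
    also have "\<dots> < \<infinity>" using int by (simp add: ennreal_mult_less_top)
    finally show "(\<integral>\<^sup>+ z. ennreal (norm (case z of (y, t) \<Rightarrow> H y t)) \<partial>(Q x \<Otimes>\<^sub>M lborel)) < \<infinity>" .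
  qed measurable
  show "integrable (Q x) (\<lambda>y. \<sigma> y * (F y - F 0))"
    using integrable_fst'[OF Hint] by (simp add: inner)
  have "(LINT y|Q x. \<sigma> y * (F y - F 0)) = (LINT y|Q x. (LBINT t. H y t))" by (simp add: inner)
  also have "\<dots> = (LBINT t. (LINT y|Q x. H y t))" by (rule Fubini_integral[OF Hint, symmetric])
  also have "\<dots> = (LBINT t. enn2real (tail Q x t) * (\<sigma> t * sgn t * F' t))"
  proof (intro Bochner_Integration.integral_cong refl)
    fix t
    have m: "{y. zbetween y t} \<in> sets (Q x)" by measurable
    have "(LINT y|Q x. H y t) = (LINT y|Q x. (\<sigma> t * sgn t * F' t) * indicator {y. zbetween y t} y)"
      by (intro Bochner_Integration.integral_cong) (auto simp: H_def indicator_def)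
    also have "\<dots> = (\<sigma> t * sgn t * F' t) * measure (Q x) {y. zbetween y t}"
      using m sets_eq_imp_space_eq[OF s] by simp
    also have "measure (Q x) {y. zbetween y t} = enn2real (tail Q x t)"
      using m by (simp add: tail_eq_nn_integral[of Q x, OF s] measure_def)
    finally show "(LINT y|Q x. H y t) = enn2real (tail Q x t) * (\<sigma> t * sgn t * F' t)" by simp
  qed
  also have "\<dots> = (LINT t|integrated_tail Q x. \<sigma> t * sgn t * F' t)"
    by (rule integral_integrated_tail(1)[of Q x, OF s sf fin, symmetric]) measurable
  finally show "(LINT y|Q x. \<sigma> y * (F y - F 0)) = (LINT t|integrated_tail Q x. \<sigma> t * sgn t * F' t)" .
qed

section \<open>Uniform bounds for order zero operators\<close>

text \<open>Continuity is assumed only for each fixed \<open>z\<close>; Fatou's lemma turns it into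
  closedness of the sublevel sets \<open>A n\<close> of the L1 norm. These cover the space, so
  Baire's theorem puts a ball into one of them, and linearity moves the ball to the origin.\<close>

lemma L1_operator_bounded:
  fixes T :: "'a::{real_normed_vector, complete_space} \<Rightarrow> 'b \<Rightarrow> real"
  assumes int: "\<And>f. integrable M (T f)"
    and add: "\<And>f g z. T (f + g) z = T f z + T g z"
    and scale: "\<And>c f z. T (c *\<^sub>R f) z = c * T f z"
    and cont: "\<And>z F f. F \<longlonglongrightarrow> f \<Longrightarrow> (\<lambda>n. T (F n) z) \<longlonglongrightarrow> T f z"
  shows "\<exists>C\<ge>0. \<forall>f. (LINT z|M. \<bar>T f z\<bar>) \<le> C * norm f"
proof -
  define A where "A n = {f. (LINT z|M. \<bar>T f z\<bar>) \<le> real n}" for n :: nat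
  have A_nn: "f \<in> A n \<longleftrightarrow> (\<integral>\<^sup>+z. ennreal \<bar>T f z\<bar> \<partial>M) \<le> ennreal (real n)" for f n
  proof -
    have "(\<integral>\<^sup>+z. ennreal \<bar>T f z\<bar> \<partial>M) = ennreal (LINT z|M. \<bar>T f z\<bar>)"
      using int[of f] by (intro nn_integral_eq_integral) auto
    then show ?thesis by (simp add: A_def)
  qed
  have closed: "closed (A n)" for n
    unfolding closed_sequential_limits
  proof (intro allI impI, elim conjE)
    fix F f assume F: "\<forall>k. F k \<in> A n" and lim: "F \<longlonglongrightarrow> f"
    have lim': "(\<lambda>k. ennreal \<bar>T (F k) z\<bar>) \<longlonglongrightarrow> ennreal \<bar>T f z\<bar>" for z
      by (intro tendsto_intros cont lim)
    have "(\<integral>\<^sup>+z. ennreal \<bar>T f z\<bar> \<partial>M) = (\<integral>\<^sup>+z. liminf (\<lambda>k. ennreal \<bar>T (F k) z\<bar>) \<partial>M)"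
      by (intro nn_integral_cong, rule sym, rule lim_imp_Liminf) (use lim' in auto)
    also have "\<dots> \<le> liminf (\<lambda>k. \<integral>\<^sup>+z. ennreal \<bar>T (F k) z\<bar> \<partial>M)"
      using int by (intro nn_integral_liminf) auto
    also have "\<dots> \<le> liminf (\<lambda>k. ennreal (real n))"
      using F A_nn by (intro Liminf_mono) auto
    also have "\<dots> = ennreal (real n)" by (simp add: Liminf_const)
    finally show "f \<in> A n" using A_nn by simp
  qed
  have un: "(\<Union>n. A n) = UNIV"
    using real_arch_simple by (auto simp: A_def)
  obtain n where n: "interior (A n) \<noteq> {}"
  proof (rule ccontr)
    assume "\<not> thesis"
    then have e: "interior (A n) = {}" for n using that by blast
    have "euclidean interior_of \<Union>(range A) = {}"
      using Met_TC.metric_Baire_category_alt[where 'a='a, of "range A"] closed e complete_UNIV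
      by auto
    then show False using un by simp
  qed
  then obtain f0 r where r: "r > 0" and ball: "cball f0 r \<subseteq> A n"
    by (auto simp: mem_interior_cball)
  \<comment> \<open>\<open>g\<close> is the difference of \<open>f0 + g\<close> and
    \<open>f0\<close>, both in the ball; hence the factor 2.\<close>
  have small: "(LINT z|M. \<bar>T g z\<bar>) \<le> 2 * real n" if "norm g \<le> r" for g
  proof -
    have m: "f0 + g \<in> A n" "f0 \<in> A n" using ball that r by (auto simp: dist_norm)
    have "(LINT z|M. \<bar>T g z\<bar>) \<le> (LINT z|M. \<bar>T (f0 + g) z\<bar> + \<bar>T f0 z\<bar>)"
      using int by (intro integral_mono) (auto simp: add)
    also have "\<dots> = (LINT z|M. \<bar>T (f0 + g) z\<bar>) + (LINT z|M. \<bar>T f0 z\<bar>)"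
      using int by (intro Bochner_Integration.integral_add) auto
    finally show ?thesis using m by (auto simp: A_def)
  qed
  show ?thesis
  proof (intro exI[of _ "2 * real n / r"] conjI allI)
    show "0 \<le> 2 * real n / r" using r by simp
    fix f
    show "(LINT z|M. \<bar>T f z\<bar>) \<le> 2 * real n / r * norm f"
    proof (cases "f = 0")
      case True
      then have "T f z = 0" for z using scale[of 0 f z] by simp
      then show ?thesis using True by simp
    next
      case False
      define c where "c = r / norm f"
      have c: "c > 0" using False r by (simp add: c_def)
      have "(LINT z|M. \<bar>T (c *\<^sub>R f) z\<bar>) = c * (LINT z|M. \<bar>T f z\<bar>)"
        using c by (simp add: scale abs_mult)
      moreover have "(LINT z|M. \<bar>T (c *\<^sub>R f) z\<bar>) \<le> 2 * real n"
        using c False r by (intro small) (simp add: c_def)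
      ultimately have "(LINT z|M. \<bar>T f z\<bar>) \<le> 2 * real n / c"
        using c by (simp add: pos_le_divide_eq mult.commute)
      then show ?thesis by (simp add: c_def)
    qed
  qed
qed

lemma CcI:
  assumes "continuous_on UNIV f" "\<And>x. \<bar>x\<bar> > R \<Longrightarrow> f x = 0"
  shows "f \<in> Cc"
proof -
  have "{x. f x \<noteq> 0} \<subseteq> {-R..R}" using assms(2) by (force simp: abs_le_iff not_less)
  then have "closure {x. f x \<noteq> 0} \<subseteq> {-R..R}" by (rule closure_minimal) auto
  then show ?thesis using assms(1) compact_Int_closed[OF compact_Icc[of "-R" R], of "closure {x. f x \<noteq> 0}"]
    by (auto simp: Cc_def Int_absorb1)
qed

lemma compact_support_boundE:
  fixes f :: "real \<Rightarrow> real"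
  assumes "compact (closure {x. f x \<noteq> 0})"
  obtains R where "R > 0" "\<And>x. \<bar>x\<bar> \<ge> R \<Longrightarrow> f x = 0"
proof -
  have "bounded {x. f x \<noteq> 0}" using assms compact_imp_bounded bounded_subset closure_subset by blast
  then obtain B where B: "\<And>x. f x \<noteq> 0 \<Longrightarrow> \<bar>x\<bar> \<le> B" by (auto simp: bounded_iff)
  show thesis by (rule that[of "\<bar>B\<bar> + 1"]) (use B in force)+
qed

lemma Cc_supportE:
  assumes "f \<in> Cc"
  obtains R where "R > 0" "\<And>x. \<bar>x\<bar> \<ge> R \<Longrightarrow> f x = 0"
proof (rule compact_support_boundE[of f])
  show "compact (closure {x. f x \<noteq> 0})" using assms unfolding Cc_def by simp
qed (rule that)

lemma Cc_smooth_supportE: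
  assumes "f \<in> Cc_smooth"
  obtains R where "R > 0" "\<And>x. \<bar>x\<bar> \<ge> R \<Longrightarrow> f x = 0"
proof (rule compact_support_boundE[of f])
  show "compact (closure {x. f x \<noteq> 0})" using assms unfolding Cc_smooth_def by simp
qed (rule that)

definition cutoff :: "real \<Rightarrow> real \<Rightarrow> real" where
  "cutoff R x = max 0 (min 1 (R + 1 - \<bar>x\<bar>))"

lemma cutoff_simps:
  "continuous_on A (cutoff R)" "0 \<le> cutoff R x" "cutoff R x \<le> 1" "\<bar>cutoff R x\<bar> \<le> 1"
  "\<bar>x\<bar> \<le> R \<Longrightarrow> cutoff R x = 1" "\<bar>x\<bar> \<ge> R + 1 \<Longrightarrow> cutoff R x = 0"
  unfolding cutoff_def by (auto intro!: continuous_intros)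

text \<open>Multiplying by a cutoff turns the functions supported in a fixed compact set into the
  Banach space of all bounded continuous functions, to which Baire's theorem applies.\<close>

lemma Cc_operator_bounded:
  fixes T :: "(real \<Rightarrow> real) \<Rightarrow> real \<Rightarrow> real"
  assumes int: "\<And>f. f \<in> Cc \<Longrightarrow> integrable M (T f)"
    and add: "\<And>f g z. f \<in> Cc \<Longrightarrow> g \<in> Cc \<Longrightarrow> T (\<lambda>x. f x + g x) z = T f z + T g z"
    and scale: "\<And>c f z. f \<in> Cc \<Longrightarrow> T (\<lambda>x. c * f x) z = c * T f z"
    and cont: "\<And>z F f C R. \<lbrakk>\<And>n. F n \<in> Cc; f \<in> Cc; \<And>n x. \<bar>F n x\<bar> \<le> C;
        \<And>n x. \<bar>x\<bar> > R \<Longrightarrow> F n x = 0; \<And>x. (\<lambda>n. F n x) \<longlonglongrightarrow> f x\<rbrakk> \<Longrightarrow> (\<lambda>n. T (F n) z) \<longlonglongrightarrow> T f z"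
  shows "\<exists>C\<ge>0. \<forall>f\<in>Cc. (\<forall>x. \<bar>f x\<bar> \<le> 1) \<longrightarrow> (\<forall>x. \<bar>x\<bar> > R \<longrightarrow> f x = 0) \<longrightarrow> (LINT z|M. \<bar>T f z\<bar>) \<le> C"
proof -
  define S where "S f = T (\<lambda>x. cutoff R x * apply_bcontfun f x)" for f :: "real \<Rightarrow>\<^sub>C real"
  have Cc: "(\<lambda>x. cutoff R x * apply_bcontfun f x) \<in> Cc" for f :: "real \<Rightarrow>\<^sub>C real"
    by (rule CcI[where R="R+1"]) (auto intro!: continuous_intros simp: cutoff_simps)
  have "\<exists>C\<ge>0. \<forall>f. (LINT z|M. \<bar>S f z\<bar>) \<le> C * norm f"
  proof (rule L1_operator_bounded[where T=S and M=M])
    show "integrable M (S f)" for f unfolding S_def by (intro int Cc)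
    show "S (f + g) z = S f z + S g z" for f g z
      using add[OF Cc[of f] Cc[of g]] by (simp add: S_def algebra_simps)
    show "S (c *\<^sub>R f) z = c * S f z" for c f z
      using scale[OF Cc[of f], of c] by (simp add: S_def algebra_simps)
    fix z F f assume F: "F \<longlonglongrightarrow> (f :: real \<Rightarrow>\<^sub>C real)"
    obtain B where B: "\<And>n. norm (F n) \<le> B"
      using convergent_imp_Bseq[of F] F by (auto simp: convergent_def elim!: BseqE)
    have lim: "(\<lambda>n. apply_bcontfun (F n) x) \<longlonglongrightarrow> apply_bcontfun f x" for x
    proof -
      have "(\<lambda>n. dist (F n) f) \<longlonglongrightarrow> 0" using F by (subst (asm) tendsto_dist_iff)
      then have "(\<lambda>n. dist (F n x) (f x)) \<longlonglongrightarrow> 0"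
        by (rule tendsto_sandwich[OF _ _ tendsto_const, rotated 2]) (auto simp: dist_bounded)
      then show ?thesis by (subst tendsto_dist_iff)
    qed
    show "(\<lambda>n. S (F n) z) \<longlonglongrightarrow> S f z" unfolding S_def
    proof (rule cont[where C=B and R="R+1"])
      show "\<bar>cutoff R x * apply_bcontfun (F n) x\<bar> \<le> B" for n x
        using mult_mono[OF cutoff_simps(4)[of R x] order_trans[OF norm_bounded[of "F n" x] B]]
        by (simp add: abs_mult)
      show "(\<lambda>n. cutoff R x * apply_bcontfun (F n) x) \<longlonglongrightarrow> cutoff R x * apply_bcontfun f x" for x
        by (intro tendsto_mult tendsto_const lim)
      show "cutoff R x * apply_bcontfun (F n) x = 0" if "R + 1 < \<bar>x\<bar>" for n x
        using that cutoff_simps(6)[of R x] by simp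
    qed (rule Cc)+
  qed
  then obtain C where C: "C \<ge> 0" "\<And>f. (LINT z|M. \<bar>S f z\<bar>) \<le> C * norm f" by blast
  show ?thesis
  proof (intro exI[of _ C] conjI ballI impI C)
    fix f assume f: "f \<in> Cc" "\<forall>x. \<bar>f x\<bar> \<le> 1" "\<forall>x. \<bar>x\<bar> > R \<longrightarrow> f x = 0"
    have b: "f \<in> bcontfun" using f unfolding Cc_def by (intro bcontfun_normI[of _ 1]) simp_all
    \<comment> \<open>The cutoff is 1 on the support of \<open>f\<close>, so no function of the
      class in question is changed by it.\<close>
    have "(\<lambda>x. cutoff R x * f x) = f" using f cutoff_simps(5) by (auto simp: fun_eq_iff) (metis not_le)
    then have "T f = S (Bcontfun f)" using b by (simp add: S_def Bcontfun_inverse)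
    moreover have "norm (Bcontfun f) \<le> 1" using f b by (intro norm_bound) (simp add: Bcontfun_inverse)
    ultimately show "(LINT z|M. \<bar>T f z\<bar>) \<le> C"
      using C(2)[of "Bcontfun f"] mult_left_mono[of "norm (Bcontfun f)" 1 C] C(1) by simp
  qed
qed

section \<open>Smooth test functions\<close>

definition smooth :: "(real \<Rightarrow> real) \<Rightarrow> bool" where
  "smooth f \<longleftrightarrow> (\<forall>n x. (deriv ^^ n) f field_differentiable at x)"

lemma Cc_smooth_iff: "f \<in> Cc_smooth \<longleftrightarrow> smooth f \<and> compact (closure {x. f x \<noteq> 0})"
  by (simp add: Cc_smooth_def smooth_def)

lemma smooth_deriv: "smooth f \<Longrightarrow> smooth (deriv f)"
  unfolding smooth_def by (metis comp_apply funpow_Suc_right)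

lemma smooth_DERIV: "smooth f \<Longrightarrow> (f has_real_derivative deriv f x) (at x)"
  unfolding smooth_def by (metis DERIV_deriv_iff_field_differentiable funpow_0)

text \<open>Smoothness as a greatest fixed point: a class of functions closed under differentiation
  consists of smooth functions. This replaces formulas for higher derivatives by the choice of a
  suitable class.\<close>

lemma smooth_coinduct:
  assumes "P f"
    and step: "\<And>f. P f \<Longrightarrow> \<exists>g. (\<forall>x. (f has_real_derivative g x) (at x)) \<and> P g"
  shows "smooth f"
proof -
  have d: "P (deriv f)" "f field_differentiable at x" if P: "P f" for f x
  proof -
    obtain g where g: "\<And>x. (f has_real_derivative g x) (at x)" "P g" using step[OF P] by blast
    then have "deriv f = g" by (auto simp: fun_eq_iff intro!: DERIV_imp_deriv)
    then show "P (deriv f)" "f field_differentiable at x"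
      using g by (auto simp: field_differentiable_def)
  qed
  have "P ((deriv ^^ n) f)" for n by (induction n) (use assms(1) d(1) in auto)
  then show ?thesis using d(2) by (auto simp: smooth_def)
qed

text \<open>The derivative of a product is a sum of products, so the invariant class for products
  has to be closed under both operations.\<close>

inductive smooth_algebra :: "(real \<Rightarrow> real) \<Rightarrow> bool" where
  base: "smooth f \<Longrightarrow> smooth_algebra f"
| add: "smooth_algebra f \<Longrightarrow> smooth_algebra g \<Longrightarrow> smooth_algebra (\<lambda>x. f x + g x)"
| mult: "smooth_algebra f \<Longrightarrow> smooth_algebra g \<Longrightarrow> smooth_algebra (\<lambda>x. f x * g x)"

lemma smooth_algebra_smooth: "smooth_algebra f \<Longrightarrow> smooth f"
proof (erule smooth_coinduct)
  fix f assume "smooth_algebra f"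
  then show "\<exists>g. (\<forall>x. (f has_real_derivative g x) (at x)) \<and> smooth_algebra g"
  proof induction
    case (base f)
    then show ?case using smooth_DERIV smooth_deriv smooth_algebra.base by blast
  next
    case (add f g)
    then obtain f' g' where "\<And>x. (f has_real_derivative f' x) (at x)" "smooth_algebra f'"
      "\<And>x. (g has_real_derivative g' x) (at x)" "smooth_algebra g'" by blast
    then show ?case
      by (intro exI[of _ "\<lambda>x. f' x + g' x"]) (auto intro!: derivative_intros smooth_algebra.add)
  next
    case (mult f g)
    then obtain f' g' where *: "\<And>x. (f has_real_derivative f' x) (at x)" "smooth_algebra f'"
      "\<And>x. (g has_real_derivative g' x) (at x)" "smooth_algebra g'" by blast
    have "((\<lambda>x. f x * g x) has_real_derivative f' x * g x + f x * g' x) (at x)" for x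
      using * by (auto intro!: derivative_eq_intros)
    moreover have "smooth_algebra (\<lambda>x. f' x * g x + f x * g' x)"
      using mult * by (intro smooth_algebra.add smooth_algebra.mult)
    ultimately show ?case by (intro exI[of _ "\<lambda>x. f' x * g x + f x * g' x"]) auto
  qed
qed

lemma smooth_add: "smooth f \<Longrightarrow> smooth g \<Longrightarrow> smooth (\<lambda>x. f x + g x)"
  and smooth_mult: "smooth f \<Longrightarrow> smooth g \<Longrightarrow> smooth (\<lambda>x. f x * g x)"
  by (simp_all add: smooth_algebra.intros smooth_algebra_smooth)

lemma smooth_const: "smooth (\<lambda>x. c)"
  by (rule smooth_coinduct[where P="\<lambda>f. \<exists>c. f = (\<lambda>x. c)"]) (auto intro!: exI[of _ "\<lambda>x. 0"])

lemma smooth_affine: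
  assumes "smooth f" shows "smooth (\<lambda>x. f (k * x + d))"
\<comment> \<open>The factor \<open>m\<close> collects the powers of \<open>k\<close> produced by
  the chain rule.\<close>
proof (rule smooth_coinduct[where P="\<lambda>h. \<exists>m F. smooth F \<and> h = (\<lambda>x. m * F (k * x + d))"])
  show "\<exists>m F. smooth F \<and> (\<lambda>x. f (k * x + d)) = (\<lambda>x. m * F (k * x + d))"
    using assms by (intro exI[of _ 1] exI[of _ f]) auto
  fix h assume "\<exists>m F. smooth F \<and> h = (\<lambda>x. m * F (k * x + d))"
  then obtain m F where F: "smooth F" and h: "h = (\<lambda>x. m * F (k * x + d))" by blast
  have "(h has_real_derivative (m * k) * deriv F (k * x + d)) (at x)" for x
    unfolding h by (rule derivative_eq_intros DERIV_chain2[OF smooth_DERIV[OF F]] refl | simp)+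
  then show "\<exists>g. (\<forall>x. (h has_real_derivative g x) (at x)) \<and> (\<exists>m F. smooth F \<and> g = (\<lambda>x. m * F (k * x + d)))"
    using smooth_deriv[OF F] by (intro exI[of _ "\<lambda>x. m * k * deriv F (k * x + d)"]) blast
qed

text \<open>The classical smooth function that is flat at 0 without vanishing on the right of
  it.\<close>

definition exp_bump :: "real \<Rightarrow> real" where
  "exp_bump x = (if x > 0 then exp (- (1 / x)) else 0)"

lemma exp_bump_bounds: "0 \<le> exp_bump x" "exp_bump x \<le> 1" "x \<le> 0 \<Longrightarrow> exp_bump x = 0"
  by (auto simp: exp_bump_def)

lemma poly_exp_bump_tendsto_0: "((\<lambda>x. poly p (1 / x) * exp_bump x) \<longlongrightarrow> 0) (at_right 0)"
proof -
  have "((\<lambda>t. \<Sum>i\<le>degree p. coeff p i * (t ^ i / exp t)) \<longlongrightarrow> (\<Sum>i\<le>degree p. coeff p i * 0)) at_top"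
    by (intro tendsto_intros tendsto_power_div_exp_0)
  then have "((\<lambda>t. poly p t * exp (- t)) \<longlongrightarrow> 0) at_top"
    by (simp add: poly_altdef sum_distrib_right exp_minus divide_inverse mult.assoc)
  then have "((\<lambda>x. poly p (inverse x) * exp (- inverse x)) \<longlongrightarrow> 0) (at_right 0)"
    by (rule filterlim_compose[OF _ filterlim_inverse_at_top_right])
  then show ?thesis
    by (rule Lim_transform_eventually)
      (auto simp: eventually_at_filter exp_bump_def inverse_eq_divide)
qed

text \<open>With s = 1/x the derivative of p(s) exp(-s) is s^2 (p(s) - p'(s)) exp(-s), so the class
  of these functions is closed under differentiation. At 0 the difference quotient has the same
  form, with the polynomial s p(s), and tends to 0.\<close>

lemma poly_exp_bump_DERIV:
  "((\<lambda>x. poly p (1 / x) * exp_bump x) has_real_derivative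
     poly ([:0, 0, 1:] * (p - pderiv p)) (1 / x) * exp_bump x) (at x)"
proof -
  consider "x > 0" | "x < 0" | "x = 0" by linarith
  then show ?thesis
  proof cases
    case 1
    have "((\<lambda>x. poly p (1 / x) * exp (- (1 / x))) has_real_derivative
       poly ([:0, 0, 1:] * (p - pderiv p)) (1 / x) * exp (- (1 / x))) (at x)"
      using 1 by (auto intro!: derivative_eq_intros simp: field_simps power2_eq_square)
    then have "((\<lambda>x. poly p (1 / x) * exp_bump x) has_real_derivative
       poly ([:0, 0, 1:] * (p - pderiv p)) (1 / x) * exp (- (1 / x))) (at x)"
      by (rule has_field_derivative_transform_within_open[of _ _ _ "{0<..}"])
        (use 1 in \<open>auto simp: exp_bump_def\<close>)
    then show ?thesis using 1 by (simp add: exp_bump_def)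
  next
    case 2
    have "((\<lambda>x. poly p (1 / x) * exp_bump x) has_real_derivative 0) (at x)"
      by (rule has_field_derivative_transform_within_open[of "\<lambda>x. 0" _ _ "{..<0}"])
        (use 2 in \<open>auto simp: exp_bump_def\<close>)
    then show ?thesis using 2 by (simp add: exp_bump_def)
  next
    case 3
    have "((\<lambda>h. poly p (1 / h) * exp_bump h / h) \<longlongrightarrow> 0) (at_right 0)"
      using poly_exp_bump_tendsto_0[of "[:0, 1:] * p"] by (simp add: field_simps)
    moreover have "((\<lambda>h. poly p (1 / h) * exp_bump h / h) \<longlongrightarrow> 0) (at_left 0)"
      by (rule Lim_transform_eventually[OF tendsto_const])
        (auto simp: exp_bump_def eventually_at_filter)
    ultimately have "((\<lambda>h. poly p (1 / h) * exp_bump h / h) \<longlongrightarrow> 0) (at 0)"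
      by (simp add: filterlim_split_at)
    then show ?thesis unfolding 3 by (simp add: DERIV_def exp_bump_bounds(3))
  qed
qed

lemma smooth_exp_bump: "smooth exp_bump"
proof (rule smooth_coinduct[where P="\<lambda>h. \<exists>p. h = (\<lambda>x. poly p (1 / x) * exp_bump x)"])
  show "\<exists>p. exp_bump = (\<lambda>x. poly p (1 / x) * exp_bump x)"
    by (intro exI[of _ 1]) auto
  show "\<exists>g. (\<forall>x. (f has_real_derivative g x) (at x)) \<and> (\<exists>p. g = (\<lambda>x. poly p (1 / x) * exp_bump x))"
    if *: "\<exists>p. f = (\<lambda>x. poly p (1 / x) * exp_bump x)" for f
  proof -
    obtain p where "f = (\<lambda>x. poly p (1 / x) * exp_bump x)" using * by blast
    then show ?thesis
      using poly_exp_bump_DERIV[of p]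
      by (intro exI[of _ "\<lambda>x. poly ([:0, 0, 1:] * (p - pderiv p)) (1 / x) * exp_bump x"]) blast
  qed
qed

lemma Cc_smoothI: "smooth f \<Longrightarrow> (\<And>x. \<bar>x\<bar> > R \<Longrightarrow> f x = 0) \<Longrightarrow> f \<in> Cc_smooth"
  using CcI[of f R] DERIV_continuous_on[of UNIV f] smooth_DERIV[of f] 
  by (auto simp: Cc_smooth_iff Cc_def)

text \<open>For \<open>n > 0\<close> this is positive exactly on the open interval. Increasing
  \<open>n\<close> steepens both flanks, so that the limit is the indicator of the interval.\<close>

definition interval_bump :: "real \<Rightarrow> real \<Rightarrow> nat \<Rightarrow> real \<Rightarrow> real" where
  "interval_bump a b n x = exp_bump (real n * x + - (real n * a)) * exp_bump (- real n * x + real n * b)"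

lemma interval_bump_bounds: "0 \<le> interval_bump a b n x" "interval_bump a b n x \<le> 1"
  by (auto simp: interval_bump_def intro!: mult_nonneg_nonneg mult_le_one exp_bump_bounds)

lemma interval_bump_outside:
  assumes "x \<notin> {a<..<b}" shows "interval_bump a b n x = 0"
proof -
  consider "x \<le> a" | "b \<le> x" using assms by force
  then show ?thesis
    by cases (auto simp: interval_bump_def intro!: exp_bump_bounds(3) mult_left_mono)
qed

lemma interval_bump_Cc_smooth: "interval_bump a b n \<in> Cc_smooth"
proof (rule Cc_smoothI[where R="\<bar>a\<bar> + \<bar>b\<bar>"])
  show "smooth (interval_bump a b n)"
    unfolding interval_bump_def[abs_def] by (intro smooth_mult smooth_affine smooth_exp_bump)
qed (auto intro!: interval_bump_outside)

lemma interval_bump_tendsto: "(\<lambda>n. interval_bump a b n x) \<longlonglongrightarrow> indicator {a<..<b} x"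
proof (cases "x \<in> {a<..<b}")
  case True
  have e: "(\<lambda>n. exp_bump (real n * t)) \<longlonglongrightarrow> 1" if "t > 0" for t
  proof (rule Lim_transform_eventually)
    show "(\<lambda>n. exp (- (1 / t * (1 / real n)))) \<longlonglongrightarrow> 1"
      using tendsto_exp[OF tendsto_minus[OF tendsto_mult_right_zero[OF lim_1_over_n, of "1 / t"]]] by simp
    show "\<forall>\<^sub>F n in sequentially. exp (- (1 / t * (1 / real n))) = exp_bump (real n * t)"
      using eventually_gt_at_top[of 0] by eventually_elim (use that in \<open>auto simp: exp_bump_def\<close>)
  qed
  have "(\<lambda>n. exp_bump (real n * (x - a)) * exp_bump (real n * (b - x))) \<longlonglongrightarrow> 1 * 1"
    using True by (intro tendsto_mult e) auto
  then show ?thesis using True by (simp add: interval_bump_def algebra_simps)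
qed (simp add: interval_bump_outside)

lemma deriv_eq_0_outside:
  fixes f :: "real \<Rightarrow> real"
  assumes f: "\<And>x. \<bar>x\<bar> \<ge> R \<Longrightarrow> f x = 0" and x: "\<bar>x\<bar> > R"
  shows "deriv f x = 0"
proof -
  have "(f has_real_derivative 0) (at x)"
    by (rule has_field_derivative_transform_within_open[of "\<lambda>x. 0" _ _ "- {-R..R}"])
      (use x f in auto)
  then show ?thesis by (rule DERIV_imp_deriv)
qed

lemma Cc_smooth_props:
  assumes "f \<in> Cc_smooth"
  shows "\<And>x. (f has_real_derivative deriv f x) (at x)" "continuous_on A f" "f \<in> Cc"
    "deriv f \<in> Cc_smooth" "f \<in> borel_measurable borel"
proof -
  have s: "smooth f" using assms by (simp add: Cc_smooth_iff)
  show d: "(f has_real_derivative deriv f x) (at x)" for x by (rule smooth_DERIV[OF s])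
  then show c: "continuous_on A f" for A by (meson DERIV_continuous_on has_field_derivative_at_within)
  then show "f \<in> borel_measurable borel" by (intro borel_measurable_continuous_onI)
  show "f \<in> Cc" using assms c by (simp add: Cc_def Cc_smooth_iff)
  obtain R where R: "R > 0" "\<And>x. \<bar>x\<bar> \<ge> R \<Longrightarrow> f x = 0"
    by (blast intro: Cc_smooth_supportE[OF assms])
  show "deriv f \<in> Cc_smooth"
  proof (rule Cc_smoothI[where R=R])
    show "smooth (deriv f)" by (rule smooth_deriv[OF s])
    show "deriv f x = 0" if "R < \<bar>x\<bar>" for x by (rule deriv_eq_0_outside[OF R(2) that])
  qed
qed

lemma Cc_bounded:
  assumes "f \<in> Cc" obtains C where "\<And>x. \<bar>f x\<bar> \<le> C"
proof -
  obtain R where R: "R > 0" "\<And>x. \<bar>x\<bar> \<ge> R \<Longrightarrow> f x = 0" by (blast intro: Cc_supportE[OF assms])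
  have "compact (f ` {-R..R})"
    using assms by (intro compact_continuous_image) (auto simp: Cc_def intro: continuous_on_subset)
  then have "bounded (f ` {-R..R})" by (rule compact_imp_bounded)
  then obtain B where "\<forall>v\<in>f ` {-R..R}. norm v \<le> B" unfolding bounded_iff by blast
  then have B: "\<And>x. x \<in> {-R..R} \<Longrightarrow> \<bar>f x\<bar> \<le> B" by auto
  show thesis
  proof (rule that[of "\<bar>B\<bar>"])
    fix x show "\<bar>f x\<bar> \<le> \<bar>B\<bar>" using B[of x] R(2)[of x] by (cases "\<bar>x\<bar> \<ge> R") (simp, smt (verit) atLeastAtMost_iff)
  qed
qed

lemma Cc_borel: "f \<in> Cc \<Longrightarrow> f \<in> borel_measurable borel"
  unfolding Cc_def by (intro borel_measurable_continuous_onI) blast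

lemma Cc_smooth_bounds:
  assumes "f \<in> Cc_smooth"
  obtains C R where "\<And>x. \<bar>f x\<bar> \<le> C" "\<And>x. \<bar>x\<bar> > R \<Longrightarrow> f x = 0" "C \<ge> 0" "R \<ge> 0"
proof -
  obtain R where R: "R > 0" "\<And>x. \<bar>x\<bar> \<ge> R \<Longrightarrow> f x = 0" by (blast intro: Cc_smooth_supportE[OF assms])
  obtain C where C: "\<And>x. \<bar>f x\<bar> \<le> C" by (blast intro: Cc_bounded[OF Cc_smooth_props(3)[OF assms]])
  show thesis
  proof (rule that[of C R])
    show "0 \<le> C" using C[of 0] by simp
  qed (use C R in auto)
qed

lemma Cc_smooth_add:
  assumes "f \<in> Cc_smooth" "g \<in> Cc_smooth" shows "(\<lambda>x. f x + g x) \<in> Cc_smooth"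
proof -
  obtain R where R: "R > 0" "\<And>x. \<bar>x\<bar> \<ge> R \<Longrightarrow> f x = 0" by (blast intro: Cc_smooth_supportE[OF assms(1)])
  obtain S where S: "S > 0" "\<And>x. \<bar>x\<bar> \<ge> S \<Longrightarrow> g x = 0" by (blast intro: Cc_smooth_supportE[OF assms(2)])
  show ?thesis
  proof (rule Cc_smoothI[where R="max R S"])
    show "smooth (\<lambda>x. f x + g x)" using assms by (simp add: Cc_smooth_iff smooth_add)
    show "f x + g x = 0" if "max R S < \<bar>x\<bar>" for x using that R(2)[of x] S(2)[of x] by simp
  qed
qed

lemma Cc_smooth_cmult:
  assumes "f \<in> Cc_smooth" shows "(\<lambda>x. c * f x) \<in> Cc_smooth"
proof -
  obtain R where R: "R > 0" "\<And>x. \<bar>x\<bar> \<ge> R \<Longrightarrow> f x = 0" by (blast intro: Cc_smooth_supportE[OF assms(1)])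
  show ?thesis
  proof (rule Cc_smoothI[where R=R])
    show "smooth (\<lambda>x. c * f x)" using assms by (simp add: Cc_smooth_iff smooth_const smooth_mult)
    show "c * f x = 0" if "R < \<bar>x\<bar>" for x using that R(2)[of x] by simp
  qed
qed

section \<open>Antiderivatives and moments of test functions\<close>

lemma integral_deriv_compact_support:
  fixes f f' :: "real \<Rightarrow> real"
  assumes d: "\<And>x. (f has_real_derivative f' x) (at x)" and c: "continuous_on UNIV f'"
    and f: "\<And>x. \<bar>x\<bar> > R \<Longrightarrow> f' x = 0"
    and R: "R \<ge> 0"
  shows "(LBINT x. f' x) = f R - f (-R)"
proof -
  have "(LBINT x. f' x) = (LBINT x. f' x * indicator {-R..R} x)"
  proof (intro Bochner_Integration.integral_cong refl)
    show "f' x = f' x * indicator {-R..R} x" for x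
      using f[of x] by (cases "\<bar>x\<bar> > R") (auto simp: abs_le_iff indicator_def)
  qed
  also have "\<dots> = f R - f (-R)"
  proof (rule integral_FTC_Icc_real)
    show "(f has_real_derivative f' x) (at x)" for x by (rule d)
    show "isCont f' x" for x using c by (simp add: continuous_on_eq_continuous_at)
  qed (use R in auto)
  finally show ?thesis .
qed

lemma Cc_integrable:
  assumes "f \<in> Cc" shows "integrable lborel f"
proof -
  obtain R where R: "R > 0" "\<And>x. \<bar>x\<bar> \<ge> R \<Longrightarrow> f x = 0"
    by (blast intro: Cc_supportE[OF assms])
  have "continuous_on {-R..R} f" using assms by (auto simp: Cc_def intro: continuous_on_subset)
  then have "set_integrable lborel {-R..R} f" by (rule borel_integrable_atLeastAtMost')
  moreover have "(\<lambda>x. indicator {-R..R} x *\<^sub>R f x) = f"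
  proof
    show "indicator {-R..R} x *\<^sub>R f x = f x" for x
      using R(2)[of x] by (cases "\<bar>x\<bar> \<ge> R") (auto simp: indicator_def)
  qed
  ultimately show ?thesis by (simp add: set_integrable_def)
qed

text \<open>The antiderivative that vanishes at \<open>-R\<close> is constant on either side of the
  support: it is 0 on the left by this normalization and 0 on the right because the total integral
  of \<open>h\<close> vanishes.\<close>

lemma Cc_smooth_antiderivative:
  assumes h: "h \<in> Cc_smooth" and 0: "(LBINT x. h x) = 0"
  obtains H where "H \<in> Cc_smooth" "deriv H = h"
proof -
  define G where "G x = (LBINT y=0..x. h y)" for x :: real
  have c: "continuous_on A h" for A by (rule Cc_smooth_props[OF h])
  have G: "(G has_real_derivative h x) (at x)" for x
  proof -
    have "((\<lambda>u. LBINT y=(0::real)..u. h y) has_vector_derivative h x) (at x within {-\<bar>x\<bar>-1..\<bar>x\<bar>+1})"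
      by (rule interval_integral_FTC2) (auto intro: c)
    moreover have "at x within {-\<bar>x\<bar>-1..\<bar>x\<bar>+1} = at x"
      by (rule at_within_interior) auto
    ultimately show ?thesis
      by (simp add: G_def[abs_def] has_real_derivative_iff_has_vector_derivative zero_ereal_def)
  qed
  obtain R where R: "R > 0" "\<And>x. \<bar>x\<bar> \<ge> R \<Longrightarrow> h x = 0"
    by (blast intro: Cc_smooth_supportE[OF h])
  define H where "H x = G x - G (-R)" for x
  have H: "(H has_real_derivative h x) (at x)" for x
    unfolding H_def[abs_def] by (auto intro!: derivative_eq_intros G)
  have eq: "deriv H = h" using H by (auto simp: fun_eq_iff intro!: DERIV_imp_deriv)
  have "H R = 0" using integral_deriv_compact_support[OF H c, of R] R 0 by (simp add: H_def)
  have out: "H x = 0" if "\<bar>x\<bar> > R" for x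
  proof -
    have H0: "(H has_real_derivative 0) (at y within S)" if "\<bar>y\<bar> \<ge> R" for y S
      using H[of y] R(2)[OF that] by (auto intro: has_field_derivative_at_within)
    have "\<exists>c. \<forall>y\<in>{R..}. H y = c" "\<exists>c. \<forall>y\<in>{..-R}. H y = c"
      by (rule has_field_derivative_zero_constant; use R(1) in \<open>auto intro!: H0\<close>)+
    moreover have "H (-R) = 0" by (simp add: H_def)
    moreover have "x \<in> {R..} \<or> x \<in> {..-R}" using that by auto
    ultimately show ?thesis using \<open>H R = 0\<close> by (metis atLeast_iff atMost_iff order_refl)
  qed
  have "smooth h" using h by (simp add: Cc_smooth_iff)
  then have "smooth H"
    by (intro smooth_coinduct[where P="\<lambda>f. f = H \<or> smooth f"])
      (use H smooth_DERIV smooth_deriv in blast)+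
  then have "H \<in> Cc_smooth" using out by (rule Cc_smoothI)
  then show thesis using eq that by blast
qed

lemma Cc_smooth_moments_integrable:
  assumes h: "h \<in> Cc_smooth"
  shows "integrable lborel h" "integrable lborel (\<lambda>x. x * h x)"
proof -
  show "integrable lborel h" using h by (intro Cc_integrable Cc_smooth_props)
  obtain R where R: "R > 0" "\<And>x. \<bar>x\<bar> \<ge> R \<Longrightarrow> h x = 0"
    by (blast intro: Cc_smooth_supportE[OF h])
  have "(\<lambda>x. x * h x) \<in> Cc"
    by (rule CcI[where R=R]) (use R Cc_smooth_props(2)[OF h] in \<open>auto intro!: continuous_intros\<close>)
  then show "integrable lborel (\<lambda>x. x * h x)" by (rule Cc_integrable)
qed

text \<open>Applied to \<open>h\<close> and to its derivative, these identities show that second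
  derivatives annihilate all affine densities.\<close>

lemma integral_deriv_moments:
  assumes h: "h \<in> Cc_smooth"
  shows "(LBINT x. deriv h x) = 0" "(LBINT x. x * deriv h x) = - (LBINT x. h x)"
proof -
  obtain R where R: "R > 0" "\<And>x. \<bar>x\<bar> \<ge> R \<Longrightarrow> h x = 0"
    by (blast intro: Cc_smooth_supportE[OF h])
  note d = Cc_smooth_props(1)[OF h] and h' = Cc_smooth_props(4)[OF h]
  have z: "deriv h x = 0" if "\<bar>x\<bar> > R" for x by (rule deriv_eq_0_outside[OF R(2) that])
  show "(LBINT x. deriv h x) = 0"
    using integral_deriv_compact_support[OF d Cc_smooth_props(2)[OF h'] z, of R] R by simp
  have "((\<lambda>x. x * h x) has_real_derivative h x + x * deriv h x) (at x)" for x
    using d by (auto intro!: derivative_eq_intros)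
  then have "(LBINT x. h x + x * deriv h x) = 0"
    by (subst integral_deriv_compact_support[where R=R and f="\<lambda>x. x * h x"])
      (use R z Cc_smooth_props(2)[OF h] Cc_smooth_props(2)[OF h'] in \<open>auto intro!: continuous_intros\<close>)
  then show "(LBINT x. x * deriv h x) = - (LBINT x. h x)"
    using Cc_smooth_moments_integrable(1)[OF h] Cc_smooth_moments_integrable(2)[OF h'] by simp
qed

text \<open>Any \<open>h\<close> differs from a second derivative by the combination of \<open>\<phi>\<close> and \<open>\<phi>'\<close> (\<open>\<phi>\<close> a normalized
  bump) that has the same zeroth and first moment.\<close>

lemma functional_vanishing_on_second_derivatives:
  fixes L :: "(real \<Rightarrow> real) \<Rightarrow> real"
  assumes add: "\<And>f g. f \<in> Cc_smooth \<Longrightarrow> g \<in> Cc_smooth \<Longrightarrow> L (\<lambda>x. f x + g x) = L f + L g"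
    and scale: "\<And>c f. f \<in> Cc_smooth \<Longrightarrow> L (\<lambda>x. c * f x) = c * L f"
    and zero: "\<And>f. f \<in> Cc_smooth \<Longrightarrow> L (deriv (deriv f)) = 0"
  shows "\<exists>c1 c2. \<forall>h\<in>Cc_smooth. L h = (LBINT x. (c1 * x + c2) * h x)"
proof -
  note int = Cc_smooth_moments_integrable(1) and int1 = Cc_smooth_moments_integrable(2)
    and parts = integral_deriv_moments
  define B where "B = (LBINT x. interval_bump 0 1 1 x)"
  have bump: "interval_bump 0 1 1 \<in> Cc_smooth" by (rule interval_bump_Cc_smooth)
  have "B \<noteq> 0"
  proof
    assume "B = 0"
    then have "AE x in lborel. interval_bump 0 1 1 x = 0"
      using integral_nonneg_eq_0_iff_AE[OF int[OF bump]] interval_bump_bounds(1) by (auto simp: B_def)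
    moreover have "interval_bump 0 1 1 x > 0" if "x \<in> {0<..<1}" for x
      using that by (auto simp: interval_bump_def exp_bump_def)
    ultimately have "AE x in lborel. x \<notin> {0<..<1::real}"
      by (elim eventually_mono) (metis less_irrefl)
    then have "emeasure lborel {0<..<1::real} = 0"
      by (subst (asm) AE_iff_measurable[of "{0<..<1}"]) auto
    then show False by simp
  qed
  define \<phi> where "\<phi> = (\<lambda>x. 1 / B * interval_bump 0 1 1 x)"
  have \<phi>: "\<phi> \<in> Cc_smooth" unfolding \<phi>_def by (rule Cc_smooth_cmult[OF bump])
  have \<phi>1: "(LBINT x. \<phi> x) = 1" using \<open>B \<noteq> 0\<close> by (simp add: \<phi>_def B_def)
  define m where "m = (LBINT x. x * \<phi> x)"
  have \<phi>': "deriv \<phi> \<in> Cc_smooth" by (rule Cc_smooth_props[OF \<phi>])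
  show ?thesis
  proof (intro exI ballI)
    fix h assume h: "h \<in> Cc_smooth"
    define I0 I1 where "I0 = (LBINT x. h x)" and "I1 = (LBINT x. x * h x)"
    \<comment> \<open>The zeroth and first moments are 1 and \<open>m\<close> for
      \<open>\<phi>\<close>, and 0 and -1 for its derivative. The coefficients are chosen so that
      both moments of \<open>r\<close> vanish.\<close>
    define r where "r = (\<lambda>x. h x + ((- I0) * \<phi> x + (I1 - I0 * m) * deriv \<phi> x))"
    have r: "r \<in> Cc_smooth" unfolding r_def by (intro Cc_smooth_add Cc_smooth_cmult h \<phi> \<phi>')
    have r0: "(LBINT x. r x) = 0"
      unfolding r_def using int[OF h] int[OF \<phi>] int[OF \<phi>'] parts(1)[OF \<phi>] \<phi>1 by (simp add: I0_def)
    have "(LBINT x. x * r x) = (LBINT x. x * h x + ((- I0) * (x * \<phi> x) + (I1 - I0 * m) * (x * deriv \<phi> x)))"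
      unfolding r_def by (simp add: algebra_simps)
    also have "\<dots> = 0"
      using int1[OF h] int1[OF \<phi>] int1[OF \<phi>'] parts(2)[OF \<phi>] \<phi>1 by (simp add: I1_def m_def)
    finally have r1: "(LBINT x. x * r x) = 0" .
    \<comment> \<open>The zeroth moment of \<open>r\<close> gives a compactly supported
      antiderivative \<open>H\<close>. Up to sign, the integral of \<open>H\<close> is the first
      moment of \<open>r\<close>, so a second antiderivative exists as well.\<close>
    obtain H where H: "H \<in> Cc_smooth" "deriv H = r" using Cc_smooth_antiderivative[OF r r0] .
    then have "(LBINT x. H x) = 0" using parts(2)[OF H(1)] r1 by simp
    then obtain F where F: "F \<in> Cc_smooth" "deriv F = H" using Cc_smooth_antiderivative[OF H(1)] by blast
    have "0 = L r" using zero[OF F(1)] F H by simp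
    also have "\<dots> = L h + ((- I0) * L \<phi> + (I1 - I0 * m) * L (deriv \<phi>))"
      unfolding r_def by (simp only: add scale Cc_smooth_add Cc_smooth_cmult h \<phi> \<phi>')
    finally have "L h = (- L (deriv \<phi>)) * I1 + (L \<phi> + m * L (deriv \<phi>)) * I0"
      by (simp add: algebra_simps)
    also have "\<dots> = (LBINT x. (- L (deriv \<phi>)) * (x * h x) + (L \<phi> + m * L (deriv \<phi>)) * h x)"
      using int[OF h] int1[OF h] by (simp add: I0_def I1_def)
    also have "\<dots> = (LBINT x. ((- L (deriv \<phi>)) * x + (L \<phi> + m * L (deriv \<phi>))) * h x)"
      by (intro Bochner_Integration.integral_cong) (auto simp: algebra_simps)
    finally show "L h = (LBINT x. ((- L (deriv \<phi>)) * x + (L \<phi> + m * L (deriv \<phi>))) * h x)" .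
  qed
qed

section \<open>The operator on test functions\<close>

text \<open>The bound for the Dirichlet kernel: multiplication by \<open>2 * sin (s / 2)\<close>
  makes the sum telescope.\<close>

lemma sum_cos_bound:
  assumes "sin (s / 2) \<noteq> 0"
  shows "\<bar>\<Sum>k<n. cos (real k * s)\<bar> \<le> 1 / \<bar>sin (s / 2)\<bar>"
proof -
  have step: "2 * sin (s / 2) * cos (real k * s) = sin (real (Suc k) * s - s / 2) - sin (real k * s - s / 2)" for k
  proof -
    have "real (Suc k) * s - s / 2 = real k * s + s / 2" by (simp add: algebra_simps)
    then show ?thesis by (simp only: sin_add sin_diff) simp
  qed
  have "2 * sin (s / 2) * (\<Sum>k<n. cos (real k * s)) = sin (real n * s - s / 2) + sin (s / 2)"
    unfolding sum_distrib_left step by (subst sum_lessThan_telescope) simp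
  then have "\<bar>2 * sin (s / 2) * (\<Sum>k<n. cos (real k * s))\<bar> \<le> 1 + 1"
    using abs_sin_le_one[of "real n * s - s / 2"] abs_sin_le_one[of "s / 2"] by linarith
  then show ?thesis using assms by (simp add: abs_mult field_simps)
qed

text \<open>The bound on \<open>s\<close> keeps \<open>s / 2\<close> away from the nonzero multiples
  of \<open>pi\<close>, where the sine vanishes and the means would tend to 1.\<close>

lemma mean_cos_tendsto_0:
  assumes "s \<noteq> 0" "\<bar>s\<bar> \<le> 1"
  shows "(\<lambda>n. (\<Sum>k<n. cos (real k * s)) / real n) \<longlonglongrightarrow> 0"
proof (rule Lim_null_comparison)
  have "\<bar>s / 2\<bar> < pi" using assms pi_gt3 by simp
  then have "sin (s / 2) \<noteq> 0"
    using assms sin_gt_zero[of "\<bar>s / 2\<bar>"] by (cases "s > 0") auto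
  then have b: "\<bar>\<Sum>k<n. cos (real k * s)\<bar> \<le> 1 / \<bar>sin (s / 2)\<bar>" for n by (rule sum_cos_bound)
  show "\<forall>\<^sub>F n in sequentially. norm ((\<Sum>k<n. cos (real k * s)) / real n) \<le> 1 / \<bar>sin (s / 2)\<bar> * (1 / real n)"
  proof (intro always_eventually allI)
    show "norm ((\<Sum>k<n. cos (real k * s)) / real n) \<le> 1 / \<bar>sin (s / 2)\<bar> * (1 / real n)" for n
      using mult_right_mono[OF b[of n], of "1 / real n"] by simp
  qed
  show "(\<lambda>n. 1 / \<bar>sin (s / 2)\<bar> * (1 / real n)) \<longlonglongrightarrow> 0"
    by (rule tendsto_mult_right_zero[OF lim_1_over_n])
qed

section \<open>Jump integrals of test functions\<close>

lemma DERIV_shift_arg: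
  assumes "\<And>t. (f has_real_derivative f' t) (at t)"
  shows "((\<lambda>t. f (x + t)) has_real_derivative f' (x + t)) (at t)"
  using assms[of "x + t"] by (simp add: DERIV_shift add.commute)

text \<open>Stated for a general kernel, since it is used for \<open>\<mu>\<close> and for the
  integrated tail of \<open>\<rho>\<close>. The shift by \<open>x\<close> enlarges the radius of the
  support to at most \<open>R + \<bar>x\<bar>\<close>.\<close>

lemma integrable_shifted:
  assumes s: "sets (Q x) = sets borel" and sf: "sigma_finite_measure (Q x)"
    and w: "(\<integral>\<^sup>+ y. ennreal (min 1 \<bar>y\<bar>) \<partial>Q x) < \<infinity>"
    and [measurable]: "f \<in> borel_measurable borel"
    and f: "\<And>t. \<bar>f t\<bar> \<le> C" "\<And>t. \<bar>t\<bar> > R \<Longrightarrow> f t = (0::real)"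
  shows "(\<integral>\<^sup>+ t. ennreal \<bar>f (x + t)\<bar> \<partial>integrated_tail Q x) < \<infinity>"
    "integrable (integrated_tail Q x) (\<lambda>t. f (x + t))"
    "integrable (integrated_tail Q x) (\<lambda>t. f (x + t) * sgn t)"
proof -
  show *: "(\<integral>\<^sup>+ t. ennreal \<bar>f (x + t)\<bar> \<partial>integrated_tail Q x) < \<infinity>"
    by (rule integrated_tail_bound[of Q x, OF s sf w, where C=C and R="R + \<bar>x\<bar>"]) (use f in auto)
  then show i: "integrable (integrated_tail Q x) (\<lambda>t. f (x + t))"
    by (intro integrableI_bounded) auto
  show "integrable (integrated_tail Q x) (\<lambda>t. f (x + t) * sgn t)"
    by (rule Bochner_Integration.integrable_bound[OF i]) (auto simp: abs_mult abs_sgn_eq)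
qed

locale convenient_kernels =
  fixes \<Lambda> \<nu> \<mu> \<rho> :: "real \<Rightarrow> real measure"
  assumes levy: "levy_kernel \<Lambda>"
    and conv: "convenient_decomposition \<Lambda> \<nu> \<mu> \<rho>"
begin

abbreviation "UI \<equiv> U_integrand \<nu>"
abbreviation "VI \<equiv> V_integrand \<mu>"
abbreviation "WI \<equiv> W_integrand \<rho>"

lemma levy_measure: "levy_measure (\<Lambda> x)"
  using levy by (simp add: levy_kernel_def)

lemma sets_\<Lambda>: "sets (\<Lambda> x) = sets borel"
  using levy_measure by (simp add: levy_measure_def)

lemma weights:
  obtains h1 h2 h3 :: "real \<Rightarrow> real"
  where "h1 \<in> borel_measurable borel" "h2 \<in> borel_measurable borel" "h3 \<in> borel_measurable borel"
    "\<And>y. 0 \<le> h1 y" "\<And>y. 0 \<le> h2 y" "\<And>y. 0 \<le> h3 y"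
    "\<And>x. \<nu> x = density (\<Lambda> x) (\<lambda>y. ennreal (h1 y))"
    "\<And>x. \<mu> x = density (\<Lambda> x) (\<lambda>y. ennreal (h2 y))"
    "\<And>x. \<rho> x = density (\<Lambda> x) (\<lambda>y. ennreal (h3 y))"
proof -
  obtain h1 h2 h3 :: "real \<Rightarrow> real"
    where c: "continuous_on UNIV h1" "continuous_on UNIV h2" "continuous_on UNIV h3"
    and h: "\<forall>y. 0 \<le> h1 y \<and> 0 \<le> h2 y \<and> 0 \<le> h3 y"
    "\<forall>x. \<nu> x = density (\<Lambda> x) (\<lambda>y. ennreal (h1 y)) \<and> \<mu> x = density (\<Lambda> x) (\<lambda>y. ennreal (h2 y)) \<and>
      \<rho> x = density (\<Lambda> x) (\<lambda>y. ennreal (h3 y))"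
    using conv unfolding convenient_decomposition_def by blast
  show thesis
    by (rule that[of h1 h2 h3]) (use c h in \<open>auto intro: borel_measurable_continuous_onI\<close>)
qed

text \<open>All three parts of the decomposition are densities of \<open>\<Lambda>\<close> with
  finite weights independent of the base point, so sigma-finiteness and measurability in the base
  point carry over from \<open>\<Lambda>\<close>.\<close>

lemma weighted_kernel:
  assumes [measurable]: "h \<in> borel_measurable borel"
  shows "sets (density (\<Lambda> x) (\<lambda>y. ennreal (h y))) = sets borel"
    "sigma_finite_measure (density (\<Lambda> x) (\<lambda>y. ennreal (h y)))"
    "\<lbrakk>k \<in> borel_measurable M; (\<lambda>(w, y). g w y) \<in> borel_measurable (M \<Otimes>\<^sub>M borel)\<rbrakk>
      \<Longrightarrow> (\<lambda>w. \<integral>\<^sup>+ y. g w y \<partial>density (\<Lambda> (k w)) (\<lambda>y. ennreal (h y))) \<in> borel_measurable M"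
proof -
  note [measurable_cong] = sets_\<Lambda>
  show "sets (density (\<Lambda> x) (\<lambda>y. ennreal (h y))) = sets borel" by (simp add: sets_\<Lambda>)
  have "(\<lambda>y. ennreal (h y)) \<in> borel_measurable (\<Lambda> x)" by measurable
  from sigma_finite_measure.sigma_finite_iff_density_finite[OF levy_measure_sigma_finite[OF levy_measure] this]
  show "sigma_finite_measure (density (\<Lambda> x) (\<lambda>y. ennreal (h y)))" by simp
  assume k: "k \<in> borel_measurable M" and g[measurable]: "(\<lambda>(w, y). g w y) \<in> borel_measurable (M \<Otimes>\<^sub>M borel)"
  have "(\<lambda>w. \<integral>\<^sup>+ y. ennreal (h y) * g w y \<partial>\<Lambda> (k w)) \<in> borel_measurable M"
    by (rule levy_kernel_nn_integral_measurable[OF levy k]) measurable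
  moreover have "(\<integral>\<^sup>+ y. g w y \<partial>density (\<Lambda> (k w)) (\<lambda>y. ennreal (h y))) = (\<integral>\<^sup>+ y. ennreal (h y) * g w y \<partial>\<Lambda> (k w))"
    if "w \<in> space M" for w
  proof -
    have [measurable]: "g w \<in> borel_measurable borel" using measurable_Pair2[OF g that] by simp
    show ?thesis by (subst nn_integral_density) auto
  qed
  ultimately show "(\<lambda>w. \<integral>\<^sup>+ y. g w y \<partial>density (\<Lambda> (k w)) (\<lambda>y. ennreal (h y))) \<in> borel_measurable M"
    by (simp cong: measurable_cong_simp)
qed

lemma sets_parts [simp, measurable_cong]:
  "sets (\<nu> x) = sets borel" "sets (\<mu> x) = sets borel" "sets (\<rho> x) = sets borel"
  by (metis weights weighted_kernel(1))+

lemma space_parts [simp]: "space (\<nu> x) = UNIV" "space (\<mu> x) = UNIV" "space (\<rho> x) = UNIV"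
  using sets_parts[THEN sets_eq_imp_space_eq] by auto

lemma sigma_finite_parts:
  "sigma_finite_measure (\<nu> x)" "sigma_finite_measure (\<mu> x)" "sigma_finite_measure (\<rho> x)"
  by (metis weights weighted_kernel(2))+

lemma parts_nn_integral_measurable:
  assumes k: "k \<in> borel_measurable M" and g: "(\<lambda>(w, y). g w y) \<in> borel_measurable (M \<Otimes>\<^sub>M borel)"
  shows "(\<lambda>w. \<integral>\<^sup>+ y. g w y \<partial>\<nu> (k w)) \<in> borel_measurable M"
    "(\<lambda>w. \<integral>\<^sup>+ y. g w y \<partial>\<mu> (k w)) \<in> borel_measurable M"
    "(\<lambda>w. \<integral>\<^sup>+ y. g w y \<partial>\<rho> (k w)) \<in> borel_measurable M"
proof -
  obtain h1 h2 h3 where [measurable]: "h1 \<in> borel_measurable borel" "h2 \<in> borel_measurable borel" "h3 \<in> borel_measurable borel"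
    and e: "\<And>x. \<nu> x = density (\<Lambda> x) (\<lambda>y. ennreal (h1 y))"
    "\<And>x. \<mu> x = density (\<Lambda> x) (\<lambda>y. ennreal (h2 y))"
    "\<And>x. \<rho> x = density (\<Lambda> x) (\<lambda>y. ennreal (h3 y))" by (rule weights) auto
  show "(\<lambda>w. \<integral>\<^sup>+ y. g w y \<partial>\<nu> (k w)) \<in> borel_measurable M"
    "(\<lambda>w. \<integral>\<^sup>+ y. g w y \<partial>\<mu> (k w)) \<in> borel_measurable M"
    "(\<lambda>w. \<integral>\<^sup>+ y. g w y \<partial>\<rho> (k w)) \<in> borel_measurable M"
    unfolding e by (rule weighted_kernel(3)[OF _ k g]; measurable)+
qed

lemma parts_finite:
  "emeasure (\<nu> x) UNIV < \<infinity>" "(\<integral>\<^sup>+ y. ennreal (min 1 \<bar>y\<bar>) \<partial>\<mu> x) < \<infinity>"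
  "(\<integral>\<^sup>+ y. ennreal (min \<bar>y\<bar> (\<bar>y\<bar>\<^sup>2)) \<partial>\<rho> x) < \<infinity>"
  using conv unfolding convenient_decomposition_def by blast+

lemma finite_measure_\<nu>: "finite_measure (\<nu> x)"
  using parts_finite(1)[of x] by (intro finite_measureI) auto

lemma \<nu>_zero: "AE y in \<nu> x. y \<noteq> 0"
proof -
  have "emeasure (\<nu> x) {0} \<le> emeasure (\<Lambda> x) {0}"
    using conv unfolding convenient_decomposition_def by (simp add: add_increasing2)
  then have "emeasure (\<nu> x) {0} = 0" using levy_measure[of x] by (simp add: levy_measure_def)
  then show ?thesis by (intro AE_I[of _ _ "{0}"]) auto
qed

text \<open>The decomposition is an identity between values of measures. Uniqueness of densities
  turns it into h1 + h2 + h3 = 1 almost everywhere, which bounds each weight by 1 and so makes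
  \<open>j\<close> integrable for each part.\<close>

lemma integral_split:
  fixes j :: "real \<Rightarrow> real"
  assumes j: "integrable (\<Lambda> x) j"
  shows "(LINT y|\<Lambda> x. j y) = (LINT y|\<nu> x. j y) + (LINT y|\<mu> x. j y) + (LINT y|\<rho> x. j y)"
proof -
  obtain h1 h2 h3 where [measurable]: "h1 \<in> borel_measurable borel" "h2 \<in> borel_measurable borel" "h3 \<in> borel_measurable borel"
    and h0: "\<And>y. 0 \<le> h1 y" "\<And>y. 0 \<le> h2 y" "\<And>y. 0 \<le> h3 y"
    and e: "\<And>x. \<nu> x = density (\<Lambda> x) (\<lambda>y. ennreal (h1 y))"
    "\<And>x. \<mu> x = density (\<Lambda> x) (\<lambda>y. ennreal (h2 y))"
    "\<And>x. \<rho> x = density (\<Lambda> x) (\<lambda>y. ennreal (h3 y))" by (rule weights) auto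
  let ?D = "density (\<Lambda> x) (\<lambda>y. ennreal (h1 y) + ennreal (h2 y) + ennreal (h3 y))"
  note [measurable_cong] = sets_\<Lambda>
  interpret L: sigma_finite_measure "\<Lambda> x" by (rule levy_measure_sigma_finite[OF levy_measure])
  have [measurable]: "j \<in> borel_measurable borel" using j sets_\<Lambda> by (simp cong: measurable_cong_sets)
  have "?D = density (\<Lambda> x) (\<lambda>y. 1)"
  proof (rule measure_eqI)
    fix B assume "B \<in> sets (?D)"
    then have B[measurable]: "B \<in> sets borel" by (simp add: sets_\<Lambda>)
    have "emeasure (?D) B =
      emeasure (\<nu> x) B + emeasure (\<mu> x) B + emeasure (\<rho> x) B"
      unfolding e by (simp add: emeasure_density distrib_right nn_integral_add sets_\<Lambda>)
    also have "\<dots> = emeasure (\<Lambda> x) B"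
      using conv B unfolding convenient_decomposition_def by simp
    finally show "emeasure (?D) B = emeasure (density (\<Lambda> x) (\<lambda>y. 1)) B"
      by (simp add: density_1)
  qed simp
  then have "AE y in \<Lambda> x. ennreal (h1 y) + ennreal (h2 y) + ennreal (h3 y) = 1"
    by (rule L.density_unique[rotated 2]) measurable
  then have AE: "AE y in \<Lambda> x. h1 y + h2 y + h3 y = 1"
    by eventually_elim (simp add: ennreal_plus[symmetric] h0 del: ennreal_plus)
  have int: "integrable (\<Lambda> x) (\<lambda>y. h y * j y)"
    if [measurable]: "h \<in> borel_measurable borel" and "AE y in \<Lambda> x. \<bar>h y\<bar> \<le> 1" for h
  proof (rule Bochner_Integration.integrable_bound[OF j])
    show "AE y in \<Lambda> x. norm (h y * j y) \<le> norm (j y)"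
      using that(2) by eventually_elim (auto simp: abs_mult intro!: mult_left_le_one_le)
  qed measurable
  have b: "AE y in \<Lambda> x. \<bar>h1 y\<bar> \<le> 1 \<and> \<bar>h2 y\<bar> \<le> 1 \<and> \<bar>h3 y\<bar> \<le> 1"
    using AE
  proof eventually_elim
    case (elim y)
    then show ?case using h0(1)[of y] h0(2)[of y] h0(3)[of y] by (auto simp: abs_le_iff)
  qed
  have i: "integrable (\<Lambda> x) (\<lambda>y. h1 y * j y)" "integrable (\<Lambda> x) (\<lambda>y. h2 y * j y)"
    "integrable (\<Lambda> x) (\<lambda>y. h3 y * j y)"
    using b by (auto intro!: int)
  have "(LINT y|\<Lambda> x. j y) = (LINT y|\<Lambda> x. h1 y * j y + h2 y * j y + h3 y * j y)"
  proof (rule integral_cong_AE)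
    show "AE y in \<Lambda> x. j y = h1 y * j y + h2 y * j y + h3 y * j y"
      using AE by eventually_elim (simp add: distrib_right[symmetric])
  qed measurable
  also have "\<dots> = (LINT y|\<nu> x. j y) + (LINT y|\<mu> x. j y) + (LINT y|\<rho> x. j y)"
    unfolding e using i by (simp add: integral_density h0)
  finally show ?thesis .
qed

lemma tail_\<mu>_finite: "tail \<mu> x t < top"
proof (cases "t = 0")
  case False
  show ?thesis
    by (rule tail_finite[where Q=\<mu> and w="\<lambda>y. min 1 \<bar>y\<bar>" and c="min 1 \<bar>t\<bar>"])
      (use False parts_finite in \<open>auto simp: zbetween_def\<close>)
qed (simp add: tail_def)

lemma tail_\<rho>_finite: "tail \<rho> x t < top"
proof (cases "t = 0")
  case False
  show ?thesis
  proof (rule tail_finite[where Q=\<rho> and w="\<lambda>y. min \<bar>y\<bar> (\<bar>y\<bar>\<^sup>2)" and c="min \<bar>t\<bar> (\<bar>t\<bar>\<^sup>2)"])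
    show "min \<bar>t\<bar> (\<bar>t\<bar>\<^sup>2) \<le> min \<bar>y\<bar> (\<bar>y\<bar>\<^sup>2)" if "zbetween y t" for y
    proof -
      have "\<bar>t\<bar> \<le> \<bar>y\<bar>" using that by (auto simp: zbetween_def)
      then have "\<bar>t\<bar>\<^sup>2 \<le> \<bar>y\<bar>\<^sup>2" by (rule power_mono) simp
      then show ?thesis using \<open>\<bar>t\<bar> \<le> \<bar>y\<bar>\<close> by (auto intro: min.mono simp del: power2_abs)
    qed
  qed (use False parts_finite in auto)
qed (simp add: tail_def)

abbreviation "\<rho>' \<equiv> integrated_tail \<rho>"

lemma sigma_finite_\<rho>': "sigma_finite_measure (\<rho>' x)"
  by (rule sigma_finite_integrated_tail) (simp_all add: sigma_finite_parts tail_\<rho>_finite)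

lemma \<rho>'_min_finite: "(\<integral>\<^sup>+ t. ennreal (min 1 \<bar>t\<bar>) \<partial>\<rho>' x) < \<infinity>"
  by (rule integrated_tail_min_finite) (use parts_finite sigma_finite_parts in auto)

lemma tail_\<rho>'_finite: "tail \<rho>' x t < top"
proof (cases "t = 0")
  case False
  show ?thesis
    by (rule tail_finite[where Q="\<rho>'" and w="\<lambda>y. min 1 \<bar>y\<bar>" and c="min 1 \<bar>t\<bar>"])
      (use False \<rho>'_min_finite in \<open>auto simp: zbetween_def\<close>)
qed (simp add: tail_def)

lemmas V_integrable = integrable_shifted[where Q=\<mu>, OF sets_parts(2) sigma_finite_parts(2) parts_finite(2)]
lemmas W_integrable = integrable_shifted[where Q=\<rho>', OF sets_integrated_tail sigma_finite_\<rho>' \<rho>'_min_finite]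

lemma U_integrable:
  assumes [measurable]: "f \<in> borel_measurable borel" and f: "\<And>t. \<bar>f t\<bar> \<le> (C::real)"
  shows "integrable (\<nu> x) (\<lambda>y. f (x + y))"
proof -
  interpret finite_measure "\<nu> x" by (rule finite_measure_\<nu>)
  show ?thesis by (rule integrable_const_bound[of _ C]) (auto simp: f)
qed

text \<open>Pointwise convergence with a common bound and a common support suffices. In particular,
  the limit may be discontinuous, such as the indicator of an interval.\<close>

lemma V_integrand_tendsto:
  assumes [measurable]: "\<And>n. F n \<in> borel_measurable borel" "f \<in> borel_measurable borel"
    and F: "\<And>n x. \<bar>F n x\<bar> \<le> C" "\<And>n x. \<bar>x\<bar> > R \<Longrightarrow> F n x = 0" "\<And>x. (\<lambda>n. F n x) \<longlonglongrightarrow> f x"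
  shows "(\<lambda>n. VI (F n) z) \<longlonglongrightarrow> VI f z"
  unfolding V_integrand_def
proof (rule integral_dominated_convergence[where w="\<lambda>t. C * indicator {-R..R} (z + t)"])
  have C: "C \<ge> 0" using F(1)[of 0 0] by simp
  show "integrable (integrated_tail \<mu> z) (\<lambda>t. C * indicator {-R..R} (z + t))"
    by (rule V_integrable(2)[where f="\<lambda>t. C * indicator {-R..R} t" and C=C and R=R])
      (use C in \<open>auto simp: indicator_def\<close>)
  show "AE t in integrated_tail \<mu> z. norm (F n (z + t) * sgn t) \<le> C * indicator {-R..R} (z + t)" for n
  proof (rule AE_I2)
    fix t
    show "norm (F n (z + t) * sgn t) \<le> C * indicator {-R..R} (z + t)"
      using F(1)[of n "z + t"] F(2)[of "z + t" n] C
      by (cases "\<bar>z + t\<bar> > R") (auto simp: abs_mult abs_sgn_eq indicator_def)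
  qed
  show "AE t in integrated_tail \<mu> z. (\<lambda>n. F n (z + t) * sgn t) \<longlonglongrightarrow> f (z + t) * sgn t"
    by (intro AE_I2 tendsto_mult F tendsto_const)
qed measurable

lemma U_integrand_tendsto:
  assumes [measurable]: "\<And>n. F n \<in> borel_measurable borel" "f \<in> borel_measurable borel"
    and F: "\<And>n x. \<bar>F n x\<bar> \<le> C" "\<And>x. (\<lambda>n. F n x) \<longlonglongrightarrow> f x"
  shows "(\<lambda>n. UI (F n) z) \<longlonglongrightarrow> UI f z"
  unfolding U_integrand_def
proof (intro tendsto_diff tendsto_mult F tendsto_const)
  interpret finite_measure "\<nu> z" by (rule finite_measure_\<nu>)
  show "(\<lambda>n. \<integral>y. F n (z + y) \<partial>\<nu> z) \<longlonglongrightarrow> (LINT y|\<nu> z. f (z + y))"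
    by (rule integral_dominated_convergence[where w="\<lambda>_. C"]) (auto simp: F)
qed

lemma V_integrable_Cc:
  assumes "f \<in> Cc"
  shows "(\<integral>\<^sup>+ t. ennreal \<bar>f (x + t)\<bar> \<partial>integrated_tail \<mu> x) < \<infinity>"
    "integrable (integrated_tail \<mu> x) (\<lambda>t. f (x + t) * sgn t)"
    "(\<integral>\<^sup>+ t. ennreal \<bar>f (x + t)\<bar> \<partial>integrated_tail \<rho>' x) < \<infinity>"
    "integrable (integrated_tail \<rho>' x) (\<lambda>t. f (x + t))"
proof -
  obtain R where R: "R > 0" "\<And>x. \<bar>x\<bar> \<ge> R \<Longrightarrow> f x = 0" by (blast intro: Cc_supportE[OF assms])
  obtain C where C: "\<And>x. \<bar>f x\<bar> \<le> C" by (blast intro: Cc_bounded[OF assms])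
  note * = Cc_borel[OF assms] C R(2)[OF less_imp_le]
  show "(\<integral>\<^sup>+ t. ennreal \<bar>f (x + t)\<bar> \<partial>integrated_tail \<mu> x) < \<infinity>"
    "integrable (integrated_tail \<mu> x) (\<lambda>t. f (x + t) * sgn t)"
    using V_integrable(1,3)[OF *] by auto
  show "(\<integral>\<^sup>+ t. ennreal \<bar>f (x + t)\<bar> \<partial>integrated_tail \<rho>' x) < \<infinity>"
    "integrable (integrated_tail \<rho>' x) (\<lambda>t. f (x + t))"
    using W_integrable(1,2)[OF *] by auto
qed

text \<open>The tail formula with constant weight 1. The sign that appears in it is the origin of
  \<open>sgn y\<close> in \<open>V\<close>.\<close>

lemma small_jump_increments:
  assumes f: "f \<in> Cc_smooth"
  shows "integrable (\<mu> x) (\<lambda>y. f (x + y) - f x)"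
    "(LINT y|\<mu> x. f (x + y) - f x) = VI (deriv f) x"
proof -
  have f': "deriv f \<in> Cc_smooth" "deriv f \<in> Cc" using Cc_smooth_props[OF f] Cc_smooth_props(3) by auto
  have d: "((\<lambda>t. f (x + t)) has_real_derivative deriv f (x + t)) (at t)" for t
    by (rule DERIV_shift_arg[OF Cc_smooth_props(1)[OF f]])
  have c: "continuous_on UNIV (\<lambda>t. deriv f (x + t))"
    by (intro continuous_on_compose2[OF Cc_smooth_props(2)[OF f'(1), of UNIV]]) (auto intro!: continuous_intros)
  note * = integral_increments_eq_tail[where Q=\<mu> and p=1 and q=1, OF sets_parts(2) sigma_finite_parts(2) tail_\<mu>_finite d c
    V_integrable_Cc(1)[OF f'(2)]]
  show "integrable (\<mu> x) (\<lambda>y. f (x + y) - f x)"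
    "(LINT y|\<mu> x. f (x + y) - f x) = VI (deriv f) x"
    using * by (simp_all add: V_integrand_def mult.commute)
qed

text \<open>The tail formula is applied twice, first to f(x + y) - f'(x) y and then to its
  derivative, which vanishes at 0. The sign left over by the first application is the weight of the
  second and cancels the new sign, so \<open>W\<close> carries none.\<close>

lemma large_jump_increments:
  assumes f: "f \<in> Cc_smooth"
  shows "integrable (\<rho> x) (\<lambda>y. f (x + y) - f x - deriv f x * y)"
    "(LINT y|\<rho> x. f (x + y) - f x - deriv f x * y) = WI (deriv (deriv f)) x"
proof -
  have f': "deriv f \<in> Cc_smooth" "deriv f \<in> Cc" using Cc_smooth_props[OF f] Cc_smooth_props(3) by auto
  have f'': "deriv (deriv f) \<in> Cc_smooth" "deriv (deriv f) \<in> Cc"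
    using Cc_smooth_props[OF f'(1)] Cc_smooth_props(3) by auto
  note [measurable] = Cc_smooth_props(5)[OF f] Cc_smooth_props(5)[OF f'(1)] Cc_smooth_props(5)[OF f''(1)]
  define F where "F y = f (x + y) - deriv f x * y" for y
  define F' where "F' y = deriv f (x + y) - deriv f x" for y
  have dF: "(F has_real_derivative F' t) (at t)" for t
    unfolding F_def[abs_def] F'_def
    by (auto intro!: derivative_eq_intros DERIV_shift_arg[OF Cc_smooth_props(1)[OF f]])
  have dF': "(F' has_real_derivative deriv (deriv f) (x + t)) (at t)" for t
    unfolding F'_def[abs_def]
    by (auto intro!: derivative_eq_intros DERIV_shift_arg[OF Cc_smooth_props(1)[OF f'(1)]])
  have c1: "continuous_on UNIV F'" using DERIV_continuous_on[of UNIV F'] dF' by (meson has_field_derivative_at_within)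
  have c2: "continuous_on UNIV (\<lambda>t. deriv (deriv f) (x + t))"
    by (intro continuous_on_compose2[OF Cc_smooth_props(2)[OF f''(1), of UNIV]]) (auto intro!: continuous_intros)
  obtain C1 where C1: "\<And>t. \<bar>deriv f t\<bar> \<le> C1" by (blast intro: Cc_bounded[OF f'(2)])
  obtain C2 where C2: "\<And>t. \<bar>deriv (deriv f) t\<bar> \<le> C2" by (blast intro: Cc_bounded[OF f''(2)])
  define C where "C = max (2 * C1) C2"
  have C: "C \<ge> 0" using C1[of 0] by (auto simp: C_def le_max_iff_disj)
  \<comment> \<open>The mean value theorem for small \<open>t\<close>, boundedness of the derivative
    for large \<open>t\<close>. The right-hand side is a multiple of the weight that the integrated
    tail of \<open>\<rho>\<close> is known to integrate.\<close>
  have F'_bound: "\<bar>F' t\<bar> \<le> C * min 1 \<bar>t\<bar>" for t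
  proof -
    have "\<bar>F' t\<bar> \<le> 2 * C1" using C1[of "x + t"] C1[of x] unfolding F'_def by linarith
    moreover have "\<bar>F' t\<bar> \<le> C2 * \<bar>t\<bar>"
      using field_differentiable_bound[of UNIV F' "\<lambda>t. deriv (deriv f) (x + t)" C2 t 0] dF' C2
      by (auto simp: F'_def)
    ultimately have "\<bar>F' t\<bar> \<le> C * 1" "\<bar>F' t\<bar> \<le> C * \<bar>t\<bar>"
      using mult_right_mono[of C2 C "\<bar>t\<bar>"] by (auto simp: C_def)
    then show ?thesis by (simp add: min_def)
  qed
  have i1: "(\<integral>\<^sup>+ t. ennreal \<bar>F' t\<bar> \<partial>\<rho>' x) < \<infinity>"
  proof -
    have "(\<integral>\<^sup>+ t. ennreal \<bar>F' t\<bar> \<partial>\<rho>' x) \<le> (\<integral>\<^sup>+ t. ennreal C * ennreal (min 1 \<bar>t\<bar>) \<partial>\<rho>' x)"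
      using F'_bound C by (intro nn_integral_mono) (simp add: ennreal_mult'[symmetric] ennreal_leI)
    also have "\<dots> < \<infinity>" using \<rho>'_min_finite by (simp add: nn_integral_cmult ennreal_mult_less_top)
    finally show ?thesis .
  qed
  note s1 = integral_increments_eq_tail[where Q=\<rho> and p=1 and q=1, OF sets_parts(3) sigma_finite_parts(3) tail_\<rho>_finite dF c1 i1]
  note s2 = integral_increments_eq_tail[where Q=\<rho>' and p=1 and q="-1", OF sets_integrated_tail sigma_finite_\<rho>' tail_\<rho>'_finite dF' c2
    V_integrable_Cc(3)[OF f''(2)]]
  have F0: "F y - F 0 = f (x + y) - f x - deriv f x * y" for y by (simp add: F_def)
  have F'0: "F' 0 = 0" by (simp add: F'_def)
  show "integrable (\<rho> x) (\<lambda>y. f (x + y) - f x - deriv f x * y)" using s1(1) by (simp add: F0)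
  have "(LINT y|\<rho> x. f (x + y) - f x - deriv f x * y) = (LINT t|\<rho>' x. sgn t * F' t)"
    using s1(2) by (simp add: F0)
  also have "\<dots> = (LINT t|\<rho>' x. (if t > 0 then 1 else -1) * (F' t - F' 0))"
    by (intro Bochner_Integration.integral_cong) (auto simp: sgn_if F'0)
  also have "\<dots> = (LINT t|integrated_tail \<rho>' x. (if t > 0 then 1 else -1) * sgn t * deriv (deriv f) (x + t))"
    by (rule s2(2))
  \<comment> \<open>The weight times the sign is 1 except at \<open>t = 0\<close>, where it is 0;
    but the tail, and with it the density, is 0 there by definition.\<close>
  also have "\<dots> = (LINT t|integrated_tail \<rho>' x. deriv (deriv f) (x + t))"
    by (subst (1 2) integral_integrated_tail(1)[where Q=\<rho>', OF sets_integrated_tail sigma_finite_\<rho>' tail_\<rho>'_finite])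
      (auto intro!: Bochner_Integration.integral_cong simp: sgn_if tail_def)
  finally show "(LINT y|\<rho> x. f (x + y) - f x - deriv f x * y) = WI (deriv (deriv f)) x"
    by (simp add: W_integrand_def double_integrated_tail_def)
qed

text \<open>The operator compensates the jumps of size below 1, whereas \<open>U\<close> and
  \<open>V\<close> arise without compensation and \<open>W\<close> with compensation of all jumps.
  The discrepancies are multiples of f'(x), and their sum is the drift correction.\<close>

lemma jump_integral_eq:
  assumes f: "f \<in> Cc_smooth" and j: "integrable (\<Lambda> x) (jump_integrand f x)"
  shows "(LINT y|\<Lambda> x. jump_integrand f x y) = UI f x + VI (deriv f) x +
    WI (deriv (deriv f)) x + drift_correction \<nu> \<mu> \<rho> x * deriv f x"
proof -
  define i where "i y = indicator {y. \<bar>y\<bar> < 1} y * y" for y :: real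
  define k where "k y = indicator {y. 1 \<le> \<bar>y\<bar>} y * y" for y :: real
  have [measurable]: "i \<in> borel_measurable borel" "k \<in> borel_measurable borel"
    unfolding i_def[abs_def] k_def[abs_def] by measurable
  have ik: "i y + k y = y" for y by (cases "\<bar>y\<bar> < 1") (simp_all add: i_def k_def indicator_def)
  note [measurable] = Cc_smooth_props(5)[OF f]
  obtain C where C: "\<And>t. \<bar>f t\<bar> \<le> C" by (blast intro: Cc_bounded[OF Cc_smooth_props(3)[OF f]])
  interpret \<nu>: finite_measure "\<nu> x" by (rule finite_measure_\<nu>)
  have i\<nu>: "integrable (\<nu> x) i"
    by (rule \<nu>.integrable_const_bound[of _ 1]) (auto simp: i_def indicator_def)
  have i\<mu>: "integrable (\<mu> x) i"
  proof (rule integrableI_bounded)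
    have "(\<integral>\<^sup>+ y. ennreal (norm (i y)) \<partial>\<mu> x) \<le> (\<integral>\<^sup>+ y. ennreal (min 1 \<bar>y\<bar>) \<partial>\<mu> x)"
      by (intro nn_integral_mono ennreal_leI) (auto simp: i_def indicator_def)
    then show "(\<integral>\<^sup>+ y. ennreal (norm (i y)) \<partial>\<mu> x) < \<infinity>" using parts_finite(2) order_le_less_trans by blast
  qed measurable
  have k\<rho>: "integrable (\<rho> x) k"
  proof (rule integrableI_bounded)
    have "(\<integral>\<^sup>+ y. ennreal (norm (k y)) \<partial>\<rho> x) \<le> (\<integral>\<^sup>+ y. ennreal (min \<bar>y\<bar> (\<bar>y\<bar>\<^sup>2)) \<partial>\<rho> x)"
    proof (intro nn_integral_mono ennreal_leI)
      fix y show "norm (k y) \<le> min \<bar>y\<bar> (\<bar>y\<bar>\<^sup>2)"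
        using self_le_power[of "\<bar>y\<bar>" 2] by (auto simp: k_def indicator_def)
    qed
    then show "(\<integral>\<^sup>+ y. ennreal (norm (k y)) \<partial>\<rho> x) < \<infinity>" using parts_finite(3) order_le_less_trans by blast
  qed measurable
  have J: "jump_integrand f x y = f (x + y) - f x - deriv f x * i y" for y
    by (simp add: jump_integrand_def i_def mult_ac)
  have N: "(LINT y|\<nu> x. jump_integrand f x y) = UI f x - deriv f x * (LINT y|\<nu> x. i y)"
    unfolding J U_integrand_def using U_integrable[OF Cc_smooth_props(5)[OF f] C, where x=x] i\<nu> by simp
  have M: "(LINT y|\<mu> x. jump_integrand f x y) = VI (deriv f) x - deriv f x * (LINT y|\<mu> x. i y)"
    unfolding J small_jump_increments(2)[OF f, symmetric]
    using small_jump_increments(1)[OF f] i\<mu> by (subst Bochner_Integration.integral_diff) auto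
  have P: "(LINT y|\<rho> x. jump_integrand f x y) = WI (deriv (deriv f)) x + deriv f x * (LINT y|\<rho> x. k y)"
  proof -
    have "jump_integrand f x y = (f (x + y) - f x - deriv f x * y) + deriv f x * k y" for y
      unfolding J by (subst (3) ik[symmetric]) (simp add: algebra_simps)
    then show ?thesis
      unfolding large_jump_increments(2)[OF f, symmetric]
      using large_jump_increments(1)[OF f] k\<rho> by (simp only:) (subst Bochner_Integration.integral_add, auto)
  qed
  have d: "drift_correction \<nu> \<mu> \<rho> x = - (LINT y|\<nu> x. i y) - (LINT y|\<mu> x. i y) + (LINT y|\<rho> x. k y)"
    by (simp add: drift_correction_def set_lebesgue_integral_def i_def k_def)
  show ?thesis
    unfolding integral_split[OF j] N M P d by (simp add: algebra_simps)
qed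

end

section \<open>Uniform bounds for the jump functionals and local integrability of the mass\<close>

lemma radon_measure_sigma_finite:
  assumes "radon_measure \<eta>" shows "sigma_finite_measure \<eta>"
proof
  have s: "sets \<eta> = sets borel" using assms by (simp add: radon_measure_def)
  have "(\<Union>n. {- real n..real n}) = UNIV"
  proof (intro equalityI subsetI UNIV_I)
    fix x :: real
    obtain n where "\<bar>x\<bar> \<le> real n" using real_arch_simple by blast
    then show "x \<in> (\<Union>n. {- real n..real n})" by (auto simp: abs_le_iff intro!: exI[of _ n])
  qed
  then show "\<exists>A. countable A \<and> A \<subseteq> sets \<eta> \<and> \<Union>A = space \<eta> \<and> (\<forall>a\<in>A. emeasure \<eta> a \<noteq> \<infinity>)"
    using assms s sets_eq_imp_space_eq[OF s]
    by (intro exI[of _ "range (\<lambda>n::nat. {- real n..real n})"]) (auto simp: radon_measure_def less_top)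
qed

locale order_zero_kernels = convenient_kernels +
  fixes \<eta> :: "real measure"
  assumes radon: "radon_measure \<eta>"
    and U: "order_zero (U_integrand \<nu>) \<eta>"
    and V: "order_zero (V_integrand \<mu>) \<eta>"
    and W: "order_zero (W_integrand \<rho>) \<eta>"
begin

lemma sets_\<eta> [simp, measurable_cong]: "sets \<eta> = sets borel"
  using radon by (simp add: radon_measure_def)

lemma space_\<eta> [simp]: "space \<eta> = UNIV"
  using sets_eq_imp_space_eq[OF sets_\<eta>] by simp

sublocale \<eta>: sigma_finite_measure \<eta>
  by (rule radon_measure_sigma_finite[OF radon])

lemma jump_functionals_integrable:
  assumes "f \<in> Cc"
  shows "integrable \<eta> (UI f)" "integrable \<eta> (VI f)" "integrable \<eta> (WI f)"
  using U V W assms by (auto simp: order_zero_def)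

lemma V_bounded:
  "\<exists>C\<ge>0. \<forall>f\<in>Cc. (\<forall>x. \<bar>f x\<bar> \<le> 1) \<longrightarrow> (\<forall>x. \<bar>x\<bar> > R \<longrightarrow> f x = 0) \<longrightarrow> (LINT z|\<eta>. \<bar>VI f z\<bar>) \<le> C"
proof (rule Cc_operator_bounded[where T="VI" and M=\<eta>])
  show "VI (\<lambda>x. f x + g x) z = VI f z + VI g z"
    if "f \<in> Cc" "g \<in> Cc" for f g z
    using V_integrable_Cc(2)[OF that(1)] V_integrable_Cc(2)[OF that(2)]
    by (simp add: V_integrand_def distrib_right)
  show "VI (\<lambda>x. c * f x) z = c * VI f z" if "f \<in> Cc" for c f z
    by (simp add: V_integrand_def mult.assoc)
  show "(\<lambda>n. VI (F n) z) \<longlonglongrightarrow> VI f z"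
    if "\<And>n. F n \<in> Cc" "f \<in> Cc" "\<And>n x. \<bar>F n x\<bar> \<le> C" "\<And>n x. \<bar>x\<bar> > R \<Longrightarrow> F n x = 0" "\<And>x. (\<lambda>n. F n x) \<longlonglongrightarrow> f x"
    for z F f C R
    by (rule V_integrand_tendsto[where C=C and R=R]) (use that Cc_borel in auto)
qed (rule jump_functionals_integrable)

lemma U_bounded:
  "\<exists>C\<ge>0. \<forall>f\<in>Cc. (\<forall>x. \<bar>f x\<bar> \<le> 1) \<longrightarrow> (\<forall>x. \<bar>x\<bar> > R \<longrightarrow> f x = 0) \<longrightarrow> (LINT z|\<eta>. \<bar>UI f z\<bar>) \<le> C"
proof (rule Cc_operator_bounded[where T="UI" and M=\<eta>])
  have i: "integrable (\<nu> z) (\<lambda>y. f (z + y))" if f: "f \<in> Cc" for f z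
  proof -
    obtain C where C: "\<And>x. \<bar>f x\<bar> \<le> C" by (blast intro: Cc_bounded[OF f])
    show ?thesis by (rule U_integrable[OF Cc_borel[OF f] C])
  qed
  show "UI (\<lambda>x. f x + g x) z = UI f z + UI g z"
    if "f \<in> Cc" "g \<in> Cc" for f g z
    using i[OF that(1)] i[OF that(2)] by (simp add: U_integrand_def distrib_right)
  show "UI (\<lambda>x. c * f x) z = c * UI f z" if "f \<in> Cc" for c f z
    by (simp add: U_integrand_def algebra_simps)
  show "(\<lambda>n. UI (F n) z) \<longlonglongrightarrow> UI f z"
    if "\<And>n. F n \<in> Cc" "f \<in> Cc" "\<And>n x. \<bar>F n x\<bar> \<le> C" "\<And>n x. \<bar>x\<bar> > R \<Longrightarrow> F n x = 0" "\<And>x. (\<lambda>n. F n x) \<longlonglongrightarrow> f x"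
    for z F f C R
    by (rule U_integrand_tendsto[where C=C]) (use that Cc_borel in auto)
qed (rule jump_functionals_integrable)

abbreviation mass :: "real \<Rightarrow> real" where
  "mass z \<equiv> measure (\<nu> z) UNIV"

lemma mass_measurable [measurable]: "mass \<in> borel_measurable borel"
proof -
  have "(\<lambda>z. \<integral>\<^sup>+ y. 1 \<partial>\<nu> z) \<in> borel_measurable borel"
    by (rule parts_nn_integral_measurable(1)) auto
  then have "(\<lambda>z. enn2real (\<integral>\<^sup>+ y. 1 \<partial>\<nu> z)) \<in> borel_measurable borel" by measurable
  then show ?thesis by (simp add: measure_def)
qed

text \<open>\<open>U\<close> is tested against \<open>cos (k t x)\<close> and \<open>sin (k t x)\<close>, \<open>k < n\<close>. Combining the two gives
  \<open>\<integral> cos (k t y) \<nu>(z, dy) - \<nu>(z, \<real>)\<close>, where the first term disappears in the mean over \<open>k\<close> since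
  \<open>\<nu>(z, \<cdot>)\<close> has no atom at \<open>0\<close>.\<close>

lemma mass_locally_integrable:
  assumes R: "R \<ge> 0"
  shows "(\<integral>\<^sup>+ z. ennreal (mass z) * indicator {-R..R} z \<partial>\<eta>) < \<infinity>"
proof -
  obtain C where C: "C \<ge> 0" and bound: "\<And>f. \<lbrakk>f \<in> Cc; \<And>x. \<bar>f x\<bar> \<le> 1; \<And>x. \<bar>x\<bar> > R + 1 \<Longrightarrow> f x = 0\<rbrakk>
      \<Longrightarrow> (LINT z|\<eta>. \<bar>UI f z\<bar>) \<le> C"
    using U_bounded[of "R + 1"] by blast
  \<comment> \<open>If \<open>z\<close> lies in [-R, R] and \<open>z + y\<close> in the support of
    the cutoff, then |y| is at most 2 R + 2. This frequency therefore keeps |t y| at most 1, as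
    \<open>mean_cos_tendsto_0\<close> requires.\<close>
  define t where "t = 1 / (2 * R + 2)"
  have t: "t > 0" using R by (simp add: t_def)
  define p where "p k x = cutoff R x * cos (real k * t * x)" for k :: nat and x
  define q where "q k x = cutoff R x * sin (real k * t * x)" for k :: nat and x
  have pq: "p k \<in> Cc" "q k \<in> Cc" for k
    unfolding p_def[abs_def] q_def[abs_def]
    by (rule CcI[where R="R+1"]; auto intro!: continuous_intros simp: cutoff_simps)+
  have pq1: "\<bar>p k x\<bar> \<le> 1" "\<bar>q k x\<bar> \<le> 1" for k x
    unfolding p_def q_def abs_mult by (auto intro!: mult_le_one simp: cutoff_simps)
  have pq0: "p k x = 0" "q k x = 0" if "\<bar>x\<bar> > R + 1" for k x
    using that by (auto simp: p_def q_def cutoff_simps)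
  have intU: "integrable \<eta> (UI (p k))" "integrable \<eta> (UI (q k))" for k
    using pq by (auto intro: jump_functionals_integrable)
  have [measurable]: "cutoff R \<in> borel_measurable borel"
    by (intro borel_measurable_continuous_onI cutoff_simps)
  define D where "D n z y = cutoff R (z + y) * ((\<Sum>k<n. cos (real k * (t * y))) / real n)" for n z y
  define S where "S n z = (\<Sum>k<n. \<bar>UI (p k) z\<bar> + \<bar>UI (q k) z\<bar>) / real n" for n z
  have intc: "integrable (\<nu> z) (\<lambda>y. cutoff R (z + y) * cos (real k * (t * y)))" for z k
  proof -
    interpret finite_measure "\<nu> z" by (rule finite_measure_\<nu>)
    show ?thesis by (rule integrable_const_bound[of _ 1]) (auto simp: abs_mult intro!: mult_le_one cutoff_simps)
  qed
  \<comment> \<open>Weighting \<open>p k\<close> and \<open>q k\<close> by their own values at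
    \<open>z\<close> produces the cosine of a difference, in which \<open>z\<close> drops out except
    in the cutoff. The squares of the weights add up to 1, which leaves the full mass of
    \<open>\<nu> z\<close>.\<close>
  have step: "mass z - (LINT y|\<nu> z. cutoff R (z + y) * cos (real k * (t * y)))
      \<le> \<bar>UI (p k) z\<bar> + \<bar>UI (q k) z\<bar>" if z: "\<bar>z\<bar> \<le> R" for k z
  proof -
    define c s where "c = cos (real k * t * z)" and "s = sin (real k * t * z)"
    have cs: "c\<^sup>2 + s\<^sup>2 = 1" "\<bar>c\<bar> \<le> 1" "\<bar>s\<bar> \<le> 1" by (simp_all add: c_def s_def)
    have ip: "integrable (\<nu> z) (\<lambda>y. p k (z + y))" "integrable (\<nu> z) (\<lambda>y. q k (z + y))"
      using U_integrable[OF Cc_borel[OF pq(1)] pq1(1)] U_integrable[OF Cc_borel[OF pq(2)] pq1(2)] by auto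
    have z1: "p k z = c" "q k z = s" using z by (auto simp: p_def q_def c_def s_def cutoff_simps)
    have "c * UI (p k) z + s * UI (q k) z =
      (LINT y|\<nu> z. c * p k (z + y) + s * q k (z + y)) - (c\<^sup>2 + s\<^sup>2) * mass z"
      unfolding U_integrand_def z1 using ip by (simp add: algebra_simps power2_eq_square)
    also have "(\<lambda>y. c * p k (z + y) + s * q k (z + y)) = (\<lambda>y. cutoff R (z + y) * cos (real k * (t * y)))"
    proof
      fix y
      have "cos (real k * (t * y)) = cos (real k * t * (z + y) - real k * t * z)" by (simp add: algebra_simps)
      also have "\<dots> = cos (real k * t * (z + y)) * c + sin (real k * t * (z + y)) * s" unfolding c_def s_def by (rule cos_diff)
      finally show "c * p k (z + y) + s * q k (z + y) = cutoff R (z + y) * cos (real k * (t * y))"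
        by (simp add: p_def q_def algebra_simps)
    qed
    finally have "mass z - (LINT y|\<nu> z. cutoff R (z + y) * cos (real k * (t * y))) =
      - (c * UI (p k) z + s * UI (q k) z)" by (simp add: cs)
    also have "\<dots> \<le> \<bar>c\<bar> * \<bar>UI (p k) z\<bar> + \<bar>s\<bar> * \<bar>UI (q k) z\<bar>"
      unfolding abs_mult[symmetric] by linarith
    also have "\<dots> \<le> 1 * \<bar>UI (p k) z\<bar> + 1 * \<bar>UI (q k) z\<bar>"
      by (intro add_mono mult_right_mono) (auto simp: cs)
    finally show ?thesis by simp
  qed
  have mean: "mass z - (LINT y|\<nu> z. D n z y) \<le> S n z" if z: "\<bar>z\<bar> \<le> R" and n: "n > 0" for n z
  proof -
    have "(LINT y|\<nu> z. D n z y) = (LINT y|\<nu> z. (\<Sum>k<n. cutoff R (z + y) * cos (real k * (t * y))) / real n)"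
      by (simp add: D_def sum_distrib_left)
    also have "\<dots> = (\<Sum>k<n. \<integral>y. cutoff R (z + y) * cos (real k * (t * y)) \<partial>\<nu> z) / real n"
      using intc by (simp add: Bochner_Integration.integral_sum)
    finally have "mass z - (LINT y|\<nu> z. D n z y) =
      (\<Sum>k<n. mass z - (LINT y|\<nu> z. cutoff R (z + y) * cos (real k * (t * y)))) / real n"
      using n by (simp add: sum_subtractf diff_divide_distrib)
    also have "\<dots> \<le> S n z" unfolding S_def by (intro divide_right_mono sum_mono step z) auto
    finally show ?thesis .
  qed
  have lim: "(\<lambda>n. mass z - (LINT y|\<nu> z. D n z y)) \<longlonglongrightarrow> mass z" if z: "\<bar>z\<bar> \<le> R" for z
  proof -
    interpret finite_measure "\<nu> z" by (rule finite_measure_\<nu>)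
    have "(\<lambda>n. \<integral>y. D n z y \<partial>\<nu> z) \<longlonglongrightarrow> (LINT y|\<nu> z. 0)"
    proof (rule integral_dominated_convergence[where w="\<lambda>_. 1"])
      show "AE y in \<nu> z. norm (D n z y) \<le> 1" for n
      proof (rule AE_I2)
        fix y
        have "\<bar>\<Sum>k<n. cos (real k * (t * y))\<bar> \<le> (\<Sum>k<n. 1)"
          by (intro order_trans[OF sum_abs] sum_mono) auto
        then have "\<bar>(\<Sum>k<n. cos (real k * (t * y))) / real n\<bar> \<le> 1"
          by (cases "n = 0") (auto simp: abs_divide divide_le_eq)
        then show "norm (D n z y) \<le> 1"
            unfolding D_def real_norm_def abs_mult by (intro mult_le_one cutoff_simps) auto
      qed
      show "AE y in \<nu> z. (\<lambda>n. D n z y) \<longlonglongrightarrow> 0"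
        using \<nu>_zero
      proof eventually_elim
        case (elim y)
        show ?case
        proof (cases "\<bar>z + y\<bar> \<ge> R + 1")
          case True
          then show ?thesis by (simp add: D_def cutoff_simps)
        next
          case False
          then have "\<bar>y\<bar> \<le> 2 * R + 2" using z by linarith
          then have "\<bar>t * y\<bar> \<le> 1" using R by (simp add: t_def abs_mult divide_le_eq)
          moreover have "t * y \<noteq> 0" using t elim by simp
          ultimately show ?thesis unfolding D_def by (intro tendsto_mult_right_zero mean_cos_tendsto_0)
        qed
      qed
    qed (auto simp: D_def)
    from tendsto_diff[OF tendsto_const this] show ?thesis by simp
  qed
  have S_int: "integrable \<eta> (S n)" for n unfolding S_def[abs_def] using intU by auto
  \<comment> \<open>\<open>S n\<close> is a mean of \<open>n\<close> terms, each with integral at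
    most \<open>C + C\<close>, so the bound does not depend on \<open>n\<close> and survives Fatou's
    lemma.\<close>
  have S_bound: "(LINT z|\<eta>. S n z) \<le> 2 * C" for n
  proof -
    have "(LINT z|\<eta>. S n z) = (\<Sum>k<n. (LINT z|\<eta>. \<bar>UI (p k) z\<bar>) + (LINT z|\<eta>. \<bar>UI (q k) z\<bar>)) / real n"
      unfolding S_def using intU by (simp add: Bochner_Integration.integral_sum)
    also have "\<dots> \<le> (\<Sum>k<n. C + C) / real n"
      by (intro divide_right_mono sum_mono add_mono bound) (use pq pq1 pq0 in auto)
    also have "\<dots> \<le> 2 * C" using C by (cases "n = 0") auto
    finally show ?thesis .
  qed
  have "(\<integral>\<^sup>+ z. ennreal (mass z) * indicator {-R..R} z \<partial>\<eta>) \<le> (\<integral>\<^sup>+ z. liminf (\<lambda>n. ennreal (S n z)) \<partial>\<eta>)"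
  proof (rule nn_integral_mono)
    fix z
    show "ennreal (mass z) * indicator {-R..R} z \<le> liminf (\<lambda>n. ennreal (S n z))"
    proof (cases "\<bar>z\<bar> \<le> R")
      case True
      have "ennreal (mass z) = liminf (\<lambda>n. ennreal (mass z - (LINT y|\<nu> z. D n z y)))"
        by (rule sym, rule lim_imp_Liminf) (use lim[OF True] in auto)
      also have "\<dots> \<le> liminf (\<lambda>n. ennreal (S n z))"
        by (intro Liminf_mono eventually_mono[OF eventually_gt_at_top[of 0]] ennreal_leI mean True)
      finally show ?thesis using True by (simp add: indicator_def)
    qed (auto simp: indicator_def)
  qed
  also have "\<dots> \<le> liminf (\<lambda>n. \<integral>\<^sup>+ z. ennreal (S n z) \<partial>\<eta>)"
    using S_int by (intro nn_integral_liminf) auto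
  also have "\<dots> \<le> liminf (\<lambda>n::nat. ennreal (2 * C))"
  proof (intro Liminf_mono always_eventually allI)
    fix n
    have "(\<integral>\<^sup>+ z. ennreal (S n z) \<partial>\<eta>) = ennreal (LINT z|\<eta>. S n z)"
      by (rule nn_integral_eq_integral[OF S_int]) (auto simp: S_def intro!: divide_nonneg_nonneg sum_nonneg)
    then show "(\<integral>\<^sup>+ z. ennreal (S n z) \<partial>\<eta>) \<le> ennreal (2 * C)" using S_bound by (simp add: ennreal_leI)
  qed
  also have "\<dots> < \<infinity>" by (simp add: Liminf_const)
  finally show ?thesis .
qed

end

section \<open>Kernels of the integral equation\<close>

lemma integrable_pair_product_bound:
  fixes f :: "'a \<times> 'b \<Rightarrow> real"
  assumes sf: "sigma_finite_measure M1" "sigma_finite_measure M2"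
    and f[measurable]: "f \<in> borel_measurable (M1 \<Otimes>\<^sub>M M2)"
    and u: "integrable M1 u" and v: "integrable M2 v"
    and le: "\<And>x y. x \<in> space M1 \<Longrightarrow> y \<in> space M2 \<Longrightarrow> \<bar>f (x, y)\<bar> \<le> u x * v y"
    and u0: "\<And>x. 0 \<le> u x" and v0: "\<And>y. 0 \<le> v y"
  shows "integrable (M1 \<Otimes>\<^sub>M M2) f"
proof (rule integrableI_bounded[OF f])
  interpret M1: sigma_finite_measure M1 by fact
  interpret M2: sigma_finite_measure M2 by fact
  interpret pair_sigma_finite M1 M2 ..
  have [measurable]: "u \<in> borel_measurable M1" "v \<in> borel_measurable M2" using u v by auto
  have "(\<integral>\<^sup>+ p. ennreal (norm (f p)) \<partial>(M1 \<Otimes>\<^sub>M M2)) = (\<integral>\<^sup>+ x. (\<integral>\<^sup>+ y. ennreal \<bar>f (x, y)\<bar> \<partial>M2) \<partial>M1)"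
    by (subst M2.nn_integral_fst[symmetric]) auto
  also have "\<dots> \<le> (\<integral>\<^sup>+ x. (\<integral>\<^sup>+ y. ennreal (u x) * ennreal (v y) \<partial>M2) \<partial>M1)"
    by (intro nn_integral_mono) (simp add: le u0 ennreal_mult'[symmetric] ennreal_leI)
  also have "\<dots> = (\<integral>\<^sup>+ x. ennreal (u x) \<partial>M1) * (\<integral>\<^sup>+ y. ennreal (v y) \<partial>M2)"
    by (simp add: nn_integral_cmult nn_integral_multc)
  also have "\<dots> < \<infinity>"
    using u v u0 v0 by (simp add: nn_integral_eq_integral ennreal_mult_less_top)
  finally show "(\<integral>\<^sup>+ p. ennreal (norm (f p)) \<partial>(M1 \<Otimes>\<^sub>M M2)) < \<infinity>" .
qed

lemma lborel_shift:
  fixes f :: "real \<Rightarrow> real"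
  shows "(LBINT w. f w) = (LBINT t. f (z + t))"
    "integrable lborel (\<lambda>t. f (z + t)) \<longleftrightarrow> integrable lborel f"
  using lborel_integral_real_affine[of 1 f z] lborel_integrable_real_affine_iff[of 1 f z] by auto

text \<open>Integration against \<open>step x\<close> is oriented integration from 0 to
  \<open>x\<close>. This merges the cases \<open>x > 0\<close> and \<open>x \<le> 0\<close> of the
  kernels and encodes the sign convention of the Volterra integral, including its half-open
  endpoints.\<close>

definition step :: "real \<Rightarrow> real \<Rightarrow> real" where
  "step x w = indicator {0<..x} w - indicator {x<..0} w"

lemma step_simps:
  "x > 0 \<Longrightarrow> step x w = indicator {0<..x} w"
  "x \<le> 0 \<Longrightarrow> step x w = - indicator {x<..0} w"
  by (auto simp: step_def)

lemma step_bounds: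
  "\<bar>step x w\<bar> \<le> 1" "\<bar>x\<bar> \<le> R \<Longrightarrow> \<bar>w\<bar> > R \<Longrightarrow> step x w = 0" "0 \<le> step x w * (x - w)"
  "\<bar>step x w * (x - w)\<bar> \<le> \<bar>x\<bar>" 
  by (auto simp: step_def indicator_def)

lemma step_measurable:
  "(\<lambda>(x, w). step x w) \<in> borel_measurable (borel \<Otimes>\<^sub>M borel)"
proof -
  have "(\<lambda>(x, w). step x w) = (\<lambda>p. (if 0 < snd p \<and> snd p \<le> fst p then 1 else 0) - (if fst p < snd p \<and> snd p \<le> 0 then 1 else 0))"
    by (auto simp: step_def indicator_def fun_eq_iff)
  then show ?thesis by simp
qed

lemma step_measurable_compose [measurable (raw)]:
  "f \<in> borel_measurable M \<Longrightarrow> g \<in> borel_measurable M \<Longrightarrow> (\<lambda>p. step (f p) (g p)) \<in> borel_measurable M"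
  using measurable_compose[OF measurable_Pair step_measurable, of f M g] by simp

text \<open>The point \<open>w\<close> is counted by all \<open>u\<close> between \<open>w\<close>
  and \<open>x\<close>, so the iterated integral in the first kernel has weight |x - w|. For
  \<open>x \<le> 0\<close> both \<open>step x w\<close> and \<open>x - w\<close> are nonpositive on
  the relevant range, which makes the product correct in either case.\<close>

lemma integral_indicator_pair:
  "(LBINT u. indicator {0<..x} u * indicator {0<..u} w) = (if x > 0 then step x w * (x - w) else 0)"
  "(LBINT u. indicator {x<..0} u * indicator {u<..0} w) = (if x \<le> 0 then step x w * (x - w) else (0::real))"
proof -
  show "(LBINT u. indicator {0<..x} u * indicator {0<..u} w) = (if x > 0 then step x w * (x - w) else 0)"
  proof (cases "0 < w \<and> w \<le> x")
    case True
    then have "(\<lambda>u. indicator {0<..x} u * indicator {0<..u} w :: real) = indicator {w..x}"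
      by (auto simp: indicator_def fun_eq_iff)
    then show ?thesis using True by (simp add: step_simps)
  next
    case False
    then have "(\<lambda>u. indicator {0<..x} u * indicator {0<..u} w :: real) = (\<lambda>u. 0)"
      by (auto simp: indicator_def fun_eq_iff)
    then show ?thesis using False by (auto simp: step_simps)
  qed
  show "(LBINT u. indicator {x<..0} u * indicator {u<..0} w) = (if x \<le> 0 then step x w * (x - w) else (0::real))"
  proof (cases "x < w \<and> w \<le> 0")
    case True
    then have "(\<lambda>u. indicator {x<..0} u * indicator {u<..0} w :: real) = indicator {x<..<w}"
      by (auto simp: indicator_def fun_eq_iff)
    then show ?thesis using True by (simp add: step_simps)
  next
    case False
    then have "(\<lambda>u. indicator {x<..0} u * indicator {u<..0} w :: real) = (\<lambda>u. 0)"
      by (auto simp: indicator_def fun_eq_iff)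
    then show ?thesis using False by (auto simp: step_simps)
  qed
qed

lemma integrable_indicator_Icc [simp]: "integrable lborel (indicator {a..b::real} :: real \<Rightarrow> real)"
  by (cases "a \<le> b") auto

text \<open>As a function of \<open>x\<close>, \<open>step x z\<close> is the indicator of [z,
  \<infinity>) if \<open>z > 0\<close>, and minus the indicator of (-\<infinity>, z) if
  \<open>z \<le> 0\<close>. Both half lines lead to the same boundary term.\<close>

lemma integral_step_deriv:
  fixes G G' :: "real \<Rightarrow> real"
  assumes d: "\<And>x. (G has_real_derivative G' x) (at x)" and c: "continuous_on UNIV G'"
    and R: "R > 0" "\<And>x. \<bar>x\<bar> \<ge> R \<Longrightarrow> G x = 0" "\<And>x. \<bar>x\<bar> \<ge> R \<Longrightarrow> G' x = 0"
  shows "integrable lborel (\<lambda>x. step x z * G' x)" "(LBINT x. step x z * G' x) = - G z"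
proof -
  \<comment> \<open>The half line is cut off at a point beyond the support, so that the fundamental
    theorem applies on a compact interval.\<close>
  define lo hi where "lo = (if z > 0 then z else min z (-R))" and "hi = (if z > 0 then max z R else z)"
  have lh: "lo \<le> hi" by (auto simp: lo_def hi_def)
  have c': "isCont G' t" for t using c by (simp add: continuous_on_eq_continuous_at)
  have [measurable]: "G' \<in> borel_measurable borel" by (rule borel_measurable_continuous_onI[OF c])
  define \<epsilon> where "\<epsilon> = (if z > 0 then 1 else -1 :: real)"
  have ae: "AE x in lborel. step x z * G' x = \<epsilon> * (G' x * indicator {lo..hi} x)"
    using AE_lborel_singleton[of z]
  proof eventually_elim
    case (elim x)
    show ?case
    proof (cases "\<bar>x\<bar> \<ge> R")
      case False
      then show ?thesis using elim by (auto simp: step_def indicator_def \<epsilon>_def lo_def hi_def)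
    qed (simp add: R)
  qed
  have i: "integrable lborel (\<lambda>x. G' x * indicator {lo..hi} x)"
    using borel_integrable_compact[of "{lo..hi}" G'] continuous_on_subset[OF c, of "{lo..hi}"]
    by (simp add: mult.commute)
  have v: "(LBINT x. G' x * indicator {lo..hi} x) = G hi - G lo"
    by (rule integral_FTC_Icc_real[OF lh d c'])
  show "integrable lborel (\<lambda>x. step x z * G' x)"
    by (subst integrable_cong_AE[OF _ _ ae]) (use i in auto)
  have "(LBINT x. step x z * G' x) = (LBINT x. \<epsilon> * (G' x * indicator {lo..hi} x))"
    by (rule integral_cong_AE[OF _ _ ae]) auto
  also have "\<dots> = \<epsilon> * (G hi - G lo)" by (simp add: v)
  also have "\<dots> = - G z"
  proof (cases "z > 0")
    case True
    then have "G hi = 0" using R by (auto simp: hi_def max_def)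
    then show ?thesis using True by (simp add: \<epsilon>_def lo_def)
  next
    case False
    then have "G lo = 0" using R by (auto simp: lo_def min_def)
    then show ?thesis using False by (simp add: \<epsilon>_def hi_def)
  qed
  finally show "(LBINT x. step x z * G' x) = - G z" .
qed

lemma integral_step_second_deriv:
  assumes f: "f \<in> Cc_smooth"
  shows "integrable lborel (\<lambda>x. step x z * deriv (deriv f) x)"
    "(LBINT x. step x z * deriv (deriv f) x) = - deriv f z"
    "integrable lborel (\<lambda>x. step x z * (x - z) * deriv (deriv f) x)"
    "(LBINT x. step x z * (x - z) * deriv (deriv f) x) = f z"
proof -
  note f' = Cc_smooth_props(4)[OF f] note f'' = Cc_smooth_props(4)[OF f']
  obtain R0 where R0: "R0 > 0" "\<And>x. \<bar>x\<bar> \<ge> R0 \<Longrightarrow> f x = 0" by (blast intro: Cc_smooth_supportE[OF f])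
  obtain R1 where R1: "R1 > 0" "\<And>x. \<bar>x\<bar> \<ge> R1 \<Longrightarrow> deriv f x = 0" by (blast intro: Cc_smooth_supportE[OF f'])
  obtain R2 where R2: "R2 > 0" "\<And>x. \<bar>x\<bar> \<ge> R2 \<Longrightarrow> deriv (deriv f) x = 0" by (blast intro: Cc_smooth_supportE[OF f''])
  define R where "R = max R0 (max R1 R2)"
  have R: "R > 0" "\<And>x. \<bar>x\<bar> \<ge> R \<Longrightarrow> f x = 0" "\<And>x. \<bar>x\<bar> \<ge> R \<Longrightarrow> deriv f x = 0" "\<And>x. \<bar>x\<bar> \<ge> R \<Longrightarrow> deriv (deriv f) x = 0"
    using R0 R1 R2 by (auto simp: R_def)
  note d = Cc_smooth_props(1)[OF f] Cc_smooth_props(1)[OF f']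
  note c = Cc_smooth_props(2)[OF f'', of UNIV]
  show "integrable lborel (\<lambda>x. step x z * deriv (deriv f) x)"
    "(LBINT x. step x z * deriv (deriv f) x) = - deriv f z"
    using integral_step_deriv[OF d(2) c R(1) R(3,4)] by auto
  \<comment> \<open>This primitive of (x - z) f''(x) has compact support and the value - f(z) at
    \<open>z\<close>.\<close>
  have dG: "((\<lambda>x. (x - z) * deriv f x - f x) has_real_derivative (x - z) * deriv (deriv f) x) (at x)" for x
    using d by (auto intro!: derivative_eq_intros)
  have cG: "continuous_on UNIV (\<lambda>x. (x - z) * deriv (deriv f) x)"
    by (intro continuous_intros c)
  note * = integral_step_deriv[OF dG cG R(1), of z]
  show "integrable lborel (\<lambda>x. step x z * (x - z) * deriv (deriv f) x)"
    using *(1) R by (simp add: mult.assoc)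
  show "(LBINT x. step x z * (x - z) * deriv (deriv f) x) = f z"
    using *(2) R by (simp add: mult.assoc)
qed

section \<open>Local integrability of kernels and the exchange with \<open>\<eta>\<close>\<close>

context order_zero_kernels
begin

sublocale pair: pair_sigma_finite lborel \<eta> ..

abbreviation slice_norm :: "(real \<Rightarrow> real \<Rightarrow> real) \<Rightarrow> real \<Rightarrow> ennreal" where
  "slice_norm P x \<equiv> \<integral>\<^sup>+ z. ennreal \<bar>P x z\<bar> \<partial>\<eta>"

text \<open>Integrability over [-R, R] times the whole line: local in \<open>x\<close>, where the
  test function sits, but global in \<open>z\<close>. It is imposed on the integral over
  \<open>x\<close> and not on each slice, since the order zero condition on \<open>W\<close> bounds
  only such integrals.\<close>

definition locally_integrable :: "(real \<Rightarrow> real \<Rightarrow> real) \<Rightarrow> bool" where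
  "locally_integrable P \<longleftrightarrow> (\<lambda>(x, z). P x z) \<in> borel_measurable (borel \<Otimes>\<^sub>M borel) \<and>
    (\<forall>R. (\<integral>\<^sup>+ x. slice_norm P x * indicator {-R..R} x \<partial>lborel) < \<infinity>)"

lemma locally_integrableD:
  assumes "locally_integrable P"
  shows locally_integrable_measurable: "(\<lambda>(x, z). P x z) \<in> borel_measurable (lborel \<Otimes>\<^sub>M \<eta>)"
    and locally_integrable_finite: "(\<integral>\<^sup>+ x. slice_norm P x * indicator {-R..R} x \<partial>lborel) < \<infinity>"
proof -
  have "sets (lborel \<Otimes>\<^sub>M \<eta>) = sets (borel \<Otimes>\<^sub>M borel)" by (rule sets_pair_measure_cong) auto
  then show "(\<lambda>(x, z). P x z) \<in> borel_measurable (lborel \<Otimes>\<^sub>M \<eta>)"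
    using assms by (simp add: locally_integrable_def cong: measurable_cong_sets)
qed (use assms in \<open>simp add: locally_integrable_def\<close>)

lemma locally_integrable_lincomb:
  assumes P: "locally_integrable P" and Q: "locally_integrable Q" and c: "\<bar>c\<bar> \<le> 1"
  shows "locally_integrable (\<lambda>x z. c * P x z + Q x z)"
  unfolding locally_integrable_def
proof (intro conjI allI)
  have [measurable]: "(\<lambda>(x, z). P x z) \<in> borel_measurable (borel \<Otimes>\<^sub>M borel)"
      "(\<lambda>(x, z). Q x z) \<in> borel_measurable (borel \<Otimes>\<^sub>M borel)" using P Q by (auto simp: locally_integrable_def)
  show "(\<lambda>(x, z). c * P x z + Q x z) \<in> borel_measurable (borel \<Otimes>\<^sub>M borel)" by measurable
  note [measurable] = locally_integrableD(1)[OF P] locally_integrableD(1)[OF Q]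
  fix R
  have "(\<integral>\<^sup>+ x. (\<integral>\<^sup>+ z. ennreal \<bar>c * P x z + Q x z\<bar> \<partial>\<eta>) * indicator {-R..R} x \<partial>lborel) \<le>
     (\<integral>\<^sup>+ x. (\<integral>\<^sup>+ z. ennreal \<bar>P x z\<bar> + ennreal \<bar>Q x z\<bar> \<partial>\<eta>) * indicator {-R..R} x \<partial>lborel)"
  proof (intro nn_integral_mono mult_right_mono)
    fix x z
    have "\<bar>c * P x z + Q x z\<bar> \<le> \<bar>P x z\<bar> + \<bar>Q x z\<bar>"
      using mult_right_mono[OF c, of "\<bar>P x z\<bar>"] by (auto simp: abs_mult intro: order_trans[OF abs_triangle_ineq])
    then show "ennreal \<bar>c * P x z + Q x z\<bar> \<le> ennreal \<bar>P x z\<bar> + ennreal \<bar>Q x z\<bar>"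
      by (simp add: ennreal_leI flip: ennreal_plus)
  qed simp
  also have "\<dots> = (\<integral>\<^sup>+ x. slice_norm P x * indicator {-R..R} x \<partial>lborel) +
     (\<integral>\<^sup>+ x. slice_norm Q x * indicator {-R..R} x \<partial>lborel)"
    by (simp add: nn_integral_add distrib_right)
  also have "\<dots> < \<infinity>" using locally_integrableD(2)[OF P, of R] locally_integrableD(2)[OF Q, of R] by simp
  finally show "(\<integral>\<^sup>+ x. (\<integral>\<^sup>+ z. ennreal \<bar>c * P x z + Q x z\<bar> \<partial>\<eta>) * indicator {-R..R} x \<partial>lborel) < \<infinity>" .
qed

lemma locally_integrable_AE_integrable:
  assumes P: "locally_integrable P" shows "AE x in lborel. integrable \<eta> (P x)"
proof -
  note m[measurable] = locally_integrableD(1)[OF P]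
  have "AE x in lborel. slice_norm P x * indicator {-real n..real n} x \<noteq> \<infinity>" for n
    using locally_integrableD(2)[OF P, of "real n"] by (intro nn_integral_PInf_AE) auto
  then have "AE x in lborel. \<forall>n. slice_norm P x * indicator {-real n..real n} x \<noteq> \<infinity>"
    by (simp add: AE_all_countable)
  then show ?thesis
  proof eventually_elim
    case (elim x)
    obtain n where "\<bar>x\<bar> \<le> real n" using real_arch_simple by blast
    then have "slice_norm P x < \<infinity>"
      using elim[rule_format, of n] by (auto simp: indicator_def abs_le_iff less_top)
    moreover have "P x \<in> borel_measurable \<eta>" using measurable_Pair2[OF m, of x] by simp
    ultimately show ?case by (intro integrableI_bounded) auto
  qed
qed

lemma locally_integrable_Fubini:
  assumes P: "locally_integrable P" and [measurable]: "g \<in> borel_measurable borel"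
    and g: "\<And>x. \<bar>g x\<bar> \<le> C" "\<And>x. \<bar>x\<bar> > R \<Longrightarrow> g x = 0"
  shows "integrable lborel (\<lambda>x. g x * (LINT z|\<eta>. P x z))"
    "integrable \<eta> (\<lambda>z. \<integral>x. g x * P x z \<partial>lborel)"
    "(LBINT x. g x * (LINT z|\<eta>. P x z)) = (LINT z|\<eta>. (LBINT x. g x * P x z))"
proof -
  note m[measurable] = locally_integrableD(1)[OF P]
  have C: "C \<ge> 0" using g(1)[of 0] by simp
  have i: "integrable (lborel \<Otimes>\<^sub>M \<eta>) (\<lambda>(x, z). g x * P x z)"
  proof (rule integrableI_bounded)
    have "(\<integral>\<^sup>+ p. ennreal (norm (case p of (x, z) \<Rightarrow> g x * P x z)) \<partial>(lborel \<Otimes>\<^sub>M \<eta>)) =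
      (\<integral>\<^sup>+ x. (\<integral>\<^sup>+ z. ennreal \<bar>g x * P x z\<bar> \<partial>\<eta>) \<partial>lborel)"
      by (subst \<eta>.nn_integral_fst[symmetric]) (auto simp: split_beta')
    also have "\<dots> \<le> (\<integral>\<^sup>+ x. ennreal C * (slice_norm P x * indicator {-R..R} x) \<partial>lborel)"
    proof (rule nn_integral_mono)
      fix x
      have [measurable]: "P x \<in> borel_measurable \<eta>" using measurable_Pair2[OF m, of x] by simp
      show "(\<integral>\<^sup>+ z. ennreal \<bar>g x * P x z\<bar> \<partial>\<eta>) \<le> ennreal C * (slice_norm P x * indicator {-R..R} x)"
      proof (cases "\<bar>x\<bar> > R")
        case False
        have "(\<integral>\<^sup>+ z. ennreal \<bar>g x * P x z\<bar> \<partial>\<eta>) \<le> (\<integral>\<^sup>+ z. ennreal C * ennreal \<bar>P x z\<bar> \<partial>\<eta>)"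
          using g(1)[of x] C by (intro nn_integral_mono) (auto simp: abs_mult ennreal_mult'[symmetric] intro!: ennreal_leI mult_right_mono)
        also have "\<dots> = ennreal C * slice_norm P x" by (rule nn_integral_cmult) measurable
        finally show ?thesis using False by (auto simp: indicator_def)
      qed (simp add: g(2))
    qed
    also have "\<dots> = ennreal C * (\<integral>\<^sup>+ x. slice_norm P x * indicator {-R..R} x \<partial>lborel)"
      by (rule nn_integral_cmult) measurable
    also have "\<dots> < \<infinity>" using locally_integrableD(2)[OF P, of R] by (simp add: ennreal_mult_less_top)
    finally show "(\<integral>\<^sup>+ p. ennreal (norm (case p of (x, z) \<Rightarrow> g x * P x z)) \<partial>(lborel \<Otimes>\<^sub>M \<eta>)) < \<infinity>" .
  qed measurable
  show "integrable lborel (\<lambda>x. g x * (LINT z|\<eta>. P x z))"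
    using pair.integrable_fst[OF i] by simp
  show "integrable \<eta> (\<lambda>z. \<integral>x. g x * P x z \<partial>lborel)"
    using pair.integrable_snd[OF i] by simp
  show "(LBINT x. g x * (LINT z|\<eta>. P x z)) = (LINT z|\<eta>. (LBINT x. g x * P x z))"
    using pair.Fubini_integral[OF i] by simp
qed

end

text \<open>It rises just to the right of \<open>lo\<close> and falls just to the right of
  \<open>hi\<close>, so the pointwise limit is the indicator of the half-open interval that occurs
  in \<open>step\<close>. The slope is at least 1, which confines the support to
  [lo, hi + 1].\<close>

definition ramp :: "real \<Rightarrow> real \<Rightarrow> nat \<Rightarrow> real \<Rightarrow> real" where
  "ramp lo hi n y = max 0 (min 1 (min (real (Suc n) * (y - lo)) (1 - real (Suc n) * (y - hi))))"

lemma ramp_bounds: "0 \<le> ramp lo hi n y" "ramp lo hi n y \<le> 1" "\<bar>ramp lo hi n y\<bar> \<le> 1"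
  by (auto simp: ramp_def)

lemma ramp_outside: "y \<le> lo \<or> y \<ge> hi + 1 \<Longrightarrow> ramp lo hi n y = 0"
proof -
  assume "y \<le> lo \<or> y \<ge> hi + 1"
  then have "real (Suc n) * (y - lo) \<le> 0 \<or> real (Suc n) * (y - hi) \<ge> 1"
  proof
    assume "y \<ge> hi + 1"
    then have "1 * 1 \<le> real (Suc n) * (y - hi)" by (intro mult_mono) auto
    then show ?thesis by simp
  qed (auto intro: mult_nonneg_nonpos)
  then show ?thesis by (auto simp: ramp_def)
qed

lemma ramp_Cc: "\<bar>lo\<bar> \<le> R \<Longrightarrow> \<bar>hi\<bar> \<le> R \<Longrightarrow> ramp lo hi n \<in> Cc"
proof (rule CcI[where R="R+1"])
  show "continuous_on UNIV (ramp lo hi n)" unfolding ramp_def[abs_def] by (intro continuous_intros)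
qed (auto intro!: ramp_outside)

lemma ramp_tendsto: "(\<lambda>n. ramp lo hi n y) \<longlonglongrightarrow> indicator {lo<..hi} y"
proof -
  have ev: "\<forall>\<^sub>F n in sequentially. real (Suc n) * d \<ge> 1" if d: "d > 0" for d
  proof -
    obtain m where m: "inverse (real (Suc m)) < d" using reals_Archimedean[OF d] by blast
    show ?thesis
      using eventually_ge_at_top[of m]
    proof eventually_elim
      case (elim n)
      have "1 < real (Suc m) * d" using m by (simp add: field_simps)
      also have "\<dots> \<le> real (Suc n) * d" using elim d by (intro mult_right_mono) auto
      finally show ?case by simp
    qed
  qed
  consider "y \<le> lo" | "lo < y" "y \<le> hi" | "lo < y" "hi < y" by linarith
  then have "\<forall>\<^sub>F n in sequentially. indicator {lo<..hi} y = ramp lo hi n y"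
  proof cases
    case 1
    then show ?thesis by (simp add: ramp_outside)
  next
    case 2
    then have "real (Suc n) * (y - hi) \<le> 0" for n by (intro mult_nonneg_nonpos) auto
    then have le: "1 \<le> 1 - real (Suc n) * (y - hi)" for n by (simp add: algebra_simps)
    have aux: "max 0 (min 1 (min s t)) = 1" if "1 \<le> s" "1 \<le> t" for s t :: real using that by auto
    from 2 have "\<forall>\<^sub>F n in sequentially. 1 \<le> real (Suc n) * (y - lo)" by (intro ev) simp
    then show ?thesis
    proof eventually_elim
      case (elim n)
      show ?case unfolding ramp_def aux[OF elim le] using 2 by simp
    qed
  next
    case 3
    have aux: "max 0 (min 1 (min s (1 - t))) = 0" if "1 \<le> t" for s t :: real using that by auto
    from 3 have "\<forall>\<^sub>F n in sequentially. 1 \<le> real (Suc n) * (y - hi)" by (intro ev) simp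
    then show ?thesis
    proof eventually_elim
      case (elim n)
      show ?case unfolding ramp_def aux[OF elim] using 3 by simp
    qed
  qed
  then show ?thesis by (rule Lim_transform_eventually[OF tendsto_const])
qed

section \<open>The pieces of the kernels and their local integrability\<close>

locale volterra_fredholm_kernels = order_zero_kernels +
  fixes \<alpha> :: "real \<Rightarrow> real"
  assumes \<alpha>: "L1_loc \<eta> \<alpha>"
begin

lemma \<alpha>_measurable [measurable]: "\<alpha> \<in> borel_measurable borel"
  using \<alpha> by (simp add: L1_loc_def)

definition K_nu :: "real \<Rightarrow> real \<Rightarrow> real" where
  "K_nu x z = (LINT y|\<nu> z. step x (z + y) * (x - (z + y)))"

text \<open>\<open>V\<close> evaluated at a discontinuous function, outside the class covered by the
  order zero assumption.\<close>

definition K_mu :: "real \<Rightarrow> real \<Rightarrow> real" where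
  "K_mu x z = VI (step x) z"

definition K_rho :: "real \<Rightarrow> real \<Rightarrow> real" where
  "K_rho x z = enn2real (tail \<rho>' z (x - z))"

text \<open>The second kernel times \<open>step x z\<close>, so that an ordinary integral over
  \<open>\<eta>\<close> expresses the Volterra integral with its sign.\<close>

definition K_drift :: "real \<Rightarrow> real \<Rightarrow> real" where
  "K_drift x z = step x z * (\<alpha> z + (x - z) * mass z)"

lemma tail_parts_measurable:
  assumes k: "k \<in> borel_measurable M" and [measurable]: "t \<in> borel_measurable M"
  shows "(\<lambda>w. tail \<mu> (k w) (t w)) \<in> borel_measurable M" "(\<lambda>w. tail \<rho> (k w) (t w)) \<in> borel_measurable M"
proof -
  have e: "tail Q x t = (\<integral>\<^sup>+ y. ind_between y t \<partial>Q x)" if "sets (Q x) = sets borel" for Q x t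
    unfolding tail_eq_nn_integral[of Q x, OF that] by (intro nn_integral_cong) (simp add: indicator_def)
  show "(\<lambda>w. tail \<mu> (k w) (t w)) \<in> borel_measurable M" "(\<lambda>w. tail \<rho> (k w) (t w)) \<in> borel_measurable M"
    unfolding e[where Q=\<mu>, OF sets_parts(2)] e[where Q=\<rho>, OF sets_parts(3)]
    by (intro parts_nn_integral_measurable(2,3)[OF k]; measurable)+
qed

lemma tail_\<rho>'_measurable:
  assumes [measurable]: "k \<in> borel_measurable M" "t \<in> borel_measurable M"
  shows "(\<lambda>w. tail \<rho>' (k w) (t w)) \<in> borel_measurable M"
proof -
  have [measurable]: "(\<lambda>p. tail \<rho> (k (fst p)) (snd p)) \<in> borel_measurable (M \<Otimes>\<^sub>M lborel)"
    by (rule tail_parts_measurable(2)) measurable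
  have "(\<lambda>w. \<integral>\<^sup>+ y. tail \<rho> (k (fst (w, y))) (snd (w, y)) * ind_between y (t w) \<partial>lborel) \<in> borel_measurable M"
    by measurable
  moreover have "tail \<rho>' (k w) (t w) = (\<integral>\<^sup>+ y. tail \<rho> (k (fst (w, y))) (snd (w, y)) * ind_between y (t w) \<partial>lborel)" for w
  proof -
    have [measurable]: "tail \<rho> (k w) \<in> borel_measurable borel"
      by (rule tail_measurable) (simp_all add: sigma_finite_parts)
    have "tail \<rho>' (k w) (t w) = (\<integral>\<^sup>+ y. indicator {y. zbetween y (t w)} y \<partial>\<rho>' (k w))"
      by (rule tail_eq_nn_integral) simp
    also have "\<dots> = (\<integral>\<^sup>+ y. tail \<rho> (k w) y * indicator {y. zbetween y (t w)} y \<partial>lborel)"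
      unfolding integrated_tail_def by (subst nn_integral_density) auto
    also have "\<dots> = (\<integral>\<^sup>+ y. tail \<rho> (k (fst (w, y))) (snd (w, y)) * ind_between y (t w) \<partial>lborel)"
      by (intro nn_integral_cong) (simp add: indicator_def)
    finally show ?thesis .
  qed
  ultimately show ?thesis by simp
qed

text \<open>Because of the sign in its integrand, \<open>V\<close> is not monotone, and
  \<open>step x\<close> cannot be handled by domination with a cutoff. The approximating ramps all
  have support in [-(R + 1), R + 1], so one constant serves every \<open>x\<close> in
  [-R, R].\<close>

lemma V_step_bounded:
  "\<exists>C\<ge>0. \<forall>x. \<bar>x\<bar> \<le> R \<longrightarrow> (\<integral>\<^sup>+ z. ennreal \<bar>VI (step x) z\<bar> \<partial>\<eta>) \<le> ennreal C"
proof -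
  obtain C where C: "C \<ge> 0" and bound: "\<And>f. \<lbrakk>f \<in> Cc; \<And>x. \<bar>f x\<bar> \<le> 1; \<And>x. \<bar>x\<bar> > R + 1 \<Longrightarrow> f x = 0\<rbrakk>
      \<Longrightarrow> (LINT z|\<eta>. \<bar>VI f z\<bar>) \<le> C"
    using V_bounded[of "R + 1"] by blast
  show ?thesis
  proof (intro exI[of _ C] conjI C allI impI)
    fix x assume x: "\<bar>x\<bar> \<le> R"
    define lo hi where "lo = min 0 x" and "hi = max 0 x"
    have lh: "\<bar>lo\<bar> \<le> R" "\<bar>hi\<bar> \<le> R" using x by (auto simp: lo_def hi_def)
    have st: "step x = (\<lambda>w. (if x > 0 then 1 else -1) * indicator {lo<..hi} w)"
      by (auto simp: step_def lo_def hi_def indicator_def fun_eq_iff)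
    have cc: "ramp lo hi n \<in> Cc" for n by (rule ramp_Cc[OF lh])
    have [measurable]: "ramp lo hi n \<in> borel_measurable borel" for n by (rule Cc_borel[OF cc])
    have out: "ramp lo hi n w = 0" if "\<bar>w\<bar> > R + 1" for n w
      by (rule ramp_outside) (use that lh in auto)
    have V_eq: "\<bar>VI (step x) z\<bar> = \<bar>VI (indicator {lo<..hi}) z\<bar>" for z
      by (simp add: V_integrand_def st)
    have lim: "(\<lambda>n. VI (ramp lo hi n) z) \<longlonglongrightarrow> VI (indicator {lo<..hi}) z" for z
      by (rule V_integrand_tendsto[where C=1 and R="R+1"]) (auto intro: ramp_bounds out ramp_tendsto)
    have "(\<integral>\<^sup>+ z. ennreal \<bar>VI (step x) z\<bar> \<partial>\<eta>) = (\<integral>\<^sup>+ z. liminf (\<lambda>n. ennreal \<bar>VI (ramp lo hi n) z\<bar>) \<partial>\<eta>)"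
      unfolding V_eq
      by (intro nn_integral_cong, rule sym, rule lim_imp_Liminf) (auto intro!: tendsto_intros lim)
    also have "\<dots> \<le> liminf (\<lambda>n. \<integral>\<^sup>+ z. ennreal \<bar>VI (ramp lo hi n) z\<bar> \<partial>\<eta>)"
      using jump_functionals_integrable(2)[OF cc] by (intro nn_integral_liminf) auto
    also have "\<dots> \<le> liminf (\<lambda>n::nat. ennreal C)"
    proof (intro Liminf_mono always_eventually allI)
      fix n
      have "(\<integral>\<^sup>+ z. ennreal \<bar>VI (ramp lo hi n) z\<bar> \<partial>\<eta>) = ennreal (LINT z|\<eta>. \<bar>VI (ramp lo hi n) z\<bar>)"
        using jump_functionals_integrable(2)[OF cc] by (intro nn_integral_eq_integral) auto
      then show "(\<integral>\<^sup>+ z. ennreal \<bar>VI (ramp lo hi n) z\<bar> \<partial>\<eta>) \<le> ennreal C"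
        using bound[OF cc ramp_bounds(3) out] by (simp add: ennreal_leI)
    qed
    also have "\<dots> = ennreal C" by (simp add: Liminf_const)
    finally show "(\<integral>\<^sup>+ z. ennreal \<bar>VI (step x) z\<bar> \<partial>\<eta>) \<le> ennreal C" .
  qed
qed

lemma locally_integrableI:
  assumes m: "(\<lambda>(x, z). P x z) \<in> borel_measurable (borel \<Otimes>\<^sub>M borel)"
    and b: "\<And>R. R \<ge> 0 \<Longrightarrow> \<exists>C<\<infinity>. \<forall>x. \<bar>x\<bar> \<le> R \<longrightarrow> slice_norm P x \<le> C"
  shows "locally_integrable P"
  unfolding locally_integrable_def
proof (intro conjI allI m)
  fix R :: real
  obtain C where C: "C < \<infinity>" "\<And>x. \<bar>x\<bar> \<le> \<bar>R\<bar> \<Longrightarrow> slice_norm P x \<le> C"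
    using b[of "\<bar>R\<bar>"] by auto
  have "(\<integral>\<^sup>+ x. slice_norm P x * indicator {-R..R} x \<partial>lborel) \<le>
    (\<integral>\<^sup>+ x. C * indicator {-R..R} x \<partial>lborel)"
  proof (rule nn_integral_mono)
    fix x
    show "slice_norm P x * indicator {-R..R} x \<le> C * indicator {-R..R} x"
      using C(2)[of x] by (auto simp: indicator_def)
  qed
  also have "\<dots> = C * emeasure lborel {-R..R}" by (simp add: nn_integral_cmult)
  also have "\<dots> < \<infinity>" using C(1) by (cases "-R \<le> R") (auto simp: ennreal_mult_less_top)
  finally show "(\<integral>\<^sup>+ x. slice_norm P x * indicator {-R..R} x \<partial>lborel) < \<infinity>" .
qed

lemma locally_integrable_K_mu: "locally_integrable K_mu"
proof (rule locally_integrableI)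
  have [measurable]: "(\<lambda>p. enn2real (tail \<mu> (snd (fst p)) (snd p))) \<in> borel_measurable ((borel \<Otimes>\<^sub>M borel) \<Otimes>\<^sub>M lborel)"
    by (intro borel_measurable_enn2real tail_parts_measurable(1)) measurable
  have "(\<lambda>w. \<integral>t. enn2real (tail \<mu> (snd (fst (w, t))) (snd (w, t))) * (step (fst (fst (w, t))) (snd (fst (w, t)) + snd (w, t)) * sgn t) \<partial>lborel)
      \<in> borel_measurable (borel \<Otimes>\<^sub>M borel)" by measurable
  moreover have "K_mu x z = (LBINT t. enn2real (tail \<mu> z t) * (step x (z + t) * sgn t))" for x z
    unfolding K_mu_def V_integrand_def
    by (rule integral_integrated_tail(1)) (auto simp: sigma_finite_parts tail_\<mu>_finite)
  ultimately show "(\<lambda>(x, z). K_mu x z) \<in> borel_measurable (borel \<Otimes>\<^sub>M borel)" by (simp add: split_beta')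
  fix R :: real
  show "\<exists>C<\<infinity>. \<forall>x. \<bar>x\<bar> \<le> R \<longrightarrow> slice_norm K_mu x \<le> C"
    using V_step_bounded[of R] unfolding K_mu_def by (metis ennreal_less_top infinity_ennreal_def)
qed

lemma integrable_K_nu: "integrable (\<nu> z) (\<lambda>y. step x (z + y) * (x - (z + y)))"
proof -
  interpret finite_measure "\<nu> z" by (rule finite_measure_\<nu>)
  show ?thesis by (rule integrable_const_bound[of _ "\<bar>x\<bar>"], rule AE_I2, unfold real_norm_def, rule step_bounds) measurable
qed

text \<open>The integrand is nonnegative and at most \<open>R\<close> times a cutoff at
  \<open>z + y\<close>. Integrating the cutoff over \<open>\<nu> z\<close> gives \<open>U\<close> of
  the cutoff plus the cutoff times the mass, and both are integrable.\<close>

lemma locally_integrable_K_nu: "locally_integrable K_nu"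
proof (rule locally_integrableI)
  have nn: "K_nu x z = enn2real (\<integral>\<^sup>+ y. ennreal (step x (z + y) * (x - (z + y))) \<partial>\<nu> z)" for x z
    unfolding K_nu_def by (rule integral_eq_nn_integral) (auto simp: step_bounds)
  have "(\<lambda>p. (\<integral>\<^sup>+ y. ennreal (step (fst p) (snd p + y) * (fst p - (snd p + y))) \<partial>\<nu> (snd p))) \<in> borel_measurable (borel \<Otimes>\<^sub>M borel)"
  proof (rule parts_nn_integral_measurable(1))
    show "(\<lambda>(w, y). ennreal (step (fst w) (snd w + y) * (fst w - (snd w + y)))) \<in> borel_measurable ((borel \<Otimes>\<^sub>M borel) \<Otimes>\<^sub>M borel)"
      unfolding split_beta' by measurable
  qed measurable
  then show "(\<lambda>(x, z). K_nu x z) \<in> borel_measurable (borel \<Otimes>\<^sub>M borel)"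
    unfolding nn split_beta' by measurable
  fix R :: real assume R: "R \<ge> 0"
  have cc: "cutoff R \<in> Cc" by (rule CcI[where R="R+1"]) (auto simp: cutoff_simps)
  have i: "integrable (\<nu> z) (\<lambda>y. cutoff R (z + y))" for z
    by (rule U_integrable[OF Cc_borel[OF cc], of 1]) (simp add: cutoff_simps)
  define C where "C = ennreal R * ((\<integral>\<^sup>+ z. ennreal \<bar>UI (cutoff R) z\<bar> \<partial>\<eta>) + (\<integral>\<^sup>+ z. ennreal (mass z) * indicator {-(R+1)..R+1} z \<partial>\<eta>))"
  show "\<exists>C<\<infinity>. \<forall>x. \<bar>x\<bar> \<le> R \<longrightarrow> slice_norm K_nu x \<le> C"
  proof (intro exI[of _ C] conjI allI impI)
    show "C < \<infinity>" unfolding C_def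
      using mass_locally_integrable[of "R + 1"] R integrable_iff_bounded[of \<eta> "UI (cutoff R)"] jump_functionals_integrable(1)[OF cc]
      by (simp add: ennreal_mult_less_top)
    fix x assume x: "\<bar>x\<bar> \<le> R"
    have "slice_norm K_nu x \<le> (\<integral>\<^sup>+ z. ennreal R * (ennreal \<bar>UI (cutoff R) z\<bar> + ennreal (mass z) * indicator {-(R+1)..R+1} z) \<partial>\<eta>)"
    proof (rule nn_integral_mono)
      fix z
      have "0 \<le> K_nu x z" unfolding nn by simp
      have "K_nu x z \<le> (LINT y|\<nu> z. R * cutoff R (z + y))"
        unfolding K_nu_def
      proof (rule integral_mono[OF integrable_K_nu])
        show "integrable (\<nu> z) (\<lambda>y. R * cutoff R (z + y))" using i by simp
        fix y
        show "step x (z + y) * (x - (z + y)) \<le> R * cutoff R (z + y)"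
        proof (cases "\<bar>z + y\<bar> \<le> R")
          case True
          then show ?thesis using step_bounds(4)[of x "z + y"] x by (simp add: cutoff_simps)
        next
          case False
          then show ?thesis using step_bounds(2)[OF x, of "z + y"] R by (simp add: cutoff_simps)
        qed
      qed
      also have "\<dots> = R * (UI (cutoff R) z + cutoff R z * mass z)" by (simp add: U_integrand_def)
      also have "\<dots> \<le> R * (\<bar>UI (cutoff R) z\<bar> + mass z * indicator {-(R+1)..R+1} z)"
      proof (intro mult_left_mono add_mono R)
        show "cutoff R z * mass z \<le> mass z * indicator {-(R+1)..R+1} z"
          using cutoff_simps(3)[of R z] cutoff_simps(6)[of R z] 
          by (cases "\<bar>z\<bar> \<le> R + 1") (auto simp: indicator_def abs_le_iff intro: mult_left_le_one_le cutoff_simps)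
      qed simp
      finally have "ennreal (K_nu x z) \<le> ennreal (R * (\<bar>UI (cutoff R) z\<bar> + mass z * indicator {-(R+1)..R+1} z))"
        by (rule ennreal_leI)
      then show "ennreal \<bar>K_nu x z\<bar> \<le> ennreal R * (ennreal \<bar>UI (cutoff R) z\<bar> + ennreal (mass z) * indicator {-(R+1)..R+1} z)"
        using R \<open>0 \<le> K_nu x z\<close> by (auto simp: ennreal_mult' indicator_def split: if_splits)
    qed
    also have "\<dots> = C"
      unfolding C_def using jump_functionals_integrable(1)[OF cc]
      by (subst nn_integral_cmult, simp, subst nn_integral_add, auto)
    finally show "slice_norm K_nu x \<le> C" .
  qed
qed

lemma locally_integrable_K_drift: "locally_integrable K_drift"
proof (rule locally_integrableI)
  show "(\<lambda>(x, z). K_drift x z) \<in> borel_measurable (borel \<Otimes>\<^sub>M borel)"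
    unfolding K_drift_def split_beta' by measurable
  fix R :: real assume R: "R \<ge> 0"
  define C where "C = (\<integral>\<^sup>+ z. ennreal \<bar>indicator {-R..R} z * \<alpha> z\<bar> \<partial>\<eta>) + ennreal R * (\<integral>\<^sup>+ z. ennreal (mass z) * indicator {-R..R} z \<partial>\<eta>)"
  show "\<exists>C<\<infinity>. \<forall>x. \<bar>x\<bar> \<le> R \<longrightarrow> slice_norm K_drift x \<le> C"
  proof (intro exI[of _ C] conjI allI impI)
    have "integrable \<eta> (\<lambda>z. indicator {-R..R} z * \<alpha> z)"
      using \<alpha> unfolding L1_loc_def set_integrable_def by auto
    then show "C < \<infinity>" unfolding C_def
      using mass_locally_integrable[OF R] by (simp add: ennreal_mult_less_top integrable_iff_bounded)
    fix x assume x: "\<bar>x\<bar> \<le> R"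
    have "slice_norm K_drift x \<le> (\<integral>\<^sup>+ z. ennreal \<bar>indicator {-R..R} z * \<alpha> z\<bar> + ennreal R * (ennreal (mass z) * indicator {-R..R} z) \<partial>\<eta>)"
    proof (rule nn_integral_mono)
      fix z
      have "\<bar>K_drift x z\<bar> \<le> \<bar>indicator {-R..R} z * \<alpha> z\<bar> + R * (mass z * indicator {-R..R} z)"
      proof (cases "\<bar>z\<bar> \<le> R")
        case True
        have "\<bar>K_drift x z\<bar> \<le> \<bar>step x z\<bar> * \<bar>\<alpha> z\<bar> + \<bar>step x z * (x - z)\<bar> * mass z"
        proof -
          have "K_drift x z = step x z * \<alpha> z + (step x z * (x - z)) * mass z"
            by (simp add: K_drift_def algebra_simps)
          then have "\<bar>K_drift x z\<bar> \<le> \<bar>step x z * \<alpha> z\<bar> + \<bar>(step x z * (x - z)) * mass z\<bar>"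
            by (simp only: abs_triangle_ineq)
          then show ?thesis by (simp only: abs_mult abs_of_nonneg[OF measure_nonneg])
        qed
        also have "\<dots> \<le> 1 * \<bar>\<alpha> z\<bar> + R * mass z"
          using step_bounds(4)[of x z] x by (intro add_mono mult_right_mono step_bounds) auto
        finally show ?thesis using True by (auto simp: indicator_def)
      next
        case False
        then show ?thesis using step_bounds(2)[OF x, of z] by (simp add: K_drift_def indicator_def)
      qed
      then have "ennreal \<bar>K_drift x z\<bar> \<le> ennreal (\<bar>indicator {-R..R} z * \<alpha> z\<bar> + R * (mass z * indicator {-R..R} z))"
        by (rule ennreal_leI)
      then show "ennreal \<bar>K_drift x z\<bar> \<le> ennreal \<bar>indicator {-R..R} z * \<alpha> z\<bar> + ennreal R * (ennreal (mass z) * indicator {-R..R} z)"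
        using R by (auto simp: ennreal_mult' indicator_def split: if_splits)
    qed
    also have "\<dots> = C"
      unfolding C_def by (subst nn_integral_add, simp_all add: nn_integral_cmult)
    finally show "slice_norm K_drift x \<le> C" .
  qed
qed

text \<open>\<open>K_rho\<close>, as a function of \<open>x\<close>, is the density of the
  double-integrated tail moved to \<open>z\<close>, so pairing it with \<open>g\<close> is
  \<open>W\<close> itself.\<close>

lemma K_rho_shift:
  assumes [measurable]: "g \<in> borel_measurable borel"
  shows "(LBINT x. g x * K_rho x z) = WI g z"
proof -
  have "(LBINT x. g x * K_rho x z) = (LBINT t. g (z + t) * K_rho (z + t) z)"
    by (rule lborel_shift(1))
  also have "\<dots> = (LBINT t. enn2real (tail \<rho>' z t) * g (z + t))"
    by (simp add: K_rho_def mult.commute)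
  also have "\<dots> = (LINT t|integrated_tail \<rho>' z. g (z + t))"
    by (rule integral_integrated_tail(1)[symmetric]) (auto simp: sigma_finite_\<rho>' tail_\<rho>'_finite)
  finally show ?thesis by (simp add: W_integrand_def double_integrated_tail_def)
qed

lemma integrable_mult_K_rho:
  assumes g: "g \<in> Cc"
  shows "integrable lborel (\<lambda>x. g x * K_rho x z)"
proof -
  note [measurable] = Cc_borel[OF g]
  have "integrable lborel (\<lambda>t. enn2real (tail \<rho>' z t) * g (z + t))"
    using V_integrable_Cc(4)[OF g, of z]
    by (subst (asm) integral_integrated_tail(2)) (auto simp: sigma_finite_\<rho>' tail_\<rho>'_finite)
  then have "integrable lborel (\<lambda>t. g (z + t) * K_rho (z + t) z)"
    by (simp add: K_rho_def mult.commute)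
  then show ?thesis by (rule lborel_shift(2)[THEN iffD1])
qed

text \<open>Since \<open>K_rho\<close> is nonnegative, Tonelli's theorem reduces the claim to the
  integrability of \<open>W\<close> at a single cutoff.\<close>

lemma locally_integrable_K_rho: "locally_integrable K_rho"
  unfolding locally_integrable_def
proof (intro conjI allI)
  show m: "(\<lambda>(x, z). K_rho x z) \<in> borel_measurable (borel \<Otimes>\<^sub>M borel)"
    unfolding K_rho_def split_beta'
    by (intro borel_measurable_enn2real tail_\<rho>'_measurable) measurable
  have "sets (lborel \<Otimes>\<^sub>M \<eta>) = sets (borel \<Otimes>\<^sub>M borel)" by (rule sets_pair_measure_cong) auto
  then have m'[measurable]: "(\<lambda>(x, z). K_rho x z) \<in> borel_measurable (lborel \<Otimes>\<^sub>M \<eta>)"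
    using m by (simp cong: measurable_cong_sets)
  fix R :: real
  have cc: "cutoff \<bar>R\<bar> \<in> Cc" by (rule CcI[where R="\<bar>R\<bar>+1"]) (auto simp: cutoff_simps)
  note [measurable] = Cc_borel[OF cc]
  have K0: "0 \<le> K_rho x z" for x z by (simp add: K_rho_def)
  have "(\<integral>\<^sup>+ x. slice_norm K_rho x * indicator {-R..R} x \<partial>lborel) \<le>
     (\<integral>\<^sup>+ x. (\<integral>\<^sup>+ z. ennreal (cutoff \<bar>R\<bar> x * K_rho x z) \<partial>\<eta>) \<partial>lborel)"
  proof (rule nn_integral_mono)
    fix x
    show "slice_norm K_rho x * indicator {-R..R} x \<le> (\<integral>\<^sup>+ z. ennreal (cutoff \<bar>R\<bar> x * K_rho x z) \<partial>\<eta>)"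
      by (cases "\<bar>x\<bar> \<le> R") (auto simp: indicator_def cutoff_simps K0)
  qed
  also have "\<dots> = (\<integral>\<^sup>+ z. (\<integral>\<^sup>+ x. ennreal (cutoff \<bar>R\<bar> x * K_rho x z) \<partial>lborel) \<partial>\<eta>)"
    by (rule pair.Fubini'[symmetric]) measurable
  also have "\<dots> = (\<integral>\<^sup>+ z. ennreal (WI (cutoff \<bar>R\<bar>) z) \<partial>\<eta>)"
    using integrable_mult_K_rho[OF cc] by (intro nn_integral_cong) (subst nn_integral_eq_integral, auto simp: K0 cutoff_simps K_rho_shift)
  also have "\<dots> \<le> (\<integral>\<^sup>+ z. ennreal (norm (WI (cutoff \<bar>R\<bar>) z)) \<partial>\<eta>)"
    by (intro nn_integral_mono ennreal_leI) auto
  also have "\<dots> < \<infinity>"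
    using jump_functionals_integrable(3)[OF cc] by (simp add: integrable_iff_bounded)
  finally show "(\<integral>\<^sup>+ x. slice_norm K_rho x * indicator {-R..R} x \<partial>lborel) < \<infinity>" .
qed

end

section \<open>The kernels paired with second derivatives\<close>

context volterra_fredholm_kernels
begin

text \<open>Fubini's theorem for the sets \<open>B u\<close> that vary with \<open>u\<close>. The
  function \<open>H\<close> is there to express the joint measurability of this family.\<close>

lemma integral_measure_shifted:
  fixes H :: "real \<Rightarrow> real \<Rightarrow> real"
  assumes H: "(\<lambda>(u, w). H u w) \<in> borel_measurable (borel \<Otimes>\<^sub>M borel)"
    and J: "\<And>u w. 0 \<le> H u w" "\<And>u w. H u w \<le> indicator {-r..r} u"
    and B: "\<And>u. B u \<in> sets borel" "\<And>u w. H u w = indicator J u * indicator (B u) w"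
  shows "(LBINT u:J. measure (shifted \<nu> z) (B u)) = (LINT y|\<nu> z. (LBINT u. H u (z + y)))"
proof -
  interpret N: finite_measure "\<nu> z" by (rule finite_measure_\<nu>)
  interpret NL: pair_sigma_finite "\<nu> z" lborel ..
  note [measurable] = B(1)
  have [measurable]: "(\<lambda>p. H (snd p) (z + fst p)) \<in> borel_measurable (\<nu> z \<Otimes>\<^sub>M lborel)"
    using measurable_compose[of "\<lambda>p. (snd p, z + fst p)" "\<nu> z \<Otimes>\<^sub>M lborel" "borel \<Otimes>\<^sub>M borel", OF _ H] by simp
  have i: "integrable (\<nu> z \<Otimes>\<^sub>M lborel) (\<lambda>(y, u). H u (z + y))"
    by (rule integrable_pair_product_bound[where u="\<lambda>_. 1" and v="indicator {-r..r}"])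
      (use J in \<open>auto simp: split_beta' N.sigma_finite_measure_axioms lborel.sigma_finite_measure_axioms\<close>)
  have "(LBINT u:J. measure (shifted \<nu> z) (B u)) = (LBINT u. (LINT y|\<nu> z. H u (z + y)))"
    unfolding set_lebesgue_integral_def
  proof (intro Bochner_Integration.integral_cong refl)
    fix u
    have [measurable]: "B u \<in> sets borel" by (rule B)
    have "measure (shifted \<nu> z) (B u) = measure (\<nu> z) {y. y + z \<in> B u}"
      unfolding shifted_def by (subst measure_distr) (auto simp: vimage_def)
    also have "\<dots> = (LINT y|\<nu> z. indicator {y. y + z \<in> B u} y)"
      by simp
    finally have "measure (shifted \<nu> z) (B u) = (LINT y|\<nu> z. indicator (B u) (z + y))"
      by (simp add: indicator_def add.commute)
    then show "indicator J u *\<^sub>R measure (shifted \<nu> z) (B u) = (LINT y|\<nu> z. H u (z + y))"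
      by (simp add: B(2))
  qed
  also have "\<dots> = (LINT y|\<nu> z. (LBINT u. H u (z + y)))"
    by (rule NL.Fubini_integral[OF i])
  finally show ?thesis .
qed

lemma K_nu_eq:
  "x > 0 \<Longrightarrow> (LBINT u:{0<..x}. measure (shifted \<nu> z) {0<..u}) = K_nu x z"
  "x \<le> 0 \<Longrightarrow> (LBINT u:{x<..0}. measure (shifted \<nu> z) {u<..0}) = K_nu x z"
proof -
  assume x: "x > 0"
  have m: "(\<lambda>(u, w). indicator {0<..x} u * indicator {0<..u} w :: real) =
      (\<lambda>p. if 0 < fst p \<and> fst p \<le> x \<and> 0 < snd p \<and> snd p \<le> fst p then 1 else 0)"
    by (auto simp: indicator_def fun_eq_iff)
  have "(\<lambda>(u, w). indicator {0<..x} u * indicator {0<..u} w :: real) \<in> borel_measurable (borel \<Otimes>\<^sub>M borel)"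
    unfolding m by measurable
  then have "(LBINT u:{0<..x}. measure (shifted \<nu> z) {0<..u}) =
      (LINT y|\<nu> z. (LBINT u. indicator {0<..x} u * indicator {0<..u} (z + y)))"
    by (rule integral_measure_shifted[where r="\<bar>x\<bar>"]) (auto simp: indicator_def)
  then show "(LBINT u:{0<..x}. measure (shifted \<nu> z) {0<..u}) = K_nu x z"
    using x by (simp add: integral_indicator_pair K_nu_def)
next
  assume x: "x \<le> 0"
  have m: "(\<lambda>(u, w). indicator {x<..0} u * indicator {u<..0} w :: real) =
      (\<lambda>p. if x < fst p \<and> fst p \<le> 0 \<and> fst p < snd p \<and> snd p \<le> 0 then 1 else 0)"
    by (auto simp: indicator_def fun_eq_iff)
  have "(\<lambda>(u, w). indicator {x<..0} u * indicator {u<..0} w :: real) \<in> borel_measurable (borel \<Otimes>\<^sub>M borel)"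
    unfolding m by measurable
  then have "(LBINT u:{x<..0}. measure (shifted \<nu> z) {u<..0}) =
      (LINT y|\<nu> z. (LBINT u. indicator {x<..0} u * indicator {u<..0} (z + y)))"
    by (rule integral_measure_shifted[where r="\<bar>x\<bar>"]) (auto simp: indicator_def)
  then show "(LBINT u:{x<..0}. measure (shifted \<nu> z) {u<..0}) = K_nu x z"
    using x by (simp add: integral_indicator_pair K_nu_def)
qed

lemma K_mu_eq: "K_mu x z = (LBINT y. step x y * (sgn (y - z) * enn2real (tail \<mu> z (y - z))))"
proof -
  have "K_mu x z = (LBINT t. enn2real (tail \<mu> z t) * (step x (z + t) * sgn t))"
    unfolding K_mu_def V_integrand_def
    by (rule integral_integrated_tail(1)) (auto simp: sigma_finite_parts tail_\<mu>_finite)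
  also have "\<dots> = (LBINT y. step x y * (sgn (y - z) * enn2real (tail \<mu> z (y - z))))"
    by (subst (2) lborel_shift(1)[where z=z]) (simp add: mult_ac)
  finally show ?thesis .
qed

lemma kernel1_eq: "kernel1 \<nu> \<mu> \<rho> x z = - K_nu x z + K_mu x z - K_rho x z"
proof (cases "x > 0")
  case True
  then show ?thesis
    by (simp add: kernel1_def K_nu_eq K_rho_def)
      (simp add: K_mu_eq step_simps set_lebesgue_integral_def)
next
  case False
  then show ?thesis
    by (simp add: kernel1_def K_nu_eq K_rho_def)
      (simp add: K_mu_eq step_simps set_lebesgue_integral_def)
qed

lemma locally_integrable_kernel1: "locally_integrable (kernel1 \<nu> \<mu> \<rho>)"
proof -
  have "locally_integrable (\<lambda>x z. 0 * K_nu x z + (-1 * K_nu x z + (-1 * K_rho x z + K_mu x z)))"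
    by (intro locally_integrable_lincomb locally_integrable_K_nu locally_integrable_K_rho locally_integrable_K_mu) auto
  moreover have "kernel1 \<nu> \<mu> \<rho> = (\<lambda>x z. 0 * K_nu x z + (-1 * K_nu x z + (-1 * K_rho x z + K_mu x z)))"
    by (simp add: kernel1_eq fun_eq_iff)
  ultimately show ?thesis by simp
qed

text \<open>For fixed \<open>z\<close> the exchange is justified by the bound |x| for the integrand
  of \<open>K_nu\<close> and the finiteness of \<open>\<nu> z\<close>; then \<open>f\<close> is
  recovered from its second derivative.\<close>

lemma second_deriv_K_nu:
  assumes f: "f \<in> Cc_smooth"
  shows "integrable lborel (\<lambda>x. deriv (deriv f) x * K_nu x z)"
    "(LBINT x. deriv (deriv f) x * K_nu x z) = (LINT y|\<nu> z. f (z + y))"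
proof -
  let ?g = "deriv (deriv f)"
  have g: "?g \<in> Cc_smooth" using f by (intro Cc_smooth_props(4))
  note [measurable] = Cc_smooth_props(5)[OF g]
  obtain C R where C: "\<And>x. \<bar>?g x\<bar> \<le> C" "\<And>x. \<bar>x\<bar> > R \<Longrightarrow> ?g x = 0" "C \<ge> 0" "R \<ge> 0"
    by (blast intro: Cc_smooth_bounds[OF g])
  interpret N: finite_measure "\<nu> z" by (rule finite_measure_\<nu>)
  interpret NL: pair_sigma_finite "\<nu> z" lborel ..
  have i: "integrable (\<nu> z \<Otimes>\<^sub>M lborel) (\<lambda>(y, x). ?g x * (step x (z + y) * (x - (z + y))))"
  proof (rule integrable_pair_product_bound[where u="\<lambda>_. 1" and v="\<lambda>x. C * R * indicator {-R..R} x"])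
    fix y x
    show "\<bar>case (y, x) of (y, x) \<Rightarrow> ?g x * (step x (z + y) * (x - (z + y)))\<bar> \<le> 1 * (C * R * indicator {-R..R} x)"
    proof (cases "\<bar>x\<bar> > R")
      case False
      have "\<bar>?g x\<bar> * \<bar>step x (z + y) * (x - (z + y))\<bar> \<le> C * R"
        by (intro mult_mono C order_trans[OF step_bounds(4)]) (use False in auto)
      moreover have "x \<in> {-R..R}" using False by auto
      ultimately show ?thesis by (simp add: abs_mult mult.assoc)
    qed (simp add: C)
  qed (use C in \<open>auto simp: split_beta' N.sigma_finite_measure_axioms lborel.sigma_finite_measure_axioms\<close>)
  have e: "(LINT y|\<nu> z. ?g x * (step x (z + y) * (x - (z + y)))) = ?g x * K_nu x z" for x
    unfolding K_nu_def by simp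
  show "integrable lborel (\<lambda>x. ?g x * K_nu x z)"
    using NL.integrable_snd[OF i] by (simp only: e)
  have "(LBINT x. ?g x * K_nu x z) = (LINT y|\<nu> z. (LBINT x. ?g x * (step x (z + y) * (x - (z + y)))))"
    using NL.Fubini_integral[OF i] by (simp only: e)
  also have "\<dots> = (LINT y|\<nu> z. f (z + y))"
  proof -
    have "(LBINT x. ?g x * (step x w * (x - w))) = f w" for w
      using integral_step_second_deriv(4)[OF f, of w] by (simp add: mult_ac)
    then show ?thesis by (simp only:)
  qed
  finally show "(LBINT x. ?g x * K_nu x z) = (LINT y|\<nu> z. f (z + y))" .
qed

text \<open>If |x| is at most \<open>R\<close>, then \<open>step x (z + y)\<close> vanishes unless
  \<open>z + y\<close> lies in [-R, R]. This confines \<open>y\<close> to a bounded set, whose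
  measure under the integrated tail is finite.\<close>

lemma second_deriv_K_mu:
  assumes f: "f \<in> Cc_smooth"
  shows "integrable lborel (\<lambda>x. deriv (deriv f) x * K_mu x z)"
    "(LBINT x. deriv (deriv f) x * K_mu x z) = - VI (deriv f) z"
proof -
  let ?g = "deriv (deriv f)" and ?M = "integrated_tail \<mu> z"
  have g: "?g \<in> Cc_smooth" using f by (intro Cc_smooth_props(4))
  note [measurable] = Cc_smooth_props(5)[OF g]
  obtain C R where C: "\<And>x. \<bar>?g x\<bar> \<le> C" "\<And>x. \<bar>x\<bar> > R \<Longrightarrow> ?g x = 0" "C \<ge> 0" "R \<ge> 0"
    by (blast intro: Cc_smooth_bounds[OF g])
  interpret N: sigma_finite_measure ?M
    by (rule sigma_finite_integrated_tail) (simp_all add: sigma_finite_parts tail_\<mu>_finite)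
  interpret NL: pair_sigma_finite ?M lborel ..
  have i: "integrable (?M \<Otimes>\<^sub>M lborel) (\<lambda>(y, x). ?g x * (step x (z + y) * sgn y))"
  proof (rule integrable_pair_product_bound[where u="\<lambda>y. indicator {-R..R} (z + y)" and v="\<lambda>x. C * indicator {-R..R} x"])
    show "integrable ?M (\<lambda>y. indicator {-R..R} (z + y) :: real)"
      by (rule V_integrable(2)[where f="indicator {-R..R}" and C=1 and R=R]) (use C in \<open>auto simp: indicator_def\<close>)
    fix y x
    show "\<bar>case (y, x) of (y, x) \<Rightarrow> ?g x * (step x (z + y) * sgn y)\<bar> \<le> indicator {-R..R} (z + y) * (C * indicator {-R..R} x)"
    proof (cases "\<bar>x\<bar> > R \<or> \<bar>z + y\<bar> > R")
      case False
      have "\<bar>?g x\<bar> * (\<bar>step x (z + y)\<bar> * \<bar>sgn y\<bar>) \<le> C * (1 * 1)"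
        by (intro mult_mono C step_bounds) (auto simp: abs_sgn_eq C)
      moreover have "x \<in> {-R..R}" "z + y \<in> {-R..R}" using False by auto
      ultimately show ?thesis by (simp add: abs_mult)
    next
      case True
      then show ?thesis using step_bounds(2)[of x R "z + y"] C by (cases "\<bar>x\<bar> > R") auto
    qed
  qed (use C in \<open>auto simp: split_beta' N.sigma_finite_measure_axioms lborel.sigma_finite_measure_axioms\<close>)
  have e: "(LINT y|?M. ?g x * (step x (z + y) * sgn y)) = ?g x * K_mu x z" for x
    unfolding K_mu_def V_integrand_def by simp
  show "integrable lborel (\<lambda>x. ?g x * K_mu x z)"
    using NL.integrable_snd[OF i] by (simp only: e)
  have "(LBINT x. ?g x * K_mu x z) = (LINT y|?M. (LBINT x. ?g x * (step x (z + y) * sgn y)))"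
    using NL.Fubini_integral[OF i] by (simp only: e)
  also have "\<dots> = (LINT y|?M. - (deriv f (z + y) * sgn y))"
  proof -
    have "(LBINT x. ?g x * (step x w * c)) = - (deriv f w * c)" for w c
    proof -
      have "(LBINT x. ?g x * (step x w * c)) = (LBINT x. step x w * ?g x * c)"
        by (simp add: mult_ac)
      then show ?thesis using integral_step_second_deriv(2)[OF f, of w] by simp
    qed
    then show ?thesis by (simp only:)
  qed
  also have "\<dots> = - VI (deriv f) z"
    unfolding V_integrand_def by (rule Bochner_Integration.integral_minus)
  finally show "(LBINT x. ?g x * K_mu x z) = - VI (deriv f) z" .
qed

definition kernel :: "real \<Rightarrow> real \<Rightarrow> real" where
  "kernel x z = kernel1 \<nu> \<mu> \<rho> x z + K_drift x z"

lemma locally_integrable_kernel: "locally_integrable kernel"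
  using locally_integrable_lincomb[OF locally_integrable_kernel1 locally_integrable_K_drift, of 1] by (simp add: kernel_def[abs_def])

text \<open>The value of the operator at \<open>f\<close> without the second-order term b
  f''/2.\<close>

definition weak_action :: "(real \<Rightarrow> real) \<Rightarrow> real \<Rightarrow> real" where
  "weak_action f z = \<alpha> z * deriv f z + UI f z + VI (deriv f) z + WI (deriv (deriv f)) z"

text \<open>The mass term of \<open>K_drift\<close> contributes f(z) \<nu>(z, \<real>), which
  together with the contribution of \<open>- K_nu\<close> is minus the integrand of
  \<open>U\<close>. The remaining pieces give the other terms with the same sign.\<close>

lemma second_deriv_kernel:
  assumes f: "f \<in> Cc_smooth"
  shows "(LBINT x. deriv (deriv f) x * kernel x z) = - weak_action f z"
proof -
  let ?g = "deriv (deriv f)"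
  have g: "?g \<in> Cc_smooth" using f by (intro Cc_smooth_props(4))
  note S = integral_step_second_deriv[OF f, of z]
  have \<alpha>_eq: "?g x * K_drift x z = \<alpha> z * (step x z * ?g x) + mass z * (step x z * (x - z) * ?g x)" for x
    by (simp add: K_drift_def algebra_simps)
  have ia: "integrable lborel (\<lambda>x. ?g x * K_drift x z)"
    unfolding \<alpha>_eq using S by simp
  have a: "(LBINT x. ?g x * K_drift x z) = - \<alpha> z * deriv f z + mass z * f z"
    unfolding \<alpha>_eq using S by simp
  have ir: "integrable lborel (\<lambda>x. ?g x * K_rho x z)"
    by (rule integrable_mult_K_rho[OF Cc_smooth_props(3)[OF g]])
  have r: "(LBINT x. ?g x * K_rho x z) = WI ?g z"
    by (rule K_rho_shift[OF Cc_smooth_props(5)[OF g]])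
  have "(LBINT x. ?g x * kernel x z) =
    (LBINT x. - (?g x * K_nu x z) + (?g x * K_mu x z + (- (?g x * K_rho x z) + ?g x * K_drift x z)))"
    by (simp add: kernel_def kernel1_eq algebra_simps)
  also have "\<dots> = - (LBINT x. ?g x * K_nu x z) + ((LBINT x. ?g x * K_mu x z) +
      (- (LBINT x. ?g x * K_rho x z) + (LBINT x. ?g x * K_drift x z)))"
    using second_deriv_K_nu(1)[OF f, of z] second_deriv_K_mu(1)[OF f, of z] ir ia by simp
  also have "\<dots> = - weak_action f z"
    unfolding second_deriv_K_nu(2)[OF f] second_deriv_K_mu(2)[OF f] r a
    by (simp add: weak_action_def U_integrand_def algebra_simps)
  finally show ?thesis .
qed

lemma weak_action_integral:
  assumes f: "f \<in> Cc_smooth"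
  shows "integrable \<eta> (weak_action f)"
    "(LBINT x. deriv (deriv f) x * (LINT z|\<eta>. kernel x z)) = - (LINT z|\<eta>. weak_action f z)"
proof -
  have g: "deriv (deriv f) \<in> Cc_smooth" using f by (intro Cc_smooth_props(4))
  obtain C R where C: "\<And>x. \<bar>deriv (deriv f) x\<bar> \<le> C" "\<And>x. \<bar>x\<bar> > R \<Longrightarrow> deriv (deriv f) x = 0"
    by (blast intro: Cc_smooth_bounds[OF g])
  note F = locally_integrable_Fubini[OF locally_integrable_kernel Cc_smooth_props(5)[OF g] C]
  have "integrable \<eta> (\<lambda>z. - weak_action f z)" using F(2) by (simp add: second_deriv_kernel[OF f])
  from integrable_minus[OF this] show "integrable \<eta> (weak_action f)" by simp
  show "(LBINT x. deriv (deriv f) x * (LINT z|\<eta>. kernel x z)) = - (LINT z|\<eta>. weak_action f z)"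
    using F(3) by (simp add: second_deriv_kernel[OF f])
qed

end

section \<open>Equality of the signed measures\<close>

lemma sets_borel_open_intervals:
  "sets borel = sigma_sets UNIV (range (\<lambda>(a, b). {a<..<b::real}))"
proof -
  have "(\<lambda>(a, b). box a b) = (\<lambda>(a, b). {a<..<b::real})" by auto
  then show ?thesis unfolding borel_eq_box by (simp only:) simp
qed

text \<open>The restriction to \<open>{-R<..<R}\<close> turns the locally finite signed measures into finite ones.\<close>

lemma signed_measures_eq_on_borel:
  fixes p q :: "real \<Rightarrow> real"
  assumes s: "sets M = sets borel" "sets L = sets borel"
    and p: "\<And>R. set_integrable M {-R<..<R} p" and q: "\<And>R. set_integrable L {-R<..<R} q"
    and eq: "\<And>h. h \<in> Cc_smooth \<Longrightarrow> (LINT x|M. h x * p x) = (LINT x|L. h x * q x)"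
    and [measurable]: "p \<in> borel_measurable borel" "q \<in> borel_measurable borel"
    and B: "B \<in> sets borel" "bounded B"
  shows "(LINT x:B|M. p x) = (LINT x:B|L. q x)"
proof -
  note [measurable_cong] = s
  obtain R where R: "\<And>x. x \<in> B \<Longrightarrow> \<bar>x\<bar> < R"
    using B(2) by (metis bounded_pos_less real_norm_def)
  define I where "I = {-R<..<R}"
  have [measurable]: "I \<in> sets borel" by (simp add: I_def)
  define P where "P x = indicator I x * p x" for x
  define Q where "Q x = indicator I x * q x" for x
  have iP: "integrable M P" and iQ: "integrable L Q"
    using p[of R] q[of R] by (auto simp: P_def[abs_def] Q_def[abs_def] I_def set_integrable_def)
  have ind: "set_integrable M X P" "set_integrable L X Q" if "X \<in> sets borel" for X
    using integrable_mult_indicator[OF _ iP] integrable_mult_indicator[OF _ iQ] that s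
    unfolding set_integrable_def by auto
  have open_interval: "(LINT x:{a<..<b}|M. P x) = (LINT x:{a<..<b}|L. Q x)" for a b
  proof -
    \<comment> \<open>Clipping to {-R<..<R} places the bump where the restriction has no effect, so
      \<open>p\<close> and \<open>P\<close> have the same integrals against it.\<close>
    define h where "h = interval_bump (max a (-R)) (min b R)"
    have h: "h n \<in> Cc_smooth" for n unfolding h_def by (rule interval_bump_Cc_smooth)
    have [measurable]: "h n \<in> borel_measurable borel" for n by (rule Cc_smooth_props(5)[OF h])
    have hP: "h n x * p x = h n x * P x" "h n x * q x = h n x * Q x" for n x
      using interval_bump_outside[of x "max a (-R)" "min b R" n]
      by (auto simp: h_def P_def Q_def I_def indicator_def)
    have b: "\<bar>h n x\<bar> \<le> 1" for n x
      using interval_bump_bounds[of "max a (-R)" "min b R" n x] by (simp add: h_def)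
    have lim: "(\<lambda>n. h n x * P x) \<longlonglongrightarrow> indicator {a<..<b} x *\<^sub>R P x"
       "(\<lambda>n. h n x * Q x) \<longlonglongrightarrow> indicator {a<..<b} x *\<^sub>R Q x" for x
    proof -
      have "(\<lambda>n. h n x) \<longlonglongrightarrow> indicator {max a (-R)<..<min b R} x"
        unfolding h_def by (rule interval_bump_tendsto)
      from tendsto_mult_right[OF this, of "P x"] tendsto_mult_right[OF this, of "Q x"]
      show "(\<lambda>n. h n x * P x) \<longlonglongrightarrow> indicator {a<..<b} x *\<^sub>R P x"
        "(\<lambda>n. h n x * Q x) \<longlonglongrightarrow> indicator {a<..<b} x *\<^sub>R Q x"
        by (auto simp: P_def Q_def I_def indicator_def split: if_splits)
    qed
    have "(\<lambda>n. \<integral>x. h n x * P x \<partial>M) \<longlonglongrightarrow> (LINT x:{a<..<b}|M. P x)"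
      unfolding set_lebesgue_integral_def
    proof (rule integral_dominated_convergence[where w="\<lambda>x. \<bar>P x\<bar>"])
      show "AE x in M. norm (h n x * P x) \<le> \<bar>P x\<bar>" for n
        using mult_right_mono[OF b] by (auto simp: abs_mult)
    qed (use iP lim in \<open>auto simp: P_def[abs_def]\<close>)
    moreover have "(\<lambda>n. \<integral>x. h n x * Q x \<partial>L) \<longlonglongrightarrow> (LINT x:{a<..<b}|L. Q x)"
      unfolding set_lebesgue_integral_def
    proof (rule integral_dominated_convergence[where w="\<lambda>x. \<bar>Q x\<bar>"])
      show "AE x in L. norm (h n x * Q x) \<le> \<bar>Q x\<bar>" for n
        using mult_right_mono[OF b] by (auto simp: abs_mult)
    qed (use iQ lim in \<open>auto simp: Q_def[abs_def]\<close>)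
    moreover have "(LINT x|M. h n x * P x) = (LINT x|L. h n x * Q x)" for n
      using eq[OF h] by (simp only: hP)
    ultimately show ?thesis by (simp only:) (rule LIMSEQ_unique)
  qed
  \<comment> \<open>Complements in the induction below need equal total integrals. As
    \<open>P\<close> and \<open>Q\<close> vanish off {-R<..<R}, these are integrals over an open
    interval again.\<close>
  have total: "(LINT x|M. P x) = (LINT x|L. Q x)"
  proof -
    have "P x = indicator {-R<..<R} x *\<^sub>R P x" "Q x = indicator {-R<..<R} x *\<^sub>R Q x" for x
      by (auto simp: P_def Q_def I_def indicator_def)
    then show ?thesis using open_interval[of "-R" R] unfolding set_lebesgue_integral_def by (simp only:)
  qed
  have stable: "Int_stable (range (\<lambda>(a, b). {a<..<b::real}))"
  proof (rule Int_stableI)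
    fix X Y assume "X \<in> range (\<lambda>(a, b). {a<..<b::real})" "Y \<in> range (\<lambda>(a, b). {a<..<b::real})"
    then obtain a b c d where "X = {a<..<b}" "Y = {c<..<d}" by auto
    then have "X \<inter> Y = (\<lambda>(a, b). {a<..<b}) (max a c, min b d)" by auto
    then show "X \<inter> Y \<in> range (\<lambda>(a, b). {a<..<b::real})" by blast
  qed
  have generators: "range (\<lambda>(a, b). {a<..<b::real}) \<subseteq> Pow UNIV" by simp
  have "(LINT x:X|M. P x) = (LINT x:X|L. Q x)"
    if "X \<in> sigma_sets UNIV (range (\<lambda>(a, b). {a<..<b::real}))" for X
    using stable generators that
  proof (induction rule: sigma_sets_induct_disjoint)
    case (basic X)
    then show ?case using open_interval by auto
  next
    case empty
    then show ?case by (simp add: set_lebesgue_integral_def)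
  next
    case (compl X)
    then have X: "X \<in> sets borel" by (simp add: sets_borel_open_intervals)
    have c: "indicator (UNIV - X) x *\<^sub>R P x = P x - indicator X x *\<^sub>R P x"
      "indicator (UNIV - X) x *\<^sub>R Q x = Q x - indicator X x *\<^sub>R Q x" for x
      by (auto simp: indicator_def)
    show ?case
      using ind[OF X] iP iQ compl total
      unfolding set_lebesgue_integral_def c set_integrable_def by simp
  next
    case (union X)
    have X: "X i \<in> sets borel" for i
      using union(2) by (auto simp: sets_borel_open_intervals)
    have d: "\<And>i j. i \<noteq> j \<Longrightarrow> X i \<inter> X j = {}" using union(1) by (auto simp: disjoint_family_on_def)
    have "(LINT x:(\<Union>i. X i)|M. P x) = (\<Sum>i. LINT x:X i|M. P x)"
      by (rule lebesgue_integral_countable_add) (use X s d ind in auto)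
    moreover have "(LINT x:(\<Union>i. X i)|L. Q x) = (\<Sum>i. LINT x:X i|L. Q x)"
      by (rule lebesgue_integral_countable_add) (use X s d ind in auto)
    ultimately show ?case using union(3) by simp
  qed
  then have "(LINT x:B|M. P x) = (LINT x:B|L. Q x)"
    using B(1) by (simp add: sets_borel_open_intervals)
  moreover have "indicator B x *\<^sub>R P x = indicator B x *\<^sub>R p x" "indicator B x *\<^sub>R Q x = indicator B x *\<^sub>R q x" for x
    using R[of x] by (auto simp: P_def Q_def I_def indicator_def)
  ultimately show ?thesis unfolding set_lebesgue_integral_def by (simp only:)
qed

text \<open>For the opposite direction, from Borel sets to test functions. The measures are signed,
  so monotone convergence is replaced by dominated convergence, for which the bound on
  \<open>u\<close> is essential.\<close>

lemma signed_measures_eq_on_bounded_functions: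
  fixes p q u :: "real \<Rightarrow> real"
  assumes s: "sets M = sets borel" "sets L = sets borel"
    and p: "set_integrable M {-R..R} p" and q: "set_integrable L {-R..R} q"
    and eq: "\<And>B. B \<in> sets borel \<Longrightarrow> bounded B \<Longrightarrow> (LINT x:B|M. p x) = (LINT x:B|L. q x)"
    and [measurable]: "p \<in> borel_measurable borel" "q \<in> borel_measurable borel"
    and u: "u \<in> borel_measurable borel" "\<And>x. \<bar>u x\<bar> \<le> C"
  shows "(LINT x:{-R..R}|M. u x * p x) = (LINT x:{-R..R}|L. u x * q x)"
proof -
  note [measurable_cong] = s
  let ?I = "{-R..R}"
  have int: "set_integrable M ?I (\<lambda>x. v x * p x)" "set_integrable L ?I (\<lambda>x. v x * q x)"
    if [measurable]: "v \<in> borel_measurable borel" and v: "\<And>x. \<bar>v x\<bar> \<le> c" for v c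
  proof -
    have c: "\<bar>v x * y\<bar> \<le> \<bar>c * y\<bar>" for x y
      using v[of x] by (auto simp: abs_mult intro!: mult_right_mono)
    have "set_integrable M ?I (\<lambda>x. c * p x)" "set_integrable L ?I (\<lambda>x. c * q x)" using p q by auto
    then show "set_integrable M ?I (\<lambda>x. v x * p x)" "set_integrable L ?I (\<lambda>x. v x * q x)"
      unfolding set_integrable_def
      by (auto elim!: Bochner_Integration.integrable_bound intro!: AE_I2 simp: indicator_def c)
  qed
  \<comment> \<open>The bound is an existential premise, so that each approximating function in the
    induction may bring its own.\<close>
  have nonneg: "v \<in> borel_measurable borel \<Longrightarrow> (\<And>x. 0 \<le> v x) \<Longrightarrow> (\<exists>c. \<forall>x. v x \<le> c) \<Longrightarrow>
      (LINT x:?I|M. v x * p x) = (LINT x:?I|L. v x * q x)" for v :: "real \<Rightarrow> real"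
  proof (induction rule: borel_measurable_induct_real)
    case (set A)
    have "(LINT x:?I|M. indicator A x * p x) = (LINT x:A \<inter> ?I|M. p x)"
      "(LINT x:?I|L. indicator A x * q x) = (LINT x:A \<inter> ?I|L. q x)"
      unfolding set_lebesgue_integral_def by (auto intro!: Bochner_Integration.integral_cong simp: indicator_def)
    then show ?case using eq[of "A \<inter> ?I"] set by (simp add: bounded_Int)
  next
    case (mult v c)
    \<comment> \<open>For \<open>c = 0\<close> the boundedness of \<open>c * v\<close> says nothing
      about \<open>v\<close>, and the induction hypothesis is out of reach; but then both sides are
      0.\<close>
    show ?case
    proof (cases "c = 0")
      case False
      obtain d where d: "\<And>x. c * v x \<le> d" using mult by blast
      have "v x \<le> d / c" for x using d[of x] False \<open>0 \<le> c\<close> by (simp add: field_simps)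
      then have "(LINT x:?I|M. v x * p x) = (LINT x:?I|L. v x * q x)" using mult by blast
      then show ?thesis by (simp add: mult.assoc)
    qed simp
  next
    case (add v w)
    obtain d where d: "\<And>x. w x + v x \<le> d" using add.prems by blast
    have v: "\<And>x. v x \<le> d" and w: "\<And>x. w x \<le> d" using d add.hyps(2,4) by (smt (verit))+
    have eq: "(LINT x:?I|M. v x * p x) = (LINT x:?I|L. v x * q x)" "(LINT x:?I|M. w x * p x) = (LINT x:?I|L. w x * q x)"
      using add.IH v w by blast+
    have i: "set_integrable M ?I (\<lambda>x. v x * p x)" "set_integrable L ?I (\<lambda>x. v x * q x)"
      "set_integrable M ?I (\<lambda>x. w x * p x)" "set_integrable L ?I (\<lambda>x. w x * q x)"
      using int[of v d] int[of w d] add.hyps(1-4) v w by auto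
    show ?case using eq i by (simp add: distrib_right)
  next
    case (seq V)
    obtain d where d: "\<And>x. v x \<le> d" using seq by blast
    have le: "V i x \<le> v x" for i x
      using seq by (intro incseq_le[of "\<lambda>i. V i x"]) (auto simp: mono_def le_fun_def)
    have b: "\<bar>V i x\<bar> \<le> d" for i x using order_trans[OF le d] seq(2) by simp
    have e: "(LINT x:?I|M. V i x * p x) = (LINT x:?I|L. V i x * q x)" for i
      using seq.IH[of i] order_trans[OF le d] by blast
    have d0: "d \<ge> 0" using b[of 0 0] by linarith
    note [measurable] = seq(1)
    have lim: "(\<lambda>i. V i x) \<longlonglongrightarrow> v x" for x using seq by auto
    have [measurable]: "v \<in> borel_measurable borel" by (rule borel_measurable_LIMSEQ_real[OF lim seq(1)])
    have bd: "norm (indicator ?I x *\<^sub>R (V i x * y)) \<le> d * \<bar>indicator ?I x *\<^sub>R y\<bar>" for i x y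
      using mult_right_mono[OF b[of i x], of "\<bar>y\<bar>"] by (auto simp: indicator_def abs_mult)
    have "(\<lambda>i. LINT x:?I|M. V i x * p x) \<longlonglongrightarrow> (LINT x:?I|M. v x * p x)"
      unfolding set_lebesgue_integral_def
      by (rule integral_dominated_convergence[where w="\<lambda>x. d * \<bar>indicator ?I x *\<^sub>R p x\<bar>"])
        (use p bd in \<open>auto simp: set_integrable_def intro!: tendsto_intros lim\<close>)
    moreover have "(\<lambda>i. LINT x:?I|L. V i x * q x) \<longlonglongrightarrow> (LINT x:?I|L. v x * q x)"
      unfolding set_lebesgue_integral_def
      by (rule integral_dominated_convergence[where w="\<lambda>x. d * \<bar>indicator ?I x *\<^sub>R q x\<bar>"])
        (use q bd in \<open>auto simp: set_integrable_def intro!: tendsto_intros lim\<close>)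
    ultimately show ?case unfolding e by (rule LIMSEQ_unique)
  qed
  define up where "up x = max 0 (u x)" for x
  define un where "un x = max 0 (- u x)" for x
  note [measurable] = u(1)
  have m: "up \<in> borel_measurable borel" "un \<in> borel_measurable borel"
    unfolding up_def[abs_def] un_def[abs_def] by measurable
  have b: "\<bar>up x\<bar> \<le> C" "\<bar>un x\<bar> \<le> C" for x using u(2)[of x] by (auto simp: up_def un_def)
  have n: "0 \<le> up x" "0 \<le> un x" "up x \<le> C" "un x \<le> C" for x
    using b[of x] by (auto simp: up_def un_def)
  have d: "u x = up x - un x" for x by (auto simp: up_def un_def)
  have "(LINT x:?I|M. up x * p x) = (LINT x:?I|L. up x * q x)"
    "(LINT x:?I|M. un x * p x) = (LINT x:?I|L. un x * q x)"
    using n by (intro nonneg m exI[of _ C] allI; blast)+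
  then show ?thesis
    unfolding d left_diff_distrib
    by (simp only: set_integral_diff(2)[OF int(1)[OF m(1) b(1)] int(1)[OF m(2) b(2)]]
        set_integral_diff(2)[OF int(2)[OF m(1) b(1)] int(2)[OF m(2) b(2)]])
qed

section \<open>The integral equation and its weak form\<close>

context volterra_fredholm_kernels
begin

text \<open>The equation integrates the two kernels separately, \<open>kernel\<close> combines them.
  Linearity joins the two integrals only where both exist, hence for almost every \<open>x\<close>,
  which is enough for a density.\<close>

lemma equation_density:
  fixes G :: "real \<Rightarrow> real"
  assumes G: "\<And>x. G x = c1 * x + c2 + (LINT z|\<eta>. kernel1 \<nu> \<mu> \<rho> x z) + (LINT z|\<eta>. K_drift x z)"
  shows "G \<in> borel_measurable borel" "\<And>R. set_integrable lborel {-R..R} G"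
    "AE x in lborel. G x = c1 * x + c2 + (LINT z|\<eta>. kernel x z)"
    "\<And>h. h \<in> Cc_smooth \<Longrightarrow> (LBINT x. h x * G x) =
      (LBINT x. (c1 * x + c2) * h x) + (LBINT x. h x * (LINT z|\<eta>. kernel x z))"
    "\<And>h. h \<in> Cc_smooth \<Longrightarrow> integrable lborel (\<lambda>x. h x * (LINT z|\<eta>. kernel x z))"
proof -
  have int_borel: "(\<lambda>x. \<integral>z. P x z \<partial>\<eta>) \<in> borel_measurable borel" if "locally_integrable P" for P
  proof -
    note [measurable] = locally_integrable_measurable[OF that]
    have "(\<lambda>x. \<integral>z. P x z \<partial>\<eta>) \<in> borel_measurable lborel" by measurable
    then show ?thesis by simp
  qed
  note [measurable] = int_borel[OF locally_integrable_kernel1] int_borel[OF locally_integrable_K_drift] int_borel[OF locally_integrable_kernel]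
  show Gm[measurable]: "G \<in> borel_measurable borel" unfolding G[abs_def] by measurable
  show ae: "AE x in lborel. G x = c1 * x + c2 + (LINT z|\<eta>. kernel x z)"
    using locally_integrable_AE_integrable[OF locally_integrable_kernel1] locally_integrable_AE_integrable[OF locally_integrable_K_drift]
  proof eventually_elim
    case (elim x)
    have "(LINT z|\<eta>. kernel x z) = (LINT z|\<eta>. kernel1 \<nu> \<mu> \<rho> x z + K_drift x z)"
      by (simp add: kernel_def)
    then show ?case using elim by (simp add: G)
  qed
  have ik: "integrable lborel (\<lambda>x. h x * (LINT z|\<eta>. kernel x z))"
    if "h \<in> borel_measurable borel" "\<And>x. \<bar>h x\<bar> \<le> C" "\<And>x. \<bar>x\<bar> > R \<Longrightarrow> h x = 0" for h C R
    by (rule locally_integrable_Fubini(1)[OF locally_integrable_kernel that])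
  show "set_integrable lborel {-R..R} G" for R
  proof -
    have "integrable lborel (\<lambda>x. indicator {-R..R} x * (LINT z|\<eta>. kernel x z))"
      by (rule ik[where C=1 and R=R]) (auto simp: indicator_def)
    moreover have "integrable lborel (\<lambda>x. indicator {-R..R} x * (c1 * x + c2))"
      using borel_integrable_compact[of "{-R..R}" "\<lambda>x. c1 * x + c2"] by (simp add: continuous_intros)
    ultimately have "integrable lborel (\<lambda>x. indicator {-R..R} x * (c1 * x + c2) + indicator {-R..R} x * (LINT z|\<eta>. kernel x z))"
      by (intro Bochner_Integration.integrable_add)
    then have "integrable lborel (\<lambda>x. indicator {-R..R} x * G x)"
    proof (rule integrable_cong_AE_imp)
      show "AE x in lborel. indicator {-R..R} x * (c1 * x + c2) + indicator {-R..R} x * (LINT z|\<eta>. kernel x z) = indicator {-R..R} x * G x"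
        using ae by eventually_elim (simp add: algebra_simps)
    qed measurable
    then show ?thesis by (simp add: set_integrable_def)
  qed
  fix h assume h: "h \<in> Cc_smooth"
  note [measurable] = Cc_smooth_props(5)[OF h]
  obtain C R where C: "\<And>x. \<bar>h x\<bar> \<le> C" "\<And>x. \<bar>x\<bar> > R \<Longrightarrow> h x = 0"
    by (blast intro: Cc_smooth_bounds[OF h])
  show ih: "integrable lborel (\<lambda>x. h x * (LINT z|\<eta>. kernel x z))"
    by (rule ik[OF Cc_smooth_props(5)[OF h] C])
  have ih': "integrable lborel (\<lambda>x. (c1 * x + c2) * h x)"
    using Cc_smooth_moments_integrable[OF h] by (simp add: distrib_right mult.assoc)
  have "(LBINT x. h x * G x) = (LBINT x. (c1 * x + c2) * h x + h x * (LINT z|\<eta>. kernel x z))"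
  proof (rule integral_cong_AE)
    show "AE x in lborel. h x * G x = (c1 * x + c2) * h x + h x * (LINT z|\<eta>. kernel x z)"
      using ae by eventually_elim (simp add: algebra_simps)
  qed measurable
  also have "\<dots> = (LBINT x. (c1 * x + c2) * h x) + (LBINT x. h x * (LINT z|\<eta>. kernel x z))"
    by (rule Bochner_Integration.integral_add[OF ih' ih])
  finally show "(LBINT x. h x * G x) =
      (LBINT x. (c1 * x + c2) * h x) + (LBINT x. h x * (LINT z|\<eta>. kernel x z))" .
qed

lemma Cc_smooth_mult_integrable:
  assumes p: "L1_loc \<eta> p" and h: "h \<in> Cc_smooth"
  shows "integrable \<eta> (\<lambda>x. h x * p x)"
proof -
  have [measurable]: "p \<in> borel_measurable borel" using p by (simp add: L1_loc_def)
  have pI: "set_integrable \<eta> {-R..R} p" for R using p by (auto simp: L1_loc_def)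
  note [measurable] = Cc_smooth_props(5)[OF h]
  obtain C R where C: "\<And>x. \<bar>h x\<bar> \<le> C" "\<And>x. \<bar>x\<bar> > R \<Longrightarrow> h x = 0" "C \<ge> 0"
    by (blast intro: Cc_smooth_bounds[OF h])
  have "integrable \<eta> (\<lambda>x. C * (indicator {-R..R} x * p x))"
    using pI[of R] by (simp add: set_integrable_def)
  then show ?thesis
  proof (rule Bochner_Integration.integrable_bound)
    show "AE x in \<eta>. norm (h x * p x) \<le> norm (C * (indicator {-R..R} x * p x))"
    proof (rule AE_I2)
      fix x
      show "norm (h x * p x) \<le> norm (C * (indicator {-R..R} x * p x))"
        using C(2)[of x] C(3) mult_right_mono[OF C(1)[of x], of "\<bar>p x\<bar>"]
        by (cases "\<bar>x\<bar> > R") (auto simp: indicator_def abs_mult)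
    qed
  qed measurable
qed

text \<open>Testing with second derivatives loses exactly the affine densities, and the quantified
  constants make up for that loss. All integrability demands of the equation hold beforehand, so
  only the equality of the two measures is at stake.\<close>

lemma solves_iff_weak:
  assumes p: "L1_loc \<eta> p"
    and \<kappa>: "\<And>x z. step x z * k2 x z = K_drift x z"
  shows "(\<exists>c1 c2. solves_volterra_fredholm \<eta> p (\<lambda>x. c1 * x + c2) (kernel1 \<nu> \<mu> \<rho>) k2) \<longleftrightarrow>
    (\<forall>f\<in>Cc_smooth. (LINT x|\<eta>. deriv (deriv f) x * p x) + (LINT x|\<eta>. weak_action f x) = 0)"
    (is "?L \<longleftrightarrow> ?R")
proof -
  have [measurable]: "p \<in> borel_measurable borel" using p by (simp add: L1_loc_def)
  have pI: "set_integrable \<eta> {-R..R} p" for R using p by (auto simp: L1_loc_def)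
  have pB: "set_integrable \<eta> B p" if B: "B \<in> sets borel" "bounded B" for B
  proof -
    obtain R where "\<forall>x\<in>B. norm x \<le> R" using B(2) unfolding bounded_iff by blast
    then have "B \<subseteq> {-R..R}" by (auto simp: abs_le_iff)
    then show ?thesis using set_integrable_subset[OF pI] B(1) by simp
  qed
  define G where "G c1 c2 x = c1 * x + c2 + (LINT z|\<eta>. kernel1 \<nu> \<mu> \<rho> x z) + (LINT z|\<eta>. K_drift x z)" for c1 c2 x
  note Gp = equation_density[OF G_def]
  have volterra: "volterra_integral \<eta> x (k2 x) = (LINT z|\<eta>. K_drift x z)" for x
    unfolding \<kappa>[symmetric] volterra_integral_def set_lebesgue_integral_def
    by (auto simp: step_simps)
  have AE: "AE x in lborel. integrable \<eta> (kernel1 \<nu> \<mu> \<rho> x) \<and> set_integrable \<eta> ({0<..x} \<union> {x<..0}) (k2 x)"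
  proof -
    from locally_integrable_AE_integrable[OF locally_integrable_kernel1] locally_integrable_AE_integrable[OF locally_integrable_K_drift] show ?thesis
    proof eventually_elim
      case (elim x)
      have "indicator ({0<..x} \<union> {x<..0}) z *\<^sub>R k2 x z = (if x > 0 then 1 else -1) * K_drift x z" for z
        unfolding \<kappa>[symmetric] by (auto simp: step_simps)
      then have "set_integrable \<eta> ({0<..x} \<union> {x<..0}) (k2 x)"
        unfolding set_integrable_def using elim(2) by simp
      then show ?case using elim(1) by simp
    qed
  qed
  have GB: "set_integrable lborel B (G c1 c2)" if B: "B \<in> sets borel" "bounded B" for B c1 c2
  proof -
    obtain R where "\<forall>x\<in>B. norm x \<le> R" using B(2) unfolding bounded_iff by blast
    then have "B \<subseteq> {-R..R}" by (auto simp: abs_le_iff)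
    then show ?thesis using set_integrable_subset[OF Gp(2)] B(1) by simp
  qed
  have solves: "solves_volterra_fredholm \<eta> p (\<lambda>x. c1 * x + c2) (kernel1 \<nu> \<mu> \<rho>) k2 \<longleftrightarrow>
      (\<forall>B\<in>sets borel. bounded B \<longrightarrow> (LINT x:B|\<eta>. p x) = (LBINT x:B. G c1 c2 x))" for c1 c2
    unfolding solves_volterra_fredholm_def volterra Let_def G_def[symmetric] using AE pB GB by blast
  show ?thesis
  proof
    assume ?L
    then obtain c1 c2 where eq: "\<And>B. B \<in> sets borel \<Longrightarrow> bounded B \<Longrightarrow> (LINT x:B|\<eta>. p x) = (LBINT x:B. G c1 c2 x)"
      unfolding solves by blast
    show ?R
    proof
      fix f assume f: "f \<in> Cc_smooth"
      let ?g = "deriv (deriv f)"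
      have f': "deriv f \<in> Cc_smooth" by (rule Cc_smooth_props(4)[OF f])
      have g: "?g \<in> Cc_smooth" by (rule Cc_smooth_props(4)[OF f'])
      obtain C R where C: "\<And>x. \<bar>?g x\<bar> \<le> C" "\<And>x. \<bar>x\<bar> > R \<Longrightarrow> ?g x = 0"
        by (blast intro: Cc_smooth_bounds[OF g])
      have out: "indicator {-R..R} x *\<^sub>R (?g x * y) = ?g x * y" for x y
        using C(2)[of x] by (cases "\<bar>x\<bar> > R") (auto simp: indicator_def)
      have "(LINT x:{-R..R}|\<eta>. ?g x * p x) = (LINT x:{-R..R}|lborel. ?g x * G c1 c2 x)"
        by (rule signed_measures_eq_on_bounded_functions[OF _ _ pI Gp(2) eq _ Gp(1) Cc_smooth_props(5)[OF g] C(1)]) auto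
      then have "(LINT x|\<eta>. ?g x * p x) = (LBINT x. ?g x * G c1 c2 x)"
        unfolding set_lebesgue_integral_def out .
      also have "\<dots> = (LBINT x. (c1 * x + c2) * ?g x) - (LINT z|\<eta>. weak_action f z)"
        using Gp(4)[OF g] weak_action_integral(2)[OF f] by simp
      also have "(LBINT x. (c1 * x + c2) * ?g x) = c1 * (LBINT x. x * ?g x) + c2 * (LBINT x. ?g x)"
        using Cc_smooth_moments_integrable[OF g] by (simp add: distrib_right mult.assoc)
      also have "\<dots> = 0" using integral_deriv_moments[OF f'] integral_deriv_moments(1)[OF f] by simp
      finally show "(LINT x|\<eta>. ?g x * p x) + (LINT x|\<eta>. weak_action f x) = 0" by simp
    qed
  next
    assume R: ?R
    \<comment> \<open>\<open>L\<close> represents the left side of the equation minus the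
      contribution of both kernels. The weak form says that it vanishes on second derivatives; the
      affine density obtained from this supplies the constants.\<close>
    define L where "L h = (LINT x|\<eta>. h x * p x) - (LBINT x. h x * (LINT z|\<eta>. kernel x z))" for h
    note i1 = Cc_smooth_mult_integrable[OF p]
    note i2 = Gp(5)
    have "\<exists>c1 c2. \<forall>h\<in>Cc_smooth. L h = (LBINT x. (c1 * x + c2) * h x)"
    proof (rule functional_vanishing_on_second_derivatives)
      show "L (\<lambda>x. f x + g x) = L f + L g" if "f \<in> Cc_smooth" "g \<in> Cc_smooth" for f g
        using i1[OF that(1)] i1[OF that(2)] i2[OF that(1)] i2[OF that(2)] by (simp add: L_def distrib_right)
      show "L (\<lambda>x. c * f x) = c * L f" for c f
        by (simp add: L_def mult.assoc right_diff_distrib)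
      show "L (deriv (deriv f)) = 0" if f: "f \<in> Cc_smooth" for f
        using R f weak_action_integral(2)[OF f] by (simp add: L_def)
    qed
    then obtain c1 c2 where c: "\<And>h. h \<in> Cc_smooth \<Longrightarrow> L h = (LBINT x. (c1 * x + c2) * h x)" by blast
    have "(LINT x:B|\<eta>. p x) = (LBINT x:B. G c1 c2 x)" if B: "B \<in> sets borel" "bounded B" for B
    proof (rule signed_measures_eq_on_borel[OF _ _ _ _ _ _ _ B])
      show "set_integrable \<eta> {-R<..<R} p" "set_integrable lborel {-R<..<R} (G c1 c2)" for R
        by (simp_all add: pB GB bounded_Ioo)
      show "(LINT x|\<eta>. h x * p x) = (LBINT x. h x * G c1 c2 x)" if "h \<in> Cc_smooth" for h
        using c[OF that] Gp(4)[OF that] by (simp add: L_def)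
    qed (use Gp(1) in auto)
    then show ?L unfolding solves by blast
  qed
qed

end

text \<open>The product rule splits half of (b f')' into b f''/2 and b' f'/2. The latter joins the
  drift, which is how b' gets into the second kernel.\<close>

lemma Cc_smooth_operator_eq:
  assumes op: "levy_type_operator E N D A a b b' \<Lambda>" and D: "Cc_smooth \<subseteq> D"
    and conv: "convenient_decomposition \<Lambda> \<nu> \<mu> \<rho>" and f: "f \<in> Cc_smooth"
  shows "A f x = (a x + drift_correction \<nu> \<mu> \<rho> x + 1/2 * b' x) * deriv f x + 1/2 * b x * deriv (deriv f) x +
    U_integrand \<nu> f x + V_integrand \<mu> (deriv f) x + W_integrand \<rho> (deriv (deriv f)) x"
proof -
  interpret convenient_kernels \<Lambda> \<nu> \<mu> \<rho>
    using op conv by unfold_locales (auto simp: levy_type_operator_def)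
  have f': "deriv f \<in> Cc_smooth" "deriv (deriv f) \<in> Cc_smooth" using f by (auto intro: Cc_smooth_props(4))
  obtain g where g: "divergence_term b b' f g"
    and A: "A f x = a x * deriv f x + 1/2 * g x + (LINT y|\<Lambda> x. jump_integrand f x y)"
    and j: "integrable (\<Lambda> x) (jump_integrand f x)"
    using op D f unfolding levy_type_operator_def by blast
  have "deriv f field_differentiable at x" for x
    using Cc_smooth_props(1)[OF f'(1)] by (auto simp: field_differentiable_def)
  then have "g x = b' x * deriv f x + b x * deriv (deriv f) x"
    using g Cc_smooth_props(2)[OF f'(2)] by (simp add: divergence_term_def)
  then show ?thesis unfolding A jump_integral_eq[OF f j] by (simp add: algebra_simps)
qed

theorem theorem4p3:
  fixes E D :: "(real \<Rightarrow> real) set"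
    and N :: "(real \<Rightarrow> real) \<Rightarrow> real"
    and A :: "(real \<Rightarrow> real) \<Rightarrow> real \<Rightarrow> real"
    and a b b' :: "real \<Rightarrow> real"
    and \<Lambda> \<nu> \<mu> \<rho> :: "real \<Rightarrow> real measure"
    and \<eta> :: "real measure"
  assumes "levy_type_operator E N D A a b b' \<Lambda>"
    and "Cc_smooth \<subseteq> D"
    and "convenient_decomposition \<Lambda> \<nu> \<mu> \<rho>"
    and "radon_measure \<eta>"
    and "L1_loc \<eta> (\<lambda>x. a x + drift_correction \<nu> \<mu> \<rho> x)"
    and "W11_loc \<eta> b b'"
    and "order_zero (U_integrand \<nu>) \<eta>"
    and "order_zero (V_integrand \<mu>) \<eta>"
    and "order_zero (W_integrand \<rho>) \<eta>"
  shows "infinitesimally_invariant A \<eta> \<longleftrightarrow>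
    (\<exists>c\<^sub>1 c\<^sub>2. solves_volterra_fredholm \<eta>
       (\<lambda>x. 1/2 * b x)
       (\<lambda>x. c\<^sub>1 * x + c\<^sub>2)
       (kernel1 \<nu> \<mu> \<rho>)
       (kernel2 a b' \<nu> \<mu> \<rho>))"
proof -
  define \<alpha> where "\<alpha> x = a x + drift_correction \<nu> \<mu> \<rho> x + 1/2 * b' x" for x
  have b: "L1_loc \<eta> b" "L1_loc \<eta> b'" using assms(6) by (auto simp: W11_loc_def)
  have half: "L1_loc \<eta> (\<lambda>x. 1/2 * f x)" if "L1_loc \<eta> f" for f
    using that by (auto simp: L1_loc_def)
  have "L1_loc \<eta> \<alpha>"
    using assms(5) half[OF b(2)] unfolding \<alpha>_def[abs_def] L1_loc_def by (auto intro: set_integral_add)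
  then interpret volterra_fredholm_kernels \<Lambda> \<nu> \<mu> \<rho> \<eta> \<alpha>
    using assms by unfold_locales (auto simp: levy_type_operator_def)
  have p: "L1_loc \<eta> (\<lambda>x. 1/2 * b x)" by (rule half[OF b(1)])
  have A: "A f x = deriv (deriv f) x * (1/2 * b x) + weak_action f x" if "f \<in> Cc_smooth" for f x
    unfolding Cc_smooth_operator_eq[OF assms(1-3) that] weak_action_def \<alpha>_def by (simp add: algebra_simps)
  have int: "integrable \<eta> (\<lambda>x. deriv (deriv f) x * (1/2 * b x))" if f: "f \<in> Cc_smooth" for f
    by (intro Cc_smooth_mult_integrable[OF p] Cc_smooth_props(4) f)
  have "infinitesimally_invariant A \<eta> \<longleftrightarrow>
      (\<forall>f\<in>Cc_smooth. (LINT x|\<eta>. deriv (deriv f) x * (1/2 * b x)) + (LINT x|\<eta>. weak_action f x) = 0)"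
  proof -
    have "integrable \<eta> (A f) \<and> (LINT x|\<eta>. A f x) = (LINT x|\<eta>. deriv (deriv f) x * (1/2 * b x)) + (LINT x|\<eta>. weak_action f x)"
      if f: "f \<in> Cc_smooth" for f
    proof -
      have "A f = (\<lambda>x. deriv (deriv f) x * (1/2 * b x) + weak_action f x)" using A[OF f] by blast
      then show ?thesis
        using int[OF f] weak_action_integral(1)[OF f]
        by (simp only: Bochner_Integration.integrable_add Bochner_Integration.integral_add simp_thms)
    qed
    then show ?thesis unfolding infinitesimally_invariant_def by (metis (no_types, lifting))
  qed
  also have "\<dots> \<longleftrightarrow> (\<exists>c1 c2. solves_volterra_fredholm \<eta> (\<lambda>x. 1/2 * b x) (\<lambda>x. c1 * x + c2)
      (kernel1 \<nu> \<mu> \<rho>) (kernel2 a b' \<nu> \<mu> \<rho>))"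
    by (rule solves_iff_weak[OF p, symmetric]) (simp add: K_drift_def kernel2_def \<alpha>_def)
  finally show ?thesis .
qed

end
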